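(* Let $\phi$ be an action of the group $S$ (with involution $\mathfrak{I}(a)=a^{-1}$) on the set $X$, let $\alpha:S\times X\to\mathbb{C}\setminus\{0\}$ satisfy $$\alpha(ab,x)\overline{\alpha(ab,y)}=\alpha(a,\phi(b,x))\overline{\alpha(a,\phi(b,y))}\,\alpha(b,x)\overline{\alpha(b,y)}\quad (a,b\in S,\ x,y\in X)$$ and $\alpha(a\mathfrak{I}(a),x)=1$ for all $a\in S$, $x\in X$, and let $K$ be an $\mathcal{L}(\mathcal{H})$-valued $\phi$-invariant hermitian kernel on $X$, where $\mathcal{H}$ is a Kreĭn space, with a finite number of negative squares. Then $K$ has a projectively invariant Kolmogorov decomposition on a Pontryagin space, that is unique up to unitary equivalence.
   Context: A Kreĭn space is an indefinite inner product space $(\mathcal{H},[\cdot,\cdot])$ for which there is a positive inner product $\langle\cdot,\cdot\rangle$ turning $\mathcal{H}$ into a Hilbert space, and $J=J^*=J^{-1}$ on $\mathcal{H}$, with $[\xi,\eta]=\langle J\xi,\eta\rangle$. A Pontryagin space (here) is a Kreĭn space with finite negative signature, i.e. $\dim\ker(I+J)<\infty$. $\mathcal{L}(\mathcal{H},\mathcal{K})$ is the set of bounded linear operators; $T^\sharp$ is the adjoint with respect to the indefinite inner products; $U\in\mathcal{L}(\mathcal{K}_1,\mathcal{K}_2)$ is unitary if $U^\sharp U=I$ and $UU^\sharp=I$. Kernels. A hermitian kernel on $X$ is a map $K:X\times X\to\mathcal{L}(\mathcal{H})$ with $K(x,y)=K(y,x)^\sharp$. $\mathcal{F}_0(X,\mathcal{H})$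 is the vector space of finitely supported functions $X\to\mathcal{H}$, with inner product $[f,g]_K=\sum_{x,y\in X}[K(x,y)f(y),g(x)]_{\mathcal{H}}$. $K$ has $\kappa$ negative squares if $\kappa$ is the maximal dimension of the negative subspaces of $(\mathcal{F}_0(X,\mathcal{H}),[\cdot,\cdot]_K)$. A Kolmogorov decomposition of $K$ is a pair $(V;\mathcal{K})$ with $\mathcal{K}$ a Kreĭn space and $V(x)\in\mathcal{L}(\mathcal{H},\mathcal{K})$, $x\in X$, such that $K(x,y)=V(x)^\sharp V(y)$ and the linear span of $\bigcup_xV(x)\mathcal{H}$ is dense in $\mathcal{K}$. Two Kolmogorov decompositions $(V_1;\mathcal{K}_1)$, $(V_2;\mathcal{K}_2)$ of $K$ are unitarily equivalent if there is a unitary $\Phi\in\mathcal{L}(\mathcal{K}_1,\mathcal{K}_2)$ with $V_2(x)=\Phi V_1(x)$ for all $x\in X$. Uniqueness up to unitary equivalence means that any two projectively invariant Kolmogorov decompositions of $K$ are unitarily equivalent. Action and invariance. An action satisfies $\phi(a,\phi(b,x))=\phi(ab,x)$ and $\phi(e,x)=x$, with $e$ the unit of $S$. With $\alpha$ as in the claim, $\sigma(a,b)=\alpha(a,\phi(b,x))^{-1}\alpha(b,x)^{-1}\alpha(ab,x)$, which is independent of $x$ and has modulus one. $K$ is $\phi$-invariant if $K(x,\phi(a,y))=\overline{\alpha(a,\phi(\mathfrak{I}(a),x))}\,\alpha(a,y)\,K(\phi(\mathfrak{I}(a),x),y)$ for all $x,y\in X$, $a\in S$. A projective representation of $S$ on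 $\mathcal{K}$ is a map $U:S\to\mathcal{L}(\mathcal{K})$ with $U(a)U(b)=\sigma(a,b)U(ab)$. A Kolmogorov decomposition $(V;\mathcal{K})$ is projectively invariant if there is a projective representation $U$ of $S$ on $\mathcal{K}$ with $V(\phi(a,x))=\alpha(a,x)U(a)V(x)$ for all $x\in X$, $a\in S$. *)

theory Defs
  imports
    "HOL-Analysis.Analysis"
    "HOL-Algebra.Group_Action"
    "HOL-Library.Function_Algebras"
begin

section \<open>Complex vector spaces\<close>

class complex_vector = ab_group_add +
  fixes scaleC :: "complex \<Rightarrow> 'a \<Rightarrow> 'a" (infixr \<open>*\<^sub>C\<close> 75)
  assumes scaleC_add_right: "a *\<^sub>C (x + y) = a *\<^sub>C x + a *\<^sub>C y"
    and scaleC_add_left: "(a + b) *\<^sub>C x = a *\<^sub>C x + b *\<^sub>C x"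
    and scaleC_scaleC: "a *\<^sub>C b *\<^sub>C x = (a * b) *\<^sub>C x"
    and scaleC_one: "1 *\<^sub>C x = x"

global_interpretation complex_vector: vector_space "scaleC :: complex \<Rightarrow> 'a \<Rightarrow> 'a :: complex_vector"
  by unfold_locales (simp_all add: scaleC_add_right scaleC_add_left scaleC_scaleC scaleC_one)

instantiation "fun" :: (type, complex_vector) complex_vector
begin

definition scaleC_fun_def: "c *\<^sub>C f = (\<lambda>x. c *\<^sub>C f x)"

instance
  by standard
    (simp_all add: scaleC_fun_def plus_fun_def scaleC_add_right scaleC_add_left scaleC_scaleC scaleC_one)

end

text \<open>Finite-dimensionality is needed next to \<^const>\<open>vector_space.dim\<close>, which is 0 on
  infinite-dimensional subspaces.\<close>

definition finite_dim :: "'v::complex_vector set \<Rightarrow> bool" where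
  "finite_dim N \<longleftrightarrow> (\<exists>B. finite B \<and> N \<subseteq> complex_vector.span B)"


section \<open>Inner product spaces on a carrier\<close>

text \<open>A space is a linear subspace of the ambient type together with a form, which is linear in
  its first argument.  The values of the form, and of operators, off the carrier are irrelevant.\<close>

record 'v inner_space = "'v partial_object" +
  form :: "'v \<Rightarrow> 'v \<Rightarrow> complex"

definition inner_product_space :: "'v::complex_vector inner_space \<Rightarrow> bool" where
  "inner_product_space K \<longleftrightarrow>
     complex_vector.subspace (carrier K) \<and>
     (\<forall>x\<in>carrier K. \<forall>y\<in>carrier K. \<forall>z\<in>carrier K. form K (x + y) z = form K x z + form K y z) \<and>
     (\<forall>c. \<forall>x\<in>carrier K. \<forall>y\<in>carrier K. form K (c *\<^sub>C x) y = c * form K x y) \<and>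
     (\<forall>x\<in>carrier K. \<forall>y\<in>carrier K. form K y x = cnj (form K x y))"

definition ip_norm :: "'v::complex_vector inner_space \<Rightarrow> 'v \<Rightarrow> real" where
  "ip_norm G x = sqrt (Re (form G x x))"

text \<open>The value 0 off the carrier is there because \<^locale>\<open>Metric_space\<close> requires nonnegativity
  and symmetry on the whole type.\<close>

definition ip_dist :: "'v::complex_vector inner_space \<Rightarrow> 'v \<Rightarrow> 'v \<Rightarrow> real" where
  "ip_dist G x y = (if x \<in> carrier G \<and> y \<in> carrier G then ip_norm G (x - y) else 0)"

definition hilbert_space :: "'v::complex_vector inner_space \<Rightarrow> bool" where
  "hilbert_space G \<longleftrightarrow>
     inner_product_space G \<and>
     (\<forall>x\<in>carrier G. x \<noteq> 0 \<longrightarrow> Re (form G x x) > 0) \<and>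
     Metric_space.mcomplete (carrier G) (ip_dist G)"

definition linear_op ::
  "'v::complex_vector inner_space \<Rightarrow> 'w::complex_vector inner_space \<Rightarrow> ('v \<Rightarrow> 'w) \<Rightarrow> bool" where
  "linear_op K1 K2 T \<longleftrightarrow>
     T \<in> carrier K1 \<rightarrow> carrier K2 \<and>
     (\<forall>x\<in>carrier K1. \<forall>y\<in>carrier K1. T (x + y) = T x + T y) \<and>
     (\<forall>c. \<forall>x\<in>carrier K1. T (c *\<^sub>C x) = c *\<^sub>C T x)"


section \<open>Krein and Pontryagin spaces\<close>

text \<open>\<open>G\<close> is the Hilbert space structure and \<open>J = J\<^sup>* = J\<^sup>-\<^sup>1\<close> the symmetry; as a linear
  \<open>G\<close>-isometry, \<open>J\<close> is automatically bounded.\<close>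

definition fundamental ::
  "'v::complex_vector inner_space \<Rightarrow> 'v inner_space \<Rightarrow> ('v \<Rightarrow> 'v) \<Rightarrow> bool" where
  "fundamental K G J \<longleftrightarrow>
     carrier G = carrier K \<and> hilbert_space G \<and> linear_op G G J \<and>
     (\<forall>x\<in>carrier G. \<forall>y\<in>carrier G. form G (J x) y = form G x (J y)) \<and>
     (\<forall>x\<in>carrier G. J (J x) = x) \<and>
     (\<forall>x\<in>carrier G. \<forall>y\<in>carrier G. form K x y = form G (J x) y)"

definition krein_space :: "'v::complex_vector inner_space \<Rightarrow> bool" where
  "krein_space K \<longleftrightarrow> inner_product_space K \<and> (\<exists>G J. fundamental K G J)"

definition pontryagin_space :: "'v::complex_vector inner_space \<Rightarrow> bool" where
  "pontryagin_space K \<longleftrightarrow>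
     inner_product_space K \<and>
     (\<exists>G J. fundamental K G J \<and> finite_dim {x \<in> carrier K. x + J x = 0})"

text \<open>Any two Hilbert inner products associated with the same Krein space have equivalent norms,
  so boundedness and density do not depend on which one is used.\<close>

definition bounded_ops ::
  "'v::complex_vector inner_space \<Rightarrow> 'w::complex_vector inner_space \<Rightarrow> ('v \<Rightarrow> 'w) set" where
  "bounded_ops K1 K2 =
     {T. linear_op K1 K2 T \<and>
         (\<exists>G1 J1 G2 J2. fundamental K1 G1 J1 \<and> fundamental K2 G2 J2 \<and>
            (\<exists>M. \<forall>x\<in>carrier K1. ip_norm G2 (T x) \<le> M * ip_norm G1 x))}"

definition dense_in :: "'v::complex_vector inner_space \<Rightarrow> 'v set \<Rightarrow> bool" where
  "dense_in K A \<longleftrightarrow>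
     (\<exists>G J. fundamental K G J \<and>
        Metric_space.mtopology (carrier G) (ip_dist G) closure_of A = carrier K)"

text \<open>The adjoint with respect to the indefinite forms, \<open>[T x, y] = [x, T\<^sup>\<sharp> y]\<close>.\<close>

definition adj ::
  "'v::complex_vector inner_space \<Rightarrow> 'w::complex_vector inner_space \<Rightarrow> ('v \<Rightarrow> 'w) \<Rightarrow> 'w \<Rightarrow> 'v" where
  "adj K1 K2 T y =
     (THE z. z \<in> carrier K1 \<and> (\<forall>x\<in>carrier K1. form K2 (T x) y = form K1 x z))"

definition unitary_op ::
  "'v::complex_vector inner_space \<Rightarrow> 'w::complex_vector inner_space \<Rightarrow> ('v \<Rightarrow> 'w) \<Rightarrow> bool" where
  "unitary_op K1 K2 U \<longleftrightarrow>
     U \<in> bounded_ops K1 K2 \<and>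
     (\<forall>x\<in>carrier K1. adj K1 K2 U (U x) = x) \<and>
     (\<forall>y\<in>carrier K2. U (adj K1 K2 U y) = y)"


section \<open>Hermitian kernels\<close>

definition hermitian_kernel ::
  "'x set \<Rightarrow> 'h::complex_vector inner_space \<Rightarrow> ('x \<Rightarrow> 'x \<Rightarrow> 'h \<Rightarrow> 'h) \<Rightarrow> bool" where
  "hermitian_kernel X H K \<longleftrightarrow>
     (\<forall>x\<in>X. \<forall>y\<in>X. K x y \<in> bounded_ops H H) \<and>
     (\<forall>x\<in>X. \<forall>y\<in>X. \<forall>h\<in>carrier H. K x y h = adj H H (K y x) h)"

text \<open>The finitely supported functions \<open>X \<rightarrow> H\<close> are represented by their extensions by 0; the
  double sum over \<open>X\<close> is written over the supports.\<close>

definition finsupp_space ::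
  "'x set \<Rightarrow> 'h::complex_vector inner_space \<Rightarrow> ('x \<Rightarrow> 'x \<Rightarrow> 'h \<Rightarrow> 'h) \<Rightarrow> ('x \<Rightarrow> 'h) inner_space" where
  "finsupp_space X H K =
     \<lparr>carrier = {f. f \<in> X \<rightarrow> carrier H \<and> (\<forall>x. x \<notin> X \<longrightarrow> f x = 0) \<and> finite {x. f x \<noteq> 0}},
      form = (\<lambda>f g. \<Sum>x\<in>{x. g x \<noteq> 0}. \<Sum>y\<in>{y. f y \<noteq> 0}. form H (K x y (f y)) (g x))\<rparr>"

definition negative_subspace :: "'v::complex_vector inner_space \<Rightarrow> 'v set \<Rightarrow> bool" where
  "negative_subspace F N \<longleftrightarrow>
     complex_vector.subspace N \<and> N \<subseteq> carrier F \<and> (\<forall>f\<in>N. f \<noteq> 0 \<longrightarrow> Re (form F f f) < 0)"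

definition has_negative_squares ::
  "'x set \<Rightarrow> 'h::complex_vector inner_space \<Rightarrow> ('x \<Rightarrow> 'x \<Rightarrow> 'h \<Rightarrow> 'h) \<Rightarrow> nat \<Rightarrow> bool" where
  "has_negative_squares X H K \<kappa> \<longleftrightarrow>
     (\<exists>N. negative_subspace (finsupp_space X H K) N \<and> finite_dim N \<and> complex_vector.dim N = \<kappa>) \<and>
     (\<forall>N. negative_subspace (finsupp_space X H K) N \<longrightarrow> finite_dim N \<and> complex_vector.dim N \<le> \<kappa>)"

definition kolmogorov_decomposition ::
  "'x set \<Rightarrow> 'h::complex_vector inner_space \<Rightarrow> ('x \<Rightarrow> 'x \<Rightarrow> 'h \<Rightarrow> 'h) \<Rightarrow>
   ('x \<Rightarrow> 'h \<Rightarrow> 'k) \<Rightarrow> 'k::complex_vector inner_space \<Rightarrow> bool" where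
  "kolmogorov_decomposition X H K V L \<longleftrightarrow>
     krein_space L \<and>
     (\<forall>x\<in>X. V x \<in> bounded_ops H L) \<and>
     (\<forall>x\<in>X. \<forall>y\<in>X. \<forall>h\<in>carrier H. K x y h = adj H L (V x) (V y h)) \<and>
     dense_in L (complex_vector.span (\<Union>x\<in>X. V x ` carrier H))"

definition unitarily_equivalent ::
  "'x set \<Rightarrow> 'h::complex_vector inner_space \<Rightarrow>
   ('x \<Rightarrow> 'h \<Rightarrow> 'k1) \<Rightarrow> 'k1::complex_vector inner_space \<Rightarrow>
   ('x \<Rightarrow> 'h \<Rightarrow> 'k2) \<Rightarrow> 'k2::complex_vector inner_space \<Rightarrow> bool" where
  "unitarily_equivalent X H V1 L1 V2 L2 \<longleftrightarrow>
     (\<exists>\<Phi>. unitary_op L1 L2 \<Phi> \<and> (\<forall>x\<in>X. \<forall>h\<in>carrier H. V2 x h = \<Phi> (V1 x h)))"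


section \<open>Invariance under a group action\<close>

text \<open>The cocycle \<open>\<sigma>\<close>, whose defining expression does not depend on the point of \<open>X\<close> under the
  assumptions on \<open>\<alpha>\<close>.  For empty \<open>X\<close> its value is arbitrary, but then the only space with a
  Kolmogorov decomposition is the zero space.\<close>

definition sigma ::
  "('s, 'm) monoid_scheme \<Rightarrow> 'x set \<Rightarrow> ('s \<Rightarrow> 'x \<Rightarrow> 'x) \<Rightarrow> ('s \<Rightarrow> 'x \<Rightarrow> complex) \<Rightarrow>
   's \<Rightarrow> 's \<Rightarrow> complex" where
  "sigma S X \<phi> \<alpha> a b =
     (let x = (SOME x. x \<in> X)
      in inverse (\<alpha> a (\<phi> b x)) * inverse (\<alpha> b x) * \<alpha> (a \<otimes>\<^bsub>S\<^esub> b) x)"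

definition invariant_kernel ::
  "('s, 'm) monoid_scheme \<Rightarrow> 'x set \<Rightarrow> ('s \<Rightarrow> 'x \<Rightarrow> 'x) \<Rightarrow> ('s \<Rightarrow> 'x \<Rightarrow> complex) \<Rightarrow>
   'h::complex_vector inner_space \<Rightarrow> ('x \<Rightarrow> 'x \<Rightarrow> 'h \<Rightarrow> 'h) \<Rightarrow> bool" where
  "invariant_kernel S X \<phi> \<alpha> H K \<longleftrightarrow>
     (\<forall>x\<in>X. \<forall>y\<in>X. \<forall>a\<in>carrier S. \<forall>h\<in>carrier H.
        K x (\<phi> a y) h =
          (cnj (\<alpha> a (\<phi> (inv\<^bsub>S\<^esub> a) x)) * \<alpha> a y) *\<^sub>C K (\<phi> (inv\<^bsub>S\<^esub> a) x) y h)"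

definition projective_representation ::
  "('s, 'm) monoid_scheme \<Rightarrow> 'x set \<Rightarrow> ('s \<Rightarrow> 'x \<Rightarrow> 'x) \<Rightarrow> ('s \<Rightarrow> 'x \<Rightarrow> complex) \<Rightarrow>
   'k::complex_vector inner_space \<Rightarrow> ('s \<Rightarrow> 'k \<Rightarrow> 'k) \<Rightarrow> bool" where
  "projective_representation S X \<phi> \<alpha> L U \<longleftrightarrow>
     (\<forall>a\<in>carrier S. U a \<in> bounded_ops L L) \<and>
     (\<forall>a\<in>carrier S. \<forall>b\<in>carrier S. \<forall>k\<in>carrier L.
        U a (U b k) = sigma S X \<phi> \<alpha> a b *\<^sub>C U (a \<otimes>\<^bsub>S\<^esub> b) k)"

definition projectively_invariant ::
  "('s, 'm) monoid_scheme \<Rightarrow> 'x set \<Rightarrow> ('s \<Rightarrow> 'x \<Rightarrow> 'x) \<Rightarrow> ('s \<Rightarrow> 'x \<Rightarrow> complex) \<Rightarrow>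
   'h::complex_vector inner_space \<Rightarrow> ('x \<Rightarrow> 'h \<Rightarrow> 'k) \<Rightarrow> 'k::complex_vector inner_space \<Rightarrow> bool" where
  "projectively_invariant S X \<phi> \<alpha> H V L \<longleftrightarrow>
     (\<exists>U. projective_representation S X \<phi> \<alpha> L U \<and>
        (\<forall>a\<in>carrier S. \<forall>x\<in>X. \<forall>h\<in>carrier H. V (\<phi> a x) h = \<alpha> a x *\<^sub>C U a (V x h)))"

end

theory Submission
  imports Defs
begin

text \<open>A negative orthonormal system \<open>B\<close> of maximal size among the finitely supported functions exists because
  \<open>K\<close> has finitely many negative squares; changing the sign of the span of \<open>B\<close> makes the form
  \<open>[f,g]\<^sub>K\<close> nonnegative. Completing with respect to the resulting seminorm inside the space of
  functions \<open>X \<rightarrow> H\<close> gives a reproducing kernel Pontryagin space, which carries a Kolmogorov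
  decomposition.

  In any Kolmogorov decomposition on a Krein space the images of the elements of \<open>B\<close> define in the same way a
  fundamental symmetry, by density. For these Hilbert norms the correspondence \<open>V1 f \<mapsto> V2 f\<close> between
  two decompositions is isometric, so it extends to a unitary operator. Since
  \<open>x \<mapsto> \<alpha>(a,x)\<^sup>-\<^sup>1 V(\<phi>(a,x))\<close> is again a decomposition of the invariant kernel \<open>K\<close> on the same space,
  uniqueness also provides the operators \<open>U(a)\<close>.

  Density is handled throughout as nondegeneracy of the pairing with the whole space, and boundedness as
  existence of an adjoint; neither refers to a choice of Hilbert norm.\<close>

section \<open>Inner product spaces\<close>

text \<open>The obstacle is that \<open>finsupp_space X H K\<close> is in general neither complete
  nor nondegenerate, and that a map preserving an indefinite form on a dense subspace may fail to be
  bounded. One device meets both difficulties: a reflection in finitely many vectors is a formula in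
  the form and these vectors alone, so it makes sense on the functions and in every decomposition,
  without a projection theorem and without a quotient. With the same \<open>B\<close> used in two
  decompositions, the Hilbert norm of the vector coming from a function f is determined by f and K,
  and this is what makes the correspondence bounded in both directions. The other source of
  estimates is the Hellinger-Toeplitz theorem. It yields in particular the continuity of point
  evaluations, for which the hypotheses on K contain no direct bound; this continuity is the reason
  why limits of Cauchy sequences can be formed pointwise, as functions with values in H.\<close>

lemma cnj_mult_self: "cnj z * z = of_real ((cmod z)\<^sup>2)"
  using complex_norm_square[of z] by (simp add: mult.commute)

locale ips =
  fixes G :: "'v::complex_vector inner_space"
  assumes inner_product: "inner_product_space G"
begin

lemma subspace_carrier: "complex_vector.subspace (carrier G)"
  using inner_product by (simp add: inner_product_space_def)

lemma zero_mem [simp, intro]: "0 \<in> carrier G"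
  by (rule complex_vector.subspace_0[OF subspace_carrier])

lemma add_mem [simp, intro]: "\<lbrakk>x \<in> carrier G; y \<in> carrier G\<rbrakk> \<Longrightarrow> x + y \<in> carrier G"
  by (rule complex_vector.subspace_add[OF subspace_carrier])

lemma diff_mem [simp, intro]: "\<lbrakk>x \<in> carrier G; y \<in> carrier G\<rbrakk> \<Longrightarrow> x - y \<in> carrier G"
  by (rule complex_vector.subspace_diff[OF subspace_carrier])

lemma scale_mem [simp, intro]: "x \<in> carrier G \<Longrightarrow> c *\<^sub>C x \<in> carrier G"
  by (rule complex_vector.subspace_scale[OF subspace_carrier])

lemma sum_mem [simp, intro]: "(\<And>i. i \<in> I \<Longrightarrow> f i \<in> carrier G) \<Longrightarrow> sum f I \<in> carrier G"
  by (rule complex_vector.subspace_sum[OF subspace_carrier])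

lemma form_commute: "\<lbrakk>x \<in> carrier G; y \<in> carrier G\<rbrakk> \<Longrightarrow> form G y x = cnj (form G x y)"
  using inner_product unfolding inner_product_space_def by blast

lemma form_add_left:
  "\<lbrakk>x \<in> carrier G; y \<in> carrier G; z \<in> carrier G\<rbrakk> \<Longrightarrow> form G (x + y) z = form G x z + form G y z"
  using inner_product unfolding inner_product_space_def by blast

lemma form_scale_left:
  "\<lbrakk>x \<in> carrier G; y \<in> carrier G\<rbrakk> \<Longrightarrow> form G (c *\<^sub>C x) y = c * form G x y"
  using inner_product unfolding inner_product_space_def by blast

lemma form_add_right:
  "\<lbrakk>x \<in> carrier G; y \<in> carrier G; z \<in> carrier G\<rbrakk> \<Longrightarrow> form G x (y + z) = form G x y + form G x z"
  by (simp add: form_commute[of _ x] form_add_left)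

lemma form_scale_right:
  "\<lbrakk>x \<in> carrier G; y \<in> carrier G\<rbrakk> \<Longrightarrow> form G x (c *\<^sub>C y) = cnj c * form G x y"
  by (simp add: form_commute[of _ x] form_scale_left)

lemma form_zero_left [simp]: "x \<in> carrier G \<Longrightarrow> form G 0 x = 0"
  using form_scale_left[of 0 x 0] by simp

lemma form_zero_right [simp]: "x \<in> carrier G \<Longrightarrow> form G x 0 = 0"
  using form_commute[of 0 x] by simp

lemma form_diff_left:
  assumes "x \<in> carrier G" "y \<in> carrier G" "z \<in> carrier G"
  shows "form G (x - y) z = form G x z - form G y z"
  using form_add_left[of "x - y" y z] assms by simp

lemma form_diff_right:
  assumes "x \<in> carrier G" "y \<in> carrier G" "z \<in> carrier G"
  shows "form G x (y - z) = form G x y - form G x z"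
  using form_add_right[of x "y - z" z] assms by simp

lemma form_sum_left:
  assumes "\<And>i. i \<in> I \<Longrightarrow> f i \<in> carrier G" "x \<in> carrier G"
  shows "form G (sum f I) x = (\<Sum>i\<in>I. form G (f i) x)"
  using assms by (induction I rule: infinite_finite_induct) (simp_all add: form_add_left)

lemma form_sum_right:
  assumes "\<And>i. i \<in> I \<Longrightarrow> f i \<in> carrier G" "x \<in> carrier G"
  shows "form G x (sum f I) = (\<Sum>i\<in>I. form G x (f i))"
  using assms by (induction I rule: infinite_finite_induct) (simp_all add: form_add_right)

lemmas form_simps = form_add_left form_add_right form_diff_left form_diff_right
  form_scale_left form_scale_right

lemma form_self: "x \<in> carrier G \<Longrightarrow> form G x x = of_real (Re (form G x x))"
  using arg_cong[OF form_commute[of x x], of Im] by (simp add: complex_eq_iff)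

end

text \<open>Null vectors are allowed: the reflected form on finitely supported functions is in
  general only semidefinite, and its quotient is never formed. Cauchy-Schwarz and the completion
  have to work for a seminorm.\<close>

locale psd_ips = ips +
  assumes form_nonneg: "x \<in> carrier G \<Longrightarrow> 0 \<le> Re (form G x x)"
begin

lemma norm_ge_0 [simp]: "x \<in> carrier G \<Longrightarrow> 0 \<le> ip_norm G x"
  by (simp add: ip_norm_def form_nonneg)

lemma norm_power2: "x \<in> carrier G \<Longrightarrow> (ip_norm G x)\<^sup>2 = Re (form G x x)"
  by (simp add: ip_norm_def form_nonneg)

lemma norm_power2_complex: "x \<in> carrier G \<Longrightarrow> of_real ((ip_norm G x)\<^sup>2) = form G x x"
  using form_self[of x] by (simp add: norm_power2)

lemma norm_zero [simp]: "ip_norm G 0 = 0"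
  by (simp add: ip_norm_def)

lemma norm_scale: "x \<in> carrier G \<Longrightarrow> ip_norm G (c *\<^sub>C x) = cmod c * ip_norm G x"
proof -
  assume x: "x \<in> carrier G"
  have "form G (c *\<^sub>C x) (c *\<^sub>C x) = of_real ((cmod c)\<^sup>2) * form G x x"
    using x cnj_mult_self[of c] by (simp add: form_simps mult.assoc[symmetric])
  then have "Re (form G (c *\<^sub>C x) (c *\<^sub>C x)) = (cmod c)\<^sup>2 * Re (form G x x)"
    by simp
  then show ?thesis
    by (simp add: ip_norm_def real_sqrt_mult)
qed

lemma norm_diff_expand:
  assumes "x \<in> carrier G" "y \<in> carrier G"
  shows "(ip_norm G (x - c *\<^sub>C y))\<^sup>2 =
    (ip_norm G x)\<^sup>2 - 2 * Re (cnj c * form G x y) + (cmod c)\<^sup>2 * (ip_norm G y)\<^sup>2"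
proof -
  have yx: "form G y x = cnj (form G x y)" by (rule form_commute[OF assms])
  have "form G (x - c *\<^sub>C y) (x - c *\<^sub>C y) = form G x x - (cnj c * form G x y + cnj (cnj c * form G x y))
      + c * cnj c * form G y y"
    using assms by (simp add: form_simps yx algebra_simps)
  then have "form G (x - c *\<^sub>C y) (x - c *\<^sub>C y) = form G x x - of_real (2 * Re (cnj c * form G x y))
      + of_real ((cmod c)\<^sup>2) * form G y y"
    by (simp only: complex_add_cnj complex_norm_square)
  then have "Re (form G (x - c *\<^sub>C y) (x - c *\<^sub>C y)) = Re (form G x x) - 2 * Re (cnj c * form G x y)
      + (cmod c)\<^sup>2 * Re (form G y y)"
    by simp
  then show ?thesis
    using assms by (simp add: norm_power2)
qed

lemma Cauchy_Schwarz:
  assumes x: "x \<in> carrier G" and y: "y \<in> carrier G"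
  shows "cmod (form G x y) \<le> ip_norm G x * ip_norm G y"
proof -
  define p where "p = (cmod (form G x y))\<^sup>2"
  define a where "a = (ip_norm G x)\<^sup>2"
  define b where "b = (ip_norm G y)\<^sup>2"
  have nonneg: "p \<ge> 0" "b \<ge> 0" "a \<ge> 0" by (simp_all add: p_def b_def a_def)
  \<comment> \<open>This is the squared seminorm of \<open>x - c y\<close> with
    \<open>c = t [x,y]\<close>, a choice that makes the mixed term real and equal to
    \<open>t * p\<close>.\<close>
  have key: "0 \<le> a - 2 * t * p + t\<^sup>2 * p * b" for t :: real
  proof -
    have "cnj (of_real t * form G x y) * form G x y = of_real t * (cnj (form G x y) * form G x y)"
      by simp
    also have "\<dots> = of_real (t * p)"
      by (simp only: cnj_mult_self p_def of_real_mult)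
    finally have "Re (cnj (of_real t * form G x y) * form G x y) = t * p"
      by (simp only: Re_complex_of_real)
    then have "(ip_norm G (x - (of_real t * form G x y) *\<^sub>C y))\<^sup>2 = a - 2 * (t * p) + t\<^sup>2 * p * b"
      unfolding norm_diff_expand[OF x y] by (simp add: a_def b_def p_def norm_mult power_mult_distrib)
    then show ?thesis
      by (metis zero_le_power2 mult.assoc)
  qed
  have "p \<le> a * b"
  proof (cases "b = 0")
    case True
    have "p = 0"
    proof (rule ccontr)
      assume "p \<noteq> 0"
      \<comment> \<open>For a null vector y the inequality is linear in t, and at this t it reads
        \<open>0 \<le> a - 2 (a + 1)\<close>.\<close>
      then show False
        using key[of "(a + 1) / p"] True nonneg by simp
    qed
    then show ?thesis by (simp add: nonneg)
  next
    case False
    \<comment> \<open>The quadratic in t has its minimum at \<open>1 / b\<close>.\<close>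
    then show ?thesis
      using key[of "1 / b"] nonneg by (simp add: field_simps power2_eq_square)
  qed
  then have "(cmod (form G x y))\<^sup>2 \<le> (ip_norm G x * ip_norm G y)\<^sup>2"
    by (simp add: p_def a_def b_def power_mult_distrib)
  then show ?thesis
    by (rule power2_le_imp_le) (simp add: x y)
qed

lemma norm_diff_commute: "\<lbrakk>x \<in> carrier G; y \<in> carrier G\<rbrakk> \<Longrightarrow> ip_norm G (x - y) = ip_norm G (y - x)"
  using norm_scale[of "y - x" "-1"] by simp

lemma norm_triangle:
  assumes x: "x \<in> carrier G" and y: "y \<in> carrier G"
  shows "ip_norm G (x + y) \<le> ip_norm G x + ip_norm G y"
proof -
  have "(ip_norm G (x + y))\<^sup>2 = (ip_norm G x)\<^sup>2 + 2 * Re (form G x y) + (ip_norm G y)\<^sup>2"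
    using norm_diff_expand[OF x y, of "-1"] by simp
  also have "\<dots> \<le> (ip_norm G x + ip_norm G y)\<^sup>2"
    using Cauchy_Schwarz[OF x y] complex_Re_le_cmod[of "form G x y"]
    by (simp add: power2_sum)
  finally show ?thesis
    by (rule power2_le_imp_le) (simp add: x y)
qed

lemma norm_triangle_diff:
  assumes "x \<in> carrier G" "y \<in> carrier G" "z \<in> carrier G"
  shows "ip_norm G (x - z) \<le> ip_norm G (x - y) + ip_norm G (y - z)"
  using norm_triangle[of "x - y" "y - z"] assms by simp

lemma norm_diff_ineq:
  assumes "x \<in> carrier G" "y \<in> carrier G"
  shows "\<bar>ip_norm G x - ip_norm G y\<bar> \<le> ip_norm G (x - y)"
  using norm_triangle_diff[of x y 0] norm_triangle_diff[of y x 0] norm_diff_commute[of x y] assms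
  by simp

lemma norm_tendsto:
  assumes "\<And>n. s n \<in> carrier G" "x \<in> carrier G" "(\<lambda>n::nat. ip_norm G (s n - x)) \<longlonglongrightarrow> 0"
  shows "(\<lambda>n. ip_norm G (s n)) \<longlonglongrightarrow> ip_norm G x"
proof -
  have "(\<lambda>n. ip_norm G (s n) - ip_norm G x) \<longlonglongrightarrow> 0"
    by (rule Lim_null_comparison[OF _ assms(3)]) (simp add: norm_diff_ineq assms)
  then show ?thesis by (simp add: LIM_zero_iff)
qed

lemma form_tendsto_left:
  assumes "\<And>n. s n \<in> carrier G" "x \<in> carrier G" "y \<in> carrier G"
    and "(\<lambda>n::nat. ip_norm G (s n - x)) \<longlonglongrightarrow> 0"
  shows "(\<lambda>n. form G (s n) y) \<longlonglongrightarrow> form G x y"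
proof -
  have "(\<lambda>n. form G (s n) y - form G x y) \<longlonglongrightarrow> 0"
  proof (rule Lim_null_comparison)
    show "\<forall>\<^sub>F n in sequentially. norm (form G (s n) y - form G x y) \<le> ip_norm G (s n - x) * ip_norm G y"
      using assms Cauchy_Schwarz[of "s _ - x" y] by (simp add: form_diff_left)
    show "(\<lambda>n. ip_norm G (s n - x) * ip_norm G y) \<longlonglongrightarrow> 0"
      using tendsto_mult_left_zero[OF assms(4)] by simp
  qed
  then show ?thesis by (simp add: LIM_zero_iff)
qed

lemma form_tendsto_right:
  assumes "\<And>n. s n \<in> carrier G" "x \<in> carrier G" "y \<in> carrier G"
    and "(\<lambda>n::nat. ip_norm G (s n - x)) \<longlonglongrightarrow> 0"
  shows "(\<lambda>n. form G y (s n)) \<longlonglongrightarrow> form G y x"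
proof -
  have "(\<lambda>n. cnj (form G (s n) y)) \<longlonglongrightarrow> cnj (form G x y)"
    using form_tendsto_left[OF assms] by (rule tendsto_cnj)
  then show ?thesis
    using assms by (simp add: form_commute[of _ y])
qed

end

text \<open>Phrased with the seminorm, because \<open>ip_dist\<close> is a metric only for definite
  forms. For these the notion agrees with that of metric spaces, as \<open>mcomplete_iff\<close>
  records.\<close>

definition ip_Cauchy :: "'v::complex_vector inner_space \<Rightarrow> (nat \<Rightarrow> 'v) \<Rightarrow> bool" where
  "ip_Cauchy G s \<longleftrightarrow> range s \<subseteq> carrier G \<and>
     (\<forall>e>0. \<exists>N. \<forall>m\<ge>N. \<forall>n\<ge>N. ip_norm G (s m - s n) < e)"

lemma ip_Cauchy_carrier: "ip_Cauchy G s \<Longrightarrow> s n \<in> carrier G"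
  unfolding ip_Cauchy_def by blast

section \<open>Definite forms and the metric that they induce\<close>

locale posdef_ips = ips +
  assumes form_pos: "\<lbrakk>x \<in> carrier G; x \<noteq> 0\<rbrakk> \<Longrightarrow> 0 < Re (form G x x)"

sublocale posdef_ips \<subseteq> psd_ips
proof
  show "0 \<le> Re (form G x x)" if "x \<in> carrier G" for x
    using that form_pos[of x] by (cases "x = 0") simp_all
qed

context posdef_ips
begin

lemma norm_eq_zero: "x \<in> carrier G \<Longrightarrow> ip_norm G x = 0 \<longleftrightarrow> x = 0"
  using form_pos[of x] by (cases "x = 0") (simp_all add: ip_norm_def)

lemma metric: "Metric_space (carrier G) (ip_dist G)"
proof
  show "0 \<le> ip_dist G x y" for x y
    by (simp add: ip_dist_def)
  show "ip_dist G x y = ip_dist G y x" for x y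
    by (simp add: ip_dist_def norm_diff_commute)
  show "ip_dist G x y = 0 \<longleftrightarrow> x = y" if "x \<in> carrier G" "y \<in> carrier G" for x y
    using that by (simp add: ip_dist_def norm_eq_zero)
  show "ip_dist G x z \<le> ip_dist G x y + ip_dist G y z"
    if "x \<in> carrier G" "y \<in> carrier G" "z \<in> carrier G" for x y z
    using that by (simp add: ip_dist_def norm_triangle_diff)
qed

lemma mcomplete_iff:
  "Metric_space.mcomplete (carrier G) (ip_dist G) \<longleftrightarrow>
    (\<forall>s. ip_Cauchy G s \<longrightarrow> (\<exists>x\<in>carrier G. (\<lambda>n. ip_norm G (s n - x)) \<longlonglongrightarrow> 0))"
proof -
  interpret M: Metric_space "carrier G" "ip_dist G" by (rule metric)
  have C: "M.MCauchy s \<longleftrightarrow> ip_Cauchy G s" for s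
    unfolding M.MCauchy_def ip_Cauchy_def image_subset_iff ip_dist_def by auto
  have L: "(\<exists>x. limitin M.mtopology s x sequentially) \<longleftrightarrow>
      (\<exists>x\<in>carrier G. (\<lambda>n. ip_norm G (s n - x)) \<longlonglongrightarrow> 0)" if "ip_Cauchy G s" for s
    using ip_Cauchy_carrier[OF that]
    by (auto simp: M.limit_metric_sequentially LIMSEQ_def ip_dist_def)
  show ?thesis
    unfolding M.mcomplete_def C using L by blast
qed

lemma closure_iff:
  assumes "A \<subseteq> carrier G"
  shows "Metric_space.mtopology (carrier G) (ip_dist G) closure_of A = carrier G \<longleftrightarrow>
    (\<forall>x\<in>carrier G. \<forall>e>0. \<exists>a\<in>A. ip_norm G (a - x) < e)"
proof -
  interpret M: Metric_space "carrier G" "ip_dist G" by (rule metric)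
  have "a \<in> M.mball x e \<longleftrightarrow> ip_norm G (a - x) < e" if "x \<in> carrier G" "a \<in> A" for a x e
    using that assms norm_diff_commute[of x a] by (auto simp: M.mball_def ip_dist_def)
  then show ?thesis
    unfolding M.metric_closure_of by blast
qed

end

section \<open>Hilbert spaces\<close>

locale hilbert =
  fixes G :: "'v::complex_vector inner_space"
  assumes hilbert: "hilbert_space G"

sublocale hilbert \<subseteq> posdef_ips
  using hilbert by unfold_locales (auto simp: hilbert_space_def)

lemma (in posdef_ips) hilbertI:
  assumes "\<And>s. ip_Cauchy G s \<Longrightarrow> \<exists>x\<in>carrier G. (\<lambda>n. ip_norm G (s n - x)) \<longlonglongrightarrow> 0"
  shows "hilbert G"
proof -
  have "Metric_space.mcomplete (carrier G) (ip_dist G)"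
    unfolding mcomplete_iff using assms by blast
  then show ?thesis
    by (simp add: hilbert_def hilbert_space_def inner_product form_pos)
qed

context hilbert
begin

lemma Cauchy_convergent:
  assumes "ip_Cauchy G s"
  obtains x where "x \<in> carrier G" "(\<lambda>n. ip_norm G (s n - x)) \<longlonglongrightarrow> 0"
proof -
  have "Metric_space.mcomplete (carrier G) (ip_dist G)"
    using hilbert by (simp add: hilbert_space_def)
  then show thesis
    using that assms unfolding mcomplete_iff by blast
qed

text \<open>The subspace need not be closed: the representing vector is the limit in the ambient space of a
  minimizing sequence for \<open>\<parallel>x\<parallel>\<^sup>2 - 2 Re (f x)\<close>.\<close>

lemma Riesz:
  assumes sub: "complex_vector.subspace R" and R: "R \<subseteq> carrier G"
    and add: "\<And>x y. \<lbrakk>x \<in> R; y \<in> R\<rbrakk> \<Longrightarrow> f (x + y) = f x + f y"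
    and scale: "\<And>c x. x \<in> R \<Longrightarrow> f (c *\<^sub>C x) = c * f x"
    and bound: "\<And>x. x \<in> R \<Longrightarrow> cmod (f x) \<le> M * ip_norm G x" and M: "0 \<le> M"
  shows "\<exists>z s. z \<in> carrier G \<and> (\<forall>x\<in>R. f x = form G x z) \<and> ip_norm G z \<le> M \<and>
    (\<forall>n::nat. s n \<in> R) \<and> (\<lambda>n. ip_norm G (s n - z)) \<longlonglongrightarrow> 0"
proof -
  define Q where "Q x = (ip_norm G x)\<^sup>2 - 2 * Re (f x)" for x
  have low: "- M\<^sup>2 \<le> Q x" if "x \<in> R" for x
  proof -
    have "Re (f x) \<le> M * ip_norm G x"
      using bound[OF that] complex_Re_le_cmod[of "f x"] by linarith
    moreover have "0 \<le> (ip_norm G x - M)\<^sup>2" by simp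
    ultimately show ?thesis
      by (simp add: Q_def power2_diff mult.commute[of M])
  qed
  define I where "I = Inf (Q ` R)"
  have bdd: "bdd_below (Q ` R)"
    using low by (intro bdd_belowI2)
  have ne: "Q ` R \<noteq> {}"
    using complex_vector.subspace_0[OF sub] by blast
  have I: "I \<le> Q x" if "x \<in> R" for x
    unfolding I_def using that bdd by (simp add: cInf_lower)
  have "\<exists>x. x \<in> R \<and> Q x < I + inverse (real (Suc n))" for n
  proof -
    have "Inf (Q ` R) < I + inverse (real (Suc n))"
      unfolding I_def by (rule less_add_same_cancel1[THEN iffD2]) simp
    then show ?thesis
      unfolding cInf_less_iff[OF ne bdd] by blast
  qed
  then have "\<exists>s. \<forall>n. s n \<in> R \<and> Q (s n) < I + inverse (real (Suc n))"
    by (intro choice allI)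
  then obtain s where sR: "\<And>n. s n \<in> R" and sQ: "\<And>n. Q (s n) < I + inverse (real (Suc n))"
    by blast
  have sG: "s n \<in> carrier G" for n
    using sR R by blast
  \<comment> \<open>The parallelogram law: the midpoint lies in \<open>R\<close>, so its value of
    \<open>Q\<close> is at least \<open>I\<close>, and two nearly minimal vectors must be close to
    each other.\<close>
  have par: "(ip_norm G (x - y))\<^sup>2 \<le> 2 * (Q x + Q y - 2 * I)" if "x \<in> R" "y \<in> R" for x y
  proof -
    have xy: "x \<in> carrier G" "y \<in> carrier G" "x + y \<in> R"
      using that R sub by (auto intro: complex_vector.subspace_add)
    then have mid: "(1/2) *\<^sub>C (x + y) \<in> R"
      using sub by (simp add: complex_vector.subspace_scale)
    have "Q ((1/2) *\<^sub>C (x + y)) = (ip_norm G (x + y))\<^sup>2 / 4 - Re (f x) - Re (f y)"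
      using xy by (simp add: Q_def norm_scale scale add that power_mult_distrib power2_eq_square add_divide_distrib)
    moreover have "(ip_norm G (x - y))\<^sup>2 + (ip_norm G (x + y))\<^sup>2 = 2 * (ip_norm G x)\<^sup>2 + 2 * (ip_norm G y)\<^sup>2"
      using norm_diff_expand[of x y 1] norm_diff_expand[of x y "-1"] xy by simp
    moreover have "I \<le> Q ((1/2) *\<^sub>C (x + y))"
      using I mid by blast
    ultimately show ?thesis
      by (simp add: Q_def)
  qed
  have "ip_Cauchy G s"
    unfolding ip_Cauchy_def
  proof (intro conjI allI impI)
    show "range s \<subseteq> carrier G" using sG by blast
    fix e :: real assume e: "0 < e"
    \<comment> \<open>Each of the two values of \<open>Q\<close> exceeds \<open>I\<close> by less
      than a quarter of the square of e, and \<open>par\<close> doubles their sum.\<close>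
    then obtain N where N: "inverse (real (Suc N)) < e\<^sup>2 / 4"
      using reals_Archimedean[of "e\<^sup>2 / 4"] by auto
    have "ip_norm G (s m - s n) < e" if "N \<le> m" "N \<le> n" for m n
    proof -
      have "inverse (real (Suc m)) \<le> inverse (real (Suc N))" "inverse (real (Suc n)) \<le> inverse (real (Suc N))"
        using that by (simp_all add: le_imp_inverse_le)
      moreover have "A < E" if "A \<le> 2 * (p + q - 2 * I)" "p < I + u" "q < I + v" "u \<le> w" "v \<le> w" "w < E / 4"
        for A E p q u v w :: real
        using that by argo
      ultimately have "(ip_norm G (s m - s n))\<^sup>2 < e\<^sup>2"
        using par[OF sR[of m] sR[of n]] sQ[of m] sQ[of n] N by blast
      then show ?thesis
        using e power2_less_imp_less by force
    qed
    then show "\<exists>N. \<forall>m\<ge>N. \<forall>n\<ge>N. ip_norm G (s m - s n) < e" by blast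
  qed
  then obtain z where z: "z \<in> carrier G" and lim: "(\<lambda>n. ip_norm G (s n - z)) \<longlonglongrightarrow> 0"
    by (rule Cauchy_convergent)
  \<comment> \<open>The near-minimizers are compared with their translates by \<open>t u\<close>,
    and n tends to infinity. Doing this along the sequence avoids evaluating \<open>f\<close> at the
    limit, which need not lie in \<open>R\<close>.\<close>
  have first_order: "2 * t * (Re (f u) - Re (form G u z)) \<le> t\<^sup>2 * (ip_norm G u)\<^sup>2" if u: "u \<in> R" for u and t :: real
  proof -
    have uG: "u \<in> carrier G" using u R by blast
    have "I \<le> I + inverse (real (Suc n)) + 2 * t * (Re (form G u (s n)) - Re (f u)) + t\<^sup>2 * (ip_norm G u)\<^sup>2" for n
    proof -
      have "s n - of_real (-t) *\<^sub>C u \<in> R"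
        using u sR sub by (intro complex_vector.subspace_diff complex_vector.subspace_scale)
      then have "I \<le> Q (s n - of_real (-t) *\<^sub>C u)" by (rule I)
      also have "\<dots> = Q (s n) + 2 * t * (Re (form G u (s n)) - Re (f u)) + t\<^sup>2 * (ip_norm G u)\<^sup>2"
      proof -
        have "f (s n + of_real t *\<^sub>C u) = f (s n) + of_real t * f u"
          using u sR sub by (simp add: add scale complex_vector.subspace_scale)
        then show ?thesis
          unfolding Q_def norm_diff_expand[OF sG uG] form_commute[OF uG sG]
          by (simp add: algebra_simps)
      qed
      finally show ?thesis using sQ[of n] by linarith
    qed
    moreover have "(\<lambda>n. I + inverse (real (Suc n)) + 2 * t * (Re (form G u (s n)) - Re (f u)) + t\<^sup>2 * (ip_norm G u)\<^sup>2)
        \<longlonglongrightarrow> I + 0 + 2 * t * (Re (form G u z) - Re (f u)) + t\<^sup>2 * (ip_norm G u)\<^sup>2"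
      by (intro tendsto_intros LIMSEQ_inverse_real_of_nat form_tendsto_right sG z uG lim)
    ultimately have "I \<le> I + 0 + 2 * t * (Re (form G u z) - Re (f u)) + t\<^sup>2 * (ip_norm G u)\<^sup>2"
      by (intro LIMSEQ_le_const) auto
    then show ?thesis by (simp add: algebra_simps)
  qed
  have re: "Re (f u) = Re (form G u z)" if u: "u \<in> R" for u
  proof (rule ccontr)
    define d where "d = Re (f u) - Re (form G u z)"
    define b where "b = (ip_norm G u)\<^sup>2"
    assume "Re (f u) \<noteq> Re (form G u z)"
    then have "d\<^sup>2 > 0" by (simp add: d_def)
    moreover have b: "b \<ge> 0" by (simp add: b_def)
    ultimately have c: "0 < d\<^sup>2 / (1 + b)"
      by (intro divide_pos_pos) simp_all
    \<comment> \<open>This t is small enough for the linear term to dominate the quadratic one; the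
      summand 1 covers \<open>b = 0\<close>.\<close>
    have "2 * (d / (1 + b)) * d \<le> (d / (1 + b))\<^sup>2 * b"
      unfolding d_def b_def by (rule first_order[OF u])
    then have "2 * (d\<^sup>2 / (1 + b)) \<le> d\<^sup>2 / (1 + b) * (b / (1 + b))"
      by (simp add: power2_eq_square)
    also have "\<dots> \<le> d\<^sup>2 / (1 + b) * 1"
      using c b by (intro mult_left_mono) (auto simp: field_simps)
    finally show False using c by simp
  qed
  have eq: "f u = form G u z" if u: "u \<in> R" for u
  proof -
    define w where "w = f u - form G u z"
    have uG: "u \<in> carrier G" using u R by blast
    \<comment> \<open>Equality of real parts is applied to a rotated multiple of u, on which the
      defect w becomes its squared modulus.\<close>
    have "cnj w *\<^sub>C u \<in> R" using u sub by (simp add: complex_vector.subspace_scale)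
    then have "Re (f (cnj w *\<^sub>C u)) = Re (form G (cnj w *\<^sub>C u) z)" by (rule re)
    then have "Re (cnj w * f u) = Re (cnj w * form G u z)"
      by (simp only: scale[OF u] form_scale_left[OF uG z])
    then have "Re (cnj w * w) = 0"
      unfolding w_def by (simp only: right_diff_distrib minus_complex.sel)
    then have "w = 0" by (simp add: cnj_mult_self)
    then show ?thesis by (simp add: w_def)
  qed
  \<comment> \<open>The bound on \<open>f\<close> cannot be applied to z itself, which may lie
    outside \<open>R\<close>; it is applied to \<open>s n\<close>, where
    \<open>f (s n) = [s n, z]\<close> tends to the squared norm of z.\<close>
  have "ip_norm G z \<le> M"
  proof (cases "ip_norm G z = 0")
    case False
    have "(\<lambda>n. cmod (form G (s n) z)) \<longlonglongrightarrow> cmod (form G z z)"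
      by (intro tendsto_norm form_tendsto_left sG z lim)
    moreover have "(\<lambda>n. M * ip_norm G (s n)) \<longlonglongrightarrow> M * ip_norm G z"
      by (intro tendsto_intros norm_tendsto sG z lim)
    moreover have "cmod (form G (s n) z) \<le> M * ip_norm G (s n)" for n
      using bound[OF sR[of n]] eq[OF sR[of n]] by simp
    ultimately have "cmod (form G z z) \<le> M * ip_norm G z"
      by (intro LIMSEQ_le) auto
    moreover have "cmod (form G z z) = (ip_norm G z)\<^sup>2"
      using norm_power2_complex[OF z] by (metis norm_of_real abs_of_nonneg zero_le_power2)
    ultimately show ?thesis
      using False norm_ge_0[OF z] by (simp add: power2_eq_square)
  qed (use M in simp)
  then show ?thesis
    using z eq sR lim by blast
qed

end

text \<open>The proof is the gliding hump argument: if \<open>T'\<close> were unbounded, steps of length \<open>3\<^sup>-\<^sup>n\<close> along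
  vectors \<open>T' (y n)\<close> with \<open>\<parallel>T' (y n)\<parallel> > 4\<^sup>n \<parallel>y n\<parallel>\<close> would lead to a point \<open>x\<close> with
  \<open>\<parallel>T x\<parallel> \<ge> (4/3)\<^sup>n / 2\<close> for all \<open>n\<close>.\<close>

lemma Hellinger_Toeplitz:
  assumes "hilbert G" "psd_ips P"
    and T: "T \<in> carrier G \<rightarrow> carrier P" and T': "T' \<in> carrier P \<rightarrow> carrier G"
    and adj: "\<And>x y. \<lbrakk>x \<in> carrier G; y \<in> carrier P\<rbrakk> \<Longrightarrow> form P (T x) y = form G x (T' y)"
  shows "\<exists>M\<ge>0. (\<forall>x\<in>carrier G. ip_norm P (T x) \<le> M * ip_norm G x) \<and>
    (\<forall>y\<in>carrier P. ip_norm G (T' y) \<le> M * ip_norm P y)"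
proof -
  interpret G: hilbert G by fact
  interpret P: psd_ips P by fact
  have Tm [simp]: "T x \<in> carrier P" if "x \<in> carrier G" for x using T that by blast
  have T'm [simp]: "T' y \<in> carrier G" if "y \<in> carrier P" for y using T' that by blast
  have "\<exists>M\<ge>0. \<forall>y\<in>carrier P. ip_norm G (T' y) \<le> M * ip_norm P y"
  proof (rule ccontr)
    assume "\<not> ?thesis"
    then have "\<exists>y. y \<in> carrier P \<and> 4 ^ n * ip_norm P y < ip_norm G (T' y)" for n :: nat
      by (meson not_less zero_le_numeral zero_le_power)
    then obtain y where y: "\<And>n::nat. y n \<in> carrier P"
      and yn: "\<And>n. 4 ^ n * ip_norm P (y n) < ip_norm G (T' (y n))"
      by metis
    define v where "v n = T' (y n)" for n
    define r :: "nat \<Rightarrow> real" where "r n = (1/3) ^ n" for n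
    have r: "0 < r n" "r (Suc n) = r n / 3" for n by (simp_all add: r_def)
    have vG: "v n \<in> carrier G" for n by (simp add: v_def y)
    have vpos: "0 < ip_norm G (v n)" for n
      using yn[of n] P.norm_ge_0[OF y[of n]]
      by (smt (verit) v_def mult_nonneg_nonneg zero_le_power)
    have bound: "cmod (form G x (v n)) \<le> ip_norm P (T x) * ip_norm P (y n)" if "x \<in> carrier G" for x n
      using P.Cauchy_Schwarz[of "T x" "y n"] that y by (simp add: adj v_def)
    \<comment> \<open>With u the multiple of \<open>v n\<close> of norm \<open>r n\<close>, the
      values at \<open>x + u\<close> and \<open>x - u\<close> differ by \<open>2 [u, v n]\<close>,
      so one of these points has the required size.\<close>
    have "\<exists>x'. x' \<in> carrier G \<and> (ip_norm G (x' - x) \<le> r n \<and> r n * ip_norm G (v n) \<le> cmod (form G x' (v n)))"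
      if x: "x \<in> carrier G" for x n
    proof -
      define u where "u = of_real (r n / ip_norm G (v n)) *\<^sub>C v n"
      have uG: "u \<in> carrier G" by (simp add: u_def vG)
      have un: "ip_norm G u = r n"
        using vpos[of n] r(1)[of n] by (simp add: u_def G.norm_scale vG norm_divide)
      have uv: "form G u (v n) = of_real (r n * ip_norm G (v n))"
        using vpos[of n] unfolding u_def G.form_scale_left[OF vG vG] G.norm_power2_complex[OF vG, symmetric]
        by (simp add: power2_eq_square)
      have un': "ip_norm G (x - u - x) = r n"
        using G.norm_scale[OF uG, of "-1"] un by simp
      have "2 * cmod (form G u (v n)) \<le> cmod (form G (x + u) (v n)) + cmod (form G (x - u) (v n))"
      proof -
        have "2 * form G u (v n) = form G (x + u) (v n) - form G (x - u) (v n)"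
          using x uG vG by (simp add: G.form_simps)
        then show ?thesis
          by (metis norm_triangle_ineq4 norm_mult norm_numeral)
      qed
      moreover have "cmod (form G u (v n)) = r n * ip_norm G (v n)"
        using vpos[of n] r(1)[of n] by (simp add: uv norm_mult)
      ultimately consider "r n * ip_norm G (v n) \<le> cmod (form G (x + u) (v n))"
        | "r n * ip_norm G (v n) \<le> cmod (form G (x - u) (v n))"
        by linarith
      then show ?thesis
      proof cases
        case 1
        then show ?thesis using x uG un by (intro exI[of _ "x + u"]) simp
      next
        case 2
        then show ?thesis using x uG un' by (intro exI[of _ "x - u"]) simp
      qed
    qed
    then obtain x where xG: "\<And>n::nat. x n \<in> carrier G" and step: "\<And>n. ip_norm G (x (Suc n) - x n) \<le> r n"
      and hump: "\<And>n. r n * ip_norm G (v n) \<le> cmod (form G (x (Suc n)) (v n))"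
      using dependent_nat_choice[of "\<lambda>n x. x \<in> carrier G"
          "\<lambda>n x x'. ip_norm G (x' - x) \<le> r n \<and> r n * ip_norm G (v n) \<le> cmod (form G x' (v n))"]
      by (metis G.zero_mem)
    \<comment> \<open>The steps sum like a geometric series, because
      \<open>r k = 3/2 * (r k - r (Suc k))\<close>.\<close>
    have tail: "ip_norm G (x m - x n) \<le> 3/2 * (r n - r m)" if "n \<le> m" for m n
      using that
    proof (induction m rule: dec_induct)
      case (step m)
      have "ip_norm G (x (Suc m) - x n) \<le> ip_norm G (x (Suc m) - x m) + ip_norm G (x m - x n)"
        by (intro G.norm_triangle_diff xG)
      then show ?case
        using step \<open>\<And>n. ip_norm G (x (Suc n) - x n) \<le> r n\<close>[of m] r(2)[of m] by argo
    qed simp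
    have tail': "ip_norm G (x m - x n) \<le> 3/2 * r n" if "n \<le> m" for m n
      using r(1)[of m] by (intro order_trans[OF tail[OF that]]) simp
    have "ip_Cauchy G x"
      unfolding ip_Cauchy_def
    proof (intro conjI allI impI)
      show "range x \<subseteq> carrier G" using xG by blast
      fix e :: real assume "0 < e"
      then obtain N where N: "r N < e / 3"
        using real_arch_pow_inv[of "e / 3" "1/3"] by (auto simp: r_def)
      have "ip_norm G (x m - x n) < e" if "N \<le> m" "N \<le> n" for m n
      proof -
        have "ip_norm G (x m - x n) \<le> ip_norm G (x m - x N) + ip_norm G (x N - x n)"
          by (intro G.norm_triangle_diff xG)
        also have "\<dots> \<le> 3/2 * r N + 3/2 * r N"
          using tail'[OF that(1)] tail'[OF that(2)] by (simp add: G.norm_diff_commute[OF xG[of N] xG[of n]])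
        also have "\<dots> < e" using N by simp
        finally show ?thesis .
      qed
      then show "\<exists>N. \<forall>m\<ge>N. \<forall>n\<ge>N. ip_norm G (x m - x n) < e" by blast
    qed
    then obtain z where zG: "z \<in> carrier G" and lim: "(\<lambda>n. ip_norm G (x n - z)) \<longlonglongrightarrow> 0"
      by (rule G.Cauchy_convergent)
    have close: "ip_norm G (z - x n) \<le> 3/2 * r n" for n
    proof -
      have "(\<lambda>m. ip_norm G (x m - x n)) \<longlonglongrightarrow> ip_norm G (z - x n)"
        using lim by (intro G.norm_tendsto) (simp_all add: xG zG)
      then show ?thesis
        using tail'[of n] by (intro LIMSEQ_le_const2[of _ "ip_norm G (z - x n)"]) auto
    qed
    have grow: "(4/3) ^ n / 2 \<le> ip_norm P (T z)" for n
    proof -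
      have "cmod (form G (x (Suc n)) (v n)) \<le> cmod (form G z (v n)) + cmod (form G (z - x (Suc n)) (v n))"
        using norm_triangle_ineq4[of "form G z (v n)" "form G (z - x (Suc n)) (v n)"]
        by (simp add: G.form_diff_left zG xG vG)
      \<comment> \<open>The distance from z to \<open>x (Suc n)\<close> is at most
        \<open>3/2 * r (Suc n) = r n / 2\<close>, so the later steps destroy at most half of the
        hump.\<close>
      also have "cmod (form G (z - x (Suc n)) (v n)) \<le> r n / 2 * ip_norm G (v n)"
      proof -
        have "cmod (form G (z - x (Suc n)) (v n)) \<le> ip_norm G (z - x (Suc n)) * ip_norm G (v n)"
          by (intro G.Cauchy_Schwarz) (simp_all add: zG xG vG)
        also have "\<dots> \<le> r n / 2 * ip_norm G (v n)"
          using close[of "Suc n"] vpos[of n] by (intro mult_right_mono) (simp_all add: r(2))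
        finally show ?thesis .
      qed
      also have "cmod (form G z (v n)) \<le> ip_norm P (T z) * ip_norm P (y n)"
        by (rule bound[OF zG])
      finally have *: "r n / 2 * ip_norm G (v n) \<le> ip_norm P (T z) * ip_norm P (y n)"
        using hump[of n] by simp
      \<comment> \<open>P may have null vectors; if \<open>y n\<close> were one, the inequality just
        proved would make the hump vanish.\<close>
      have ypos: "0 < ip_norm P (y n)"
      proof (rule ccontr)
        assume "\<not> 0 < ip_norm P (y n)"
        then have "ip_norm P (y n) = 0" using P.norm_ge_0[OF y[of n]] by simp
        then have "r n / 2 * ip_norm G (v n) \<le> 0" using * by simp
        then show False using r(1)[of n] vpos[of n] by (simp add: mult_le_0_iff)
      qed
      have "r n / 2 * (4 ^ n * ip_norm P (y n)) \<le> r n / 2 * ip_norm G (v n)"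
        using yn[of n] r(1)[of n] by (intro mult_left_mono) (simp_all add: v_def)
      then have "r n / 2 * 4 ^ n * ip_norm P (y n) \<le> ip_norm P (T z) * ip_norm P (y n)"
        using * by simp
      then have "r n / 2 * 4 ^ n \<le> ip_norm P (T z)"
        using ypos by (rule mult_right_le_imp_le)
      moreover have "r n / 2 * 4 ^ n = (4/3) ^ n / 2"
        by (simp add: r_def power_divide)
      ultimately show ?thesis by simp
    qed
    obtain n where "2 * ip_norm P (T z) < (4/3) ^ n"
      using real_arch_pow[of "4/3" "2 * ip_norm P (T z)"] by auto
    then show False using grow[of n] by simp
  qed
  then obtain M where M: "0 \<le> M" "\<And>y. y \<in> carrier P \<Longrightarrow> ip_norm G (T' y) \<le> M * ip_norm P y"
    by blast
  \<comment> \<open>The bound for \<open>T'\<close> carries over to \<open>T\<close>: the squared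
    seminorm of \<open>T x\<close> is \<open>[x, T' (T x)]\<close>.\<close>
  have "ip_norm P (T x) \<le> M * ip_norm G x" if x: "x \<in> carrier G" for x
  proof (cases "ip_norm P (T x) = 0")
    case False
    have "(ip_norm P (T x))\<^sup>2 = cmod (form P (T x) (T x))"
      using x P.norm_power2_complex[of "T x"] by (metis Tm abs_of_nonneg norm_of_real zero_le_power2)
    also have "\<dots> = cmod (form G x (T' (T x)))" using x by (simp add: adj)
    also have "\<dots> \<le> ip_norm G x * ip_norm G (T' (T x))" using x by (intro G.Cauchy_Schwarz) simp_all
    also have "\<dots> \<le> ip_norm G x * (M * ip_norm P (T x))" using x M by (intro mult_left_mono) simp_all
    finally have "ip_norm P (T x) * ip_norm P (T x) \<le> (M * ip_norm G x) * ip_norm P (T x)"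
      by (simp add: power2_eq_square ac_simps)
    then show ?thesis
      by (rule mult_right_le_imp_le) (use False x in \<open>simp add: less_le\<close>)
  qed (use M x in simp)
  with M show ?thesis by blast
qed

section \<open>Krein spaces\<close>

locale fundamental_symmetry =
  fixes K G :: "'v::complex_vector inner_space" and J :: "'v \<Rightarrow> 'v"
  assumes fundamental: "fundamental K G J"

sublocale fundamental_symmetry \<subseteq> hilbert G
  using fundamental by unfold_locales (simp add: fundamental_def)

context fundamental_symmetry
begin

lemma carrier_eq: "carrier K = carrier G"
  using fundamental by (simp add: fundamental_def)

lemma J_mem [simp]: "x \<in> carrier G \<Longrightarrow> J x \<in> carrier G"
  using fundamental by (auto simp: fundamental_def linear_op_def)

lemma J_J [simp]: "x \<in> carrier G \<Longrightarrow> J (J x) = x"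
  using fundamental by (simp add: fundamental_def)

lemma J_symmetric: "\<lbrakk>x \<in> carrier G; y \<in> carrier G\<rbrakk> \<Longrightarrow> form G (J x) y = form G x (J y)"
  using fundamental by (simp add: fundamental_def)

lemma form_eq: "\<lbrakk>x \<in> carrier G; y \<in> carrier G\<rbrakk> \<Longrightarrow> form K x y = form G (J x) y"
  using fundamental by (simp add: fundamental_def)

lemma form_eq_right: "\<lbrakk>x \<in> carrier G; y \<in> carrier G\<rbrakk> \<Longrightarrow> form K x y = form G x (J y)"
  by (simp add: form_eq J_symmetric)

lemma form_J_right: "\<lbrakk>x \<in> carrier G; y \<in> carrier G\<rbrakk> \<Longrightarrow> form K x (J y) = form G x y"
  by (simp add: form_eq_right)

lemma norm_J [simp]: "x \<in> carrier G \<Longrightarrow> ip_norm G (J x) = ip_norm G x"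
  by (simp add: ip_norm_def J_symmetric)

lemma J_add: "\<lbrakk>x \<in> carrier G; y \<in> carrier G\<rbrakk> \<Longrightarrow> J (x + y) = J x + J y"
  and J_scale: "x \<in> carrier G \<Longrightarrow> J (c *\<^sub>C x) = c *\<^sub>C J x"
  using fundamental by (simp_all add: fundamental_def linear_op_def)

lemma ips: "ips K"
proof
  show "inner_product_space K"
    unfolding inner_product_space_def carrier_eq
    using subspace_carrier
    by (auto simp: form_eq J_add J_scale form_simps form_commute[of _ "J _"] J_symmetric)
       (metis form_commute J_mem J_symmetric)
qed

lemma form_bound: "\<lbrakk>x \<in> carrier G; y \<in> carrier G\<rbrakk> \<Longrightarrow> cmod (form K x y) \<le> ip_norm G x * ip_norm G y"
  using Cauchy_Schwarz[of "J x" y] by (simp add: form_eq)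

text \<open>The vector \<open>J x\<close> detects x, since \<open>[J x, x]\<close> is the squared
  Hilbert norm of x.\<close>

lemma nondegenerate:
  assumes "x \<in> carrier K" "\<And>y. y \<in> carrier K \<Longrightarrow> form K y x = 0"
  shows "x = 0"
proof (rule ccontr)
  assume "x \<noteq> 0"
  then have "0 < Re (form G x x)" using assms form_pos by (simp add: carrier_eq)
  moreover have "form K (J x) x = form G x x"
    using assms by (simp add: form_eq carrier_eq)
  ultimately show False using assms by (simp add: carrier_eq)
qed

lemma eqI:
  assumes "x \<in> carrier K" "y \<in> carrier K" "\<And>z. z \<in> carrier K \<Longrightarrow> form K z x = form K z y"
  shows "x = y"
proof -
  interpret K: ips K by (rule ips)
  have "x - y = 0"
    using assms by (intro nondegenerate) (simp_all add: K.form_diff_right)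
  then show ?thesis by simp
qed

end

lemma krein_space_iff: "krein_space K \<longleftrightarrow> (\<exists>G J. fundamental_symmetry K G J)"
  unfolding krein_space_def
  by (metis fundamental_symmetry.fundamental fundamental_symmetry.intro fundamental_symmetry.ips ips.inner_product)

text \<open>Neither linearity nor boundedness is demanded. Between Krein spaces both follow, from
  nondegeneracy and from Hellinger-Toeplitz, so an operator is shown to be bounded by exhibiting an
  adjoint.\<close>

definition adjoint_pair ::
  "'v::complex_vector inner_space \<Rightarrow> 'w::complex_vector inner_space \<Rightarrow> ('v \<Rightarrow> 'w) \<Rightarrow> ('w \<Rightarrow> 'v) \<Rightarrow> bool" where
  "adjoint_pair K1 K2 T T' \<longleftrightarrow> T \<in> carrier K1 \<rightarrow> carrier K2 \<and> T' \<in> carrier K2 \<rightarrow> carrier K1 \<and>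
     (\<forall>x\<in>carrier K1. \<forall>y\<in>carrier K2. form K2 (T x) y = form K1 x (T' y))"

text \<open>Conjugating \<open>T'\<close> with the two symmetries gives a Hilbert space adjoint of
  \<open>T\<close>, to which Hellinger-Toeplitz applies. The estimate holds for every choice of the
  two Hilbert structures.\<close>

lemma adjoint_pair_bounded:
  assumes "adjoint_pair K1 K2 T T'" "fundamental_symmetry K1 G1 J1" "fundamental_symmetry K2 G2 J2"
  obtains M where "0 \<le> M" "\<And>x. x \<in> carrier K1 \<Longrightarrow> ip_norm G2 (T x) \<le> M * ip_norm G1 x"
proof -
  interpret F1: fundamental_symmetry K1 G1 J1 by fact
  interpret F2: fundamental_symmetry K2 G2 J2 by fact
  have T: "T \<in> carrier G1 \<rightarrow> carrier G2" and T': "T' \<in> carrier G2 \<rightarrow> carrier G1"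
    and adj: "\<And>x y. \<lbrakk>x \<in> carrier G1; y \<in> carrier G2\<rbrakk> \<Longrightarrow> form K2 (T x) y = form K1 x (T' y)"
    using assms(1) by (simp_all add: adjoint_pair_def F1.carrier_eq F2.carrier_eq)
  have mem [simp]: "T x \<in> carrier G2" "T' y \<in> carrier G1" if "x \<in> carrier G1" "y \<in> carrier G2" for x y
    using T T' that by blast+
  have pair: "form G2 (T x) y = form G1 x (J1 (T' (J2 y)))" if "x \<in> carrier G1" "y \<in> carrier G2" for x y
  proof -
    have "form G2 (T x) y = form K2 (T x) (J2 y)"
      using that by (intro F2.form_J_right[symmetric]) auto
    also have "\<dots> = form G1 x (J1 (T' (J2 y)))"
      using that adj[of x "J2 y"] F1.form_eq_right[of x "T' (J2 y)"] T' by force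
    finally show ?thesis .
  qed
  have "(\<lambda>y. J1 (T' (J2 y))) \<in> carrier G2 \<rightarrow> carrier G1"
    using T' by (auto intro!: F1.J_mem)
  then obtain M where "0 \<le> M" "\<And>x. x \<in> carrier G1 \<Longrightarrow> ip_norm G2 (T x) \<le> M * ip_norm G1 x"
    using Hellinger_Toeplitz[OF F1.hilbert_axioms F2.psd_ips_axioms T _ pair] by blast
  then show thesis using that by (simp add: F1.carrier_eq)
qed

lemma adjoint_pair_sym:
  assumes "adjoint_pair K1 K2 T T'" "ips K1" "ips K2"
  shows "adjoint_pair K2 K1 T' T"
proof -
  interpret K1: ips K1 by fact
  interpret K2: ips K2 by fact
  have T: "\<And>x. x \<in> carrier K1 \<Longrightarrow> T x \<in> carrier K2" and T': "\<And>y. y \<in> carrier K2 \<Longrightarrow> T' y \<in> carrier K1"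
    and adj: "\<And>x y. \<lbrakk>x \<in> carrier K1; y \<in> carrier K2\<rbrakk> \<Longrightarrow> form K2 (T x) y = form K1 x (T' y)"
    using assms(1) by (auto simp: adjoint_pair_def)
  have "form K1 (T' y) x = form K2 y (T x)" if "x \<in> carrier K1" "y \<in> carrier K2" for x y
    using K1.form_commute[of x "T' y"] K2.form_commute[of "T x" y] adj[OF that] T T' that by simp
  then show ?thesis
    using T T' by (auto simp: adjoint_pair_def)
qed

text \<open>Seen from any y, the vector \<open>T x\<close> is the functional
  \<open>[T' y, x]\<close>, whose dependence on x is that of the form; nothing about
  \<open>T'\<close> beyond its values enters.\<close>

lemma adjoint_pair_linear:
  assumes "adjoint_pair K1 K2 T T'" "krein_space K1" "krein_space K2"
  shows "linear_op K1 K2 T"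
proof -
  obtain G2 J2 where "fundamental_symmetry K2 G2 J2" using assms krein_space_iff by blast
  then interpret F2: fundamental_symmetry K2 G2 J2 .
  interpret K2: ips K2 by (rule F2.ips)
  interpret K1: ips K1 using assms(2) by (simp add: krein_space_def ips_def)
  have sym: "\<And>x y. \<lbrakk>x \<in> carrier K1; y \<in> carrier K2\<rbrakk> \<Longrightarrow> form K2 y (T x) = form K1 (T' y) x"
    and T: "\<And>x. x \<in> carrier K1 \<Longrightarrow> T x \<in> carrier K2" and T': "\<And>y. y \<in> carrier K2 \<Longrightarrow> T' y \<in> carrier K1"
    using adjoint_pair_sym[OF assms(1) K1.ips_axioms K2.ips_axioms] unfolding adjoint_pair_def by auto
  show ?thesis
    unfolding linear_op_def
  proof (intro conjI ballI allI)
    show "T \<in> carrier K1 \<rightarrow> carrier K2" using T by blast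
  next
    fix x y assume "x \<in> carrier K1" "y \<in> carrier K1"
    then show "T (x + y) = T x + T y"
      by (intro F2.eqI) (simp_all add: T T' sym K2.form_add_right K1.form_add_right)
  next
    fix c x assume "x \<in> carrier K1"
    then show "T (c *\<^sub>C x) = c *\<^sub>C T x"
      by (intro F2.eqI) (simp_all add: T T' sym K2.form_scale_right K1.form_scale_right)
  qed
qed

lemma adjoint_pair_bounded_ops:
  assumes "adjoint_pair K1 K2 T T'" "krein_space K1" "krein_space K2"
  shows "T \<in> bounded_ops K1 K2"
proof -
  obtain G1 J1 where F1: "fundamental_symmetry K1 G1 J1" using assms krein_space_iff by blast
  obtain G2 J2 where F2: "fundamental_symmetry K2 G2 J2" using assms krein_space_iff by blast
  obtain M where "\<And>x. x \<in> carrier K1 \<Longrightarrow> ip_norm G2 (T x) \<le> M * ip_norm G1 x"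
    using adjoint_pair_bounded[OF assms(1) F1 F2] by blast
  then show ?thesis
    unfolding bounded_ops_def using adjoint_pair_linear[OF assms] F1 F2
    by (auto simp: fundamental_symmetry_def)
qed

lemma adj_eq:
  assumes "adjoint_pair K1 K2 T T'" "krein_space K1" "y \<in> carrier K2"
  shows "adj K1 K2 T y = T' y"
proof -
  obtain G1 J1 where "fundamental_symmetry K1 G1 J1" using assms krein_space_iff by blast
  then interpret F1: fundamental_symmetry K1 G1 J1 .
  show ?thesis
    unfolding adj_def
  proof (rule the_equality)
    show "T' y \<in> carrier K1 \<and> (\<forall>x\<in>carrier K1. form K2 (T x) y = form K1 x (T' y))"
      using assms by (auto simp: adjoint_pair_def)
    then show "z = T' y" if "z \<in> carrier K1 \<and> (\<forall>x\<in>carrier K1. form K2 (T x) y = form K1 x z)" for z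
      using that by (intro F1.eqI) simp_all
  qed
qed

text \<open>The functional \<open>[T x, y]\<close> of x is bounded, so Riesz represents it in the
  Hilbert space \<open>G1\<close>; the symmetry \<open>J1\<close> turns the representing vector into
  one for the indefinite form. With \<open>adjoint_pair_bounded_ops\<close> this makes boundedness
  and having an adjoint the same thing.\<close>

lemma bounded_ops_adjoint_pair:
  assumes "T \<in> bounded_ops K1 K2"
  shows "adjoint_pair K1 K2 T (adj K1 K2 T)"
proof -
  obtain G1 J1 G2 J2 M where lin: "linear_op K1 K2 T" and "fundamental K1 G1 J1" "fundamental K2 G2 J2"
    and M: "\<And>x. x \<in> carrier K1 \<Longrightarrow> ip_norm G2 (T x) \<le> M * ip_norm G1 x"
    using assms unfolding bounded_ops_def by blast
  then interpret F1: fundamental_symmetry K1 G1 J1 + F2: fundamental_symmetry K2 G2 J2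
    by unfold_locales
  interpret K2: ips K2 by (rule F2.ips)
  have T: "\<And>x. x \<in> carrier K1 \<Longrightarrow> T x \<in> carrier K2"
    and T_add: "\<And>x y. \<lbrakk>x \<in> carrier K1; y \<in> carrier K1\<rbrakk> \<Longrightarrow> T (x + y) = T x + T y"
    and T_scale: "\<And>c x. x \<in> carrier K1 \<Longrightarrow> T (c *\<^sub>C x) = c *\<^sub>C T x"
    using lin by (auto simp: linear_op_def)
  have ex: "\<exists>z. z \<in> carrier K1 \<and> (\<forall>x\<in>carrier K1. form K2 (T x) y = form K1 x z)" if y: "y \<in> carrier K2" for y
  proof -
    have bound: "cmod (form K2 (T x) y) \<le> (\<bar>M\<bar> * ip_norm G2 y) * ip_norm G1 x" if "x \<in> carrier G1" for x
    proof -
      have "cmod (form K2 (T x) y) \<le> ip_norm G2 (T x) * ip_norm G2 y"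
        using that y T by (intro F2.form_bound) (simp_all flip: F1.carrier_eq F2.carrier_eq)
      also have "\<dots> \<le> (\<bar>M\<bar> * ip_norm G1 x) * ip_norm G2 y"
      proof (rule mult_right_mono)
        have "M * ip_norm G1 x \<le> \<bar>M\<bar> * ip_norm G1 x"
          using that by (intro mult_right_mono) simp_all
        then show "ip_norm G2 (T x) \<le> \<bar>M\<bar> * ip_norm G1 x"
          using M[of x] that by (simp add: F1.carrier_eq)
      qed (use y in \<open>simp add: F2.carrier_eq\<close>)
      finally show ?thesis by (simp add: ac_simps)
    qed
    have nn: "0 \<le> \<bar>M\<bar> * ip_norm G2 y" using y by (simp add: F2.carrier_eq)
    have "\<exists>z s. z \<in> carrier G1 \<and> (\<forall>x\<in>carrier G1. form K2 (T x) y = form G1 x z) \<and>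
        ip_norm G1 z \<le> \<bar>M\<bar> * ip_norm G2 y \<and>
        (\<forall>n::nat. s n \<in> carrier G1) \<and> (\<lambda>n. ip_norm G1 (s n - z)) \<longlonglongrightarrow> 0"
      using y T by (intro F1.Riesz[OF F1.subspace_carrier _ _ _ bound nn])
        (simp_all add: T_add T_scale K2.form_add_left K2.form_scale_left flip: F1.carrier_eq)
    then obtain z where z: "z \<in> carrier G1" "\<And>x. x \<in> carrier G1 \<Longrightarrow> form K2 (T x) y = form G1 x z"
      by blast
    then show ?thesis
      by (intro exI[of _ "J1 z"]) (simp add: F1.carrier_eq F1.form_J_right)
  qed
  have "adj K1 K2 T y \<in> carrier K1 \<and> (\<forall>x\<in>carrier K1. form K2 (T x) y = form K1 x (adj K1 K2 T y))"
    if y: "y \<in> carrier K2" for y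
    unfolding adj_def
  proof (rule theI')
    show "\<exists>!z. z \<in> carrier K1 \<and> (\<forall>x\<in>carrier K1. form K2 (T x) y = form K1 x z)"
      using ex[OF y] by (rule ex_ex1I) (metis F1.eqI)
  qed
  then show ?thesis
    using T by (simp add: adjoint_pair_def Pi_iff)
qed

lemma unitary_opI:
  assumes "adjoint_pair K1 K2 U U'" "krein_space K1" "krein_space K2"
    and "\<And>x. x \<in> carrier K1 \<Longrightarrow> U' (U x) = x" "\<And>y. y \<in> carrier K2 \<Longrightarrow> U (U' y) = y"
  shows "unitary_op K1 K2 U"
proof -
  have "U x \<in> carrier K2" if "x \<in> carrier K1" for x
    using assms(1) that by (auto simp: adjoint_pair_def)
  then show ?thesis
    unfolding unitary_op_def using adjoint_pair_bounded_ops[OF assms(1-3)] assms(4,5)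
    by (simp add: adj_eq[OF assms(1,2)])
qed

text \<open>Riesz on \<open>A\<close> for the functional \<open><a, x>\<close> produces the
  projection z of x to the closure of \<open>A\<close>, together with a sequence in \<open>A\<close>
  tending to it. The vector \<open>J (z - x)\<close> is then orthogonal to \<open>A\<close> for the
  indefinite form, so \<open>sep\<close> forces \<open>z = x\<close>.\<close>

lemma (in fundamental_symmetry) approximation:
  assumes sub: "complex_vector.subspace A" and A: "A \<subseteq> carrier K"
    and sep: "\<And>x. \<lbrakk>x \<in> carrier K; \<And>a. a \<in> A \<Longrightarrow> form K a x = 0\<rbrakk> \<Longrightarrow> x = 0"
    and x: "x \<in> carrier K"
  obtains s where "\<And>n::nat. s n \<in> A" "(\<lambda>n. ip_norm G (s n - x)) \<longlonglongrightarrow> 0"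
proof -
  have mem: "a \<in> carrier G" if "a \<in> A" for a using A that by (auto simp: carrier_eq)
  have xG: "x \<in> carrier G" using x by (simp add: carrier_eq)
  have "\<exists>z s. z \<in> carrier G \<and> (\<forall>a\<in>A. form G a x = form G a z) \<and> ip_norm G z \<le> ip_norm G x \<and>
      (\<forall>n::nat. s n \<in> A) \<and> (\<lambda>n. ip_norm G (s n - z)) \<longlonglongrightarrow> 0"
    using mem xG Cauchy_Schwarz by (intro Riesz[OF sub]) (auto simp: form_simps mult.commute)
  then obtain z s where z: "z \<in> carrier G" "\<And>a. a \<in> A \<Longrightarrow> form G a x = form G a z"
    and s: "\<And>n::nat. s n \<in> A" "(\<lambda>n. ip_norm G (s n - z)) \<longlonglongrightarrow> 0"
    by blast
  have "J (z - x) = 0"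
    using z xG mem by (intro sep) (simp_all add: carrier_eq form_J_right form_diff_right)
  then have "z - x = J 0"
    using z xG J_J[of "z - x"] by simp
  moreover have "J 0 = 0"
    using J_scale[of 0 0] by simp
  ultimately have "z = x" by simp
  with s show thesis using that by blast
qed

text \<open>The condition on the right mentions no Hilbert structure, so density for one fundamental
  symmetry implies it for all.\<close>

lemma dense_in_iff:
  assumes "krein_space K" and sub: "complex_vector.subspace A" and A: "A \<subseteq> carrier K"
  shows "dense_in K A \<longleftrightarrow> (\<forall>x\<in>carrier K. (\<forall>a\<in>A. form K a x = 0) \<longrightarrow> x = 0)"
proof
  assume "dense_in K A"
  then obtain G J where "fundamental K G J"
    and cl: "Metric_space.mtopology (carrier G) (ip_dist G) closure_of A = carrier K"
    unfolding dense_in_def by blast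
  then interpret F: fundamental_symmetry K G J by unfold_locales
  have AG: "A \<subseteq> carrier G" using A by (simp add: F.carrier_eq)
  have near: "\<exists>a\<in>A. ip_norm G (a - x) < e" if "x \<in> carrier G" "0 < e" for x e
    using cl that F.closure_iff[OF AG] by (simp add: F.carrier_eq)
  show "\<forall>x\<in>carrier K. (\<forall>a\<in>A. form K a x = 0) \<longrightarrow> x = 0"
  proof (intro ballI impI)
    fix x assume "x \<in> carrier K" and 0: "\<forall>a\<in>A. form K a x = 0"
    then have x: "x \<in> carrier G" by (simp add: F.carrier_eq)
    have "cmod (form G (J x) (J x)) \<le> 0"
    proof (rule ccontr)
      define p where "p = cmod (form G (J x) (J x))"
      assume "\<not> ?thesis"
      then have p: "0 < p" by (simp add: p_def)
      have nx: "0 \<le> ip_norm G (J x)" using x by simp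
      \<comment> \<open>A point of \<open>A\<close> near \<open>J x\<close>: its Hilbert product
        with \<open>J x\<close> is \<open>[a, x] = 0\<close>, so p is also the product of
        \<open>a - J x\<close> with \<open>J x\<close>, which this radius makes smaller than
        p.\<close>
      obtain a where a: "a \<in> A" "ip_norm G (a - J x) < p / (1 + ip_norm G (J x))"
        using near[of "J x" "p / (1 + ip_norm G (J x))"] p x nx by (auto simp: divide_pos_pos add_pos_nonneg)
      have aG: "a \<in> carrier G" using a AG by blast
      have "form G a (J x) = 0" using 0 a(1) F.form_eq_right[OF aG x] by simp
      then have "p = cmod (form G (a - J x) (J x))"
        using aG x by (simp add: p_def F.form_diff_left)
      also have "\<dots> \<le> ip_norm G (a - J x) * ip_norm G (J x)"
        using aG x by (intro F.Cauchy_Schwarz) simp_all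
      also have "\<dots> \<le> ip_norm G (a - J x) * (1 + ip_norm G (J x))"
        using aG x by (intro mult_left_mono) simp_all
      also have "\<dots> < p"
        using a(2) nx by (simp add: pos_less_divide_eq)
      finally show False by simp
    qed
    then have "x = 0" using x F.form_pos[of x] by (auto simp: F.J_symmetric)
    then show "x = 0" .
  qed
next
  assume sep: "\<forall>x\<in>carrier K. (\<forall>a\<in>A. form K a x = 0) \<longrightarrow> x = 0"
  obtain G J where "fundamental_symmetry K G J" using assms krein_space_iff by blast
  then interpret F: fundamental_symmetry K G J .
  have AG: "A \<subseteq> carrier G" using A by (simp add: F.carrier_eq)
  have "\<exists>a\<in>A. ip_norm G (a - x) < e" if x: "x \<in> carrier G" and e: "0 < e" for x e
  proof -
    obtain s where s: "\<And>n::nat. s n \<in> A" "(\<lambda>n. ip_norm G (s n - x)) \<longlonglongrightarrow> 0"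
      by (rule F.approximation[OF sub A, of x]) (use sep x in \<open>auto simp: F.carrier_eq\<close>)
    have "\<forall>\<^sub>F n in sequentially. ip_norm G (s n - x) < e"
      using order_tendstoD(2)[OF s(2) e] .
    then obtain n where "ip_norm G (s n - x) < e"
      using eventually_happens'[OF sequentially_bot] by blast
    then show ?thesis using s(1) by blast
  qed
  then have "Metric_space.mtopology (carrier G) (ip_dist G) closure_of A = carrier K"
    unfolding F.carrier_eq F.closure_iff[OF AG] by blast
  then show "dense_in K A"
    unfolding dense_in_def using F.fundamental by blast
qed

text \<open>Only semidefiniteness of \<open>[j x, y]\<close> is asked; definiteness and completeness
  come from comparison with some existing structure \<open>G\<close>, \<open>J\<close>. Being its
  own adjoint, \<open>j\<close> is bounded for \<open>G\<close>, which gives \<open>upper\<close>;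
  Cauchy-Schwarz for the new form gives \<open>lower\<close>.\<close>

lemma fundamentalI:
  assumes krein: "krein_space K" and j: "j \<in> carrier K \<rightarrow> carrier K"
    and sym: "\<And>x y. \<lbrakk>x \<in> carrier K; y \<in> carrier K\<rbrakk> \<Longrightarrow> form K (j x) y = form K x (j y)"
    and inv: "\<And>x. x \<in> carrier K \<Longrightarrow> j (j x) = x"
    and nonneg: "\<And>x. x \<in> carrier K \<Longrightarrow> 0 \<le> Re (form K (j x) x)"
  shows "fundamental_symmetry K \<lparr>carrier = carrier K, form = \<lambda>x y. form K (j x) y\<rparr> j"
proof -
  obtain G J where "fundamental_symmetry K G J" using krein krein_space_iff by blast
  then interpret F: fundamental_symmetry K G J .
  interpret K: ips K by (rule F.ips)
  have jm [simp]: "j x \<in> carrier K" if "x \<in> carrier K" for x using j that by blast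
  have Jm [simp]: "J x \<in> carrier K" if "x \<in> carrier K" for x using that by (simp add: F.carrier_eq)
  have pair: "adjoint_pair K K j j"
    using j sym by (auto simp: adjoint_pair_def)
  have "linear_op K K j" by (rule adjoint_pair_linear[OF pair krein krein])
  then have add: "\<And>x y. \<lbrakk>x \<in> carrier K; y \<in> carrier K\<rbrakk> \<Longrightarrow> j (x + y) = j x + j y"
    and scale: "\<And>c x. x \<in> carrier K \<Longrightarrow> j (c *\<^sub>C x) = c *\<^sub>C j x"
    by (auto simp: linear_op_def)
  obtain M where M: "0 \<le> M" "\<And>x. x \<in> carrier K \<Longrightarrow> ip_norm G (j x) \<le> M * ip_norm G x"
    using adjoint_pair_bounded[OF pair F.fundamental_symmetry_axioms F.fundamental_symmetry_axioms] by blast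
  define N where "N = \<lparr>carrier = carrier K, form = \<lambda>x y. form K (j x) y\<rparr>"
  have N_simps [simp]: "carrier N = carrier K" "form N x y = form K (j x) y" for x y
    by (simp_all add: N_def)
  interpret N: psd_ips N
  proof
    have *: "form K (j y) x = cnj (form K (j x) y)" if "x \<in> carrier K" "y \<in> carrier K" for x y
      using that K.form_commute[of "j x" y] by (simp add: sym)
    show "inner_product_space N"
      unfolding inner_product_space_def
    proof (intro conjI)
      show "\<forall>x\<in>carrier N. \<forall>y\<in>carrier N. form N y x = cnj (form N x y)"
        unfolding N_simps using * by blast
    qed (use K.subspace_carrier in \<open>simp_all add: add scale K.form_add_left K.form_scale_left\<close>)
    show "0 \<le> Re (form N x x)" if "x \<in> carrier N" for x
      using that nonneg by simp
  qed
  have upper: "ip_norm N x \<le> sqrt M * ip_norm G x" if x: "x \<in> carrier K" for x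
  proof -
    have "Re (form K (j x) x) \<le> cmod (form K (j x) x)" by (rule complex_Re_le_cmod)
    also have "\<dots> \<le> ip_norm G (j x) * ip_norm G x"
      using x jm[OF x] by (intro F.form_bound) (simp_all flip: F.carrier_eq)
    also have "\<dots> \<le> M * ip_norm G x * ip_norm G x"
      using x M by (intro mult_right_mono) (simp_all add: F.carrier_eq)
    finally have "sqrt (Re (form K (j x) x)) \<le> sqrt (M * (ip_norm G x)\<^sup>2)"
      by (simp add: power2_eq_square ac_simps)
    then show ?thesis
      using x F.norm_ge_0[of x] by (simp add: ip_norm_def[of N] real_sqrt_mult F.carrier_eq)
  qed
  have lower: "ip_norm G x \<le> sqrt M * M * ip_norm N x" if x: "x \<in> carrier K" for x
  proof (cases "ip_norm G x = 0")
    case False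
    have nx: "0 \<le> ip_norm G x" using x by (simp add: F.carrier_eq)
    \<comment> \<open>Chosen so that \<open>[j x, l] = [x, J x]\<close>, the squared norm of x in
      \<open>G\<close>.\<close>
    define l where "l = j (J x)"
    have l: "l \<in> carrier K" using x by (simp add: l_def)
    have "form N x l = form K x (J x)"
      using x by (simp add: l_def sym inv)
    also have "\<dots> = form G x x" using x by (simp add: F.form_J_right F.carrier_eq)
    finally have "(ip_norm G x)\<^sup>2 = cmod (form N x l)"
      using F.norm_power2_complex[of x] x by (metis F.carrier_eq abs_of_nonneg norm_of_real zero_le_power2)
    also have "\<dots> \<le> ip_norm N x * ip_norm N l" using x l by (intro N.Cauchy_Schwarz) simp_all
    also have "\<dots> \<le> ip_norm N x * (sqrt M * (M * ip_norm G x))"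
    proof (rule mult_left_mono)
      have "ip_norm G l \<le> M * ip_norm G x"
        using M(2)[of "J x"] x by (simp add: l_def F.carrier_eq)
      then have "sqrt M * ip_norm G l \<le> sqrt M * (M * ip_norm G x)"
        using M by (intro mult_left_mono) simp_all
      then show "ip_norm N l \<le> sqrt M * (M * ip_norm G x)"
        using upper[OF l] by simp
    qed (use x N.norm_ge_0 in simp)
    finally have "ip_norm G x * ip_norm G x \<le> (sqrt M * M * ip_norm N x) * ip_norm G x"
      by (simp add: power2_eq_square ac_simps)
    then show ?thesis
      by (rule mult_right_le_imp_le) (use False nx in \<open>simp add: less_le\<close>)
  qed (use M x N.norm_ge_0 in simp)
  interpret N: posdef_ips N
  proof
    show "0 < Re (form N x x)" if "x \<in> carrier N" "x \<noteq> 0" for x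
    proof -
      have "ip_norm G x \<noteq> 0" using that by (simp add: F.norm_eq_zero F.carrier_eq)
      then have "ip_norm N x \<noteq> 0" using lower[of x] that F.norm_ge_0[of x] by (fastforce simp: F.carrier_eq)
      then show ?thesis using N.form_nonneg[OF that(1)] by (auto simp: ip_norm_def less_le)
    qed
  qed
  have "hilbert N"
  proof (rule N.hilbertI)
    fix s assume s: "ip_Cauchy N s"
    have sK: "s n \<in> carrier K" for n using ip_Cauchy_carrier[OF s, of n] by simp
    \<comment> \<open>The summand 1 keeps the divisor positive when \<open>M\<close> is 0.\<close>
    define C where "C = sqrt M * M + 1"
    have C: "0 < C" using M by (simp add: C_def add_nonneg_pos)
    have "ip_Cauchy G s"
      unfolding ip_Cauchy_def
    proof (intro conjI allI impI)
      show "range s \<subseteq> carrier G" using sK by (auto simp: F.carrier_eq)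
      fix e :: real assume "0 < e"
      then obtain k where k: "\<And>m n. \<lbrakk>k \<le> m; k \<le> n\<rbrakk> \<Longrightarrow> ip_norm N (s m - s n) < e / C"
        using s C unfolding ip_Cauchy_def by (meson divide_pos_pos)
      have "ip_norm G (s m - s n) < e" if "k \<le> m" "k \<le> n" for m n
      proof -
        have "ip_norm G (s m - s n) \<le> sqrt M * M * ip_norm N (s m - s n)"
          by (rule lower) (simp add: sK)
        also have "\<dots> \<le> C * ip_norm N (s m - s n)"
          using N.norm_ge_0[of "s m - s n"] by (intro mult_right_mono) (simp_all add: C_def sK)
        also have "\<dots> < e" using k[OF that] C by (simp add: pos_less_divide_eq mult.commute)
        finally show ?thesis .
      qed
      then show "\<exists>N. \<forall>m\<ge>N. \<forall>n\<ge>N. ip_norm G (s m - s n) < e" by blast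
    qed
    then obtain x where x: "x \<in> carrier G" "(\<lambda>n. ip_norm G (s n - x)) \<longlonglongrightarrow> 0"
      by (rule F.Cauchy_convergent)
    have "(\<lambda>n. ip_norm N (s n - x)) \<longlonglongrightarrow> 0"
    proof (rule Lim_null_comparison)
      show "\<forall>\<^sub>F n in sequentially. norm (ip_norm N (s n - x)) \<le> sqrt M * ip_norm G (s n - x)"
        using upper[of "s _ - x"] N.norm_ge_0[of "s _ - x"] sK x by (simp add: F.carrier_eq)
      show "(\<lambda>n. sqrt M * ip_norm G (s n - x)) \<longlonglongrightarrow> 0"
        using x(2) by (rule tendsto_mult_right_zero)
    qed
    then show "\<exists>x\<in>carrier N. (\<lambda>n. ip_norm N (s n - x)) \<longlonglongrightarrow> 0"
      using x by (auto simp: F.carrier_eq)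
  qed
  then have "fundamental K N j"
    unfolding fundamental_def hilbert_def using add scale sym inv j by (simp add: linear_op_def)
  then show ?thesis
    by (simp add: fundamental_symmetry_def N_def)
qed

section \<open>Reflections in orthonormal systems\<close>

text \<open>A family instead of a set, so that \<open>B\<close> itself can index its images in other
  spaces and their injectivity never has to be discussed. The sign s is kept variable because the
  same vectors are negative for the indefinite forms and positive in the Hilbert completion.\<close>

definition orthonormal_system ::
  "'v::complex_vector inner_space \<Rightarrow> real \<Rightarrow> ('i \<Rightarrow> 'v) \<Rightarrow> 'i set \<Rightarrow> bool" where
  "orthonormal_system K s n B \<longleftrightarrow> finite B \<and> s * s = 1 \<and> n \<in> B \<rightarrow> carrier K \<and>
     (\<forall>b\<in>B. \<forall>c\<in>B. form K (n b) (n c) = (if b = c then of_real s else 0))"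

text \<open>Minus the identity on the span of the system and the identity on its orthogonal
  companion. The projection to the span is \<open>s\<close> times the sum of the
  \<open>[x, n b] n b\<close>, so the form may be degenerate and the space incomplete.\<close>

definition reflection ::
  "'v::complex_vector inner_space \<Rightarrow> real \<Rightarrow> ('i \<Rightarrow> 'v) \<Rightarrow> 'i set \<Rightarrow> 'v \<Rightarrow> 'v" where
  "reflection K s n B x = x - (\<Sum>b\<in>B. (2 * of_real s * form K x (n b)) *\<^sub>C n b)"

context ips
begin

context
  fixes s n B
  assumes system: "orthonormal_system G s n B"
begin

lemma system_mem: "b \<in> B \<Longrightarrow> n b \<in> carrier G"
  using system by (auto simp: orthonormal_system_def)

lemma reflection_mem: "x \<in> carrier G \<Longrightarrow> reflection G s n B x \<in> carrier G"
  by (auto simp: reflection_def system_mem)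

lemma form_reflection:
  assumes "x \<in> carrier G" "y \<in> carrier G"
  shows "form G (reflection G s n B x) y =
    form G x y - 2 * of_real s * (\<Sum>b\<in>B. form G x (n b) * form G (n b) y)"
  using assms
  by (simp add: reflection_def form_diff_left form_sum_left form_scale_left sum_distrib_left system_mem ac_simps)

lemma reflection_symmetric:
  assumes "x \<in> carrier G" "y \<in> carrier G"
  shows "form G (reflection G s n B x) y = form G x (reflection G s n B y)"
proof -
  have "form G x (reflection G s n B y) = cnj (form G (reflection G s n B y) x)"
    using assms by (intro form_commute reflection_mem)
  also have "\<dots> = cnj (form G y x) - 2 * of_real s * (\<Sum>b\<in>B. cnj (form G y (n b)) * cnj (form G (n b) x))"
    using assms by (simp add: form_reflection)
  also have "\<dots> = form G x y - 2 * of_real s * (\<Sum>b\<in>B. form G x (n b) * form G (n b) y)"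
    using assms by (simp add: mult.commute system_mem flip: form_commute)
  finally show ?thesis using assms by (simp add: form_reflection)
qed

lemma reflection_system:
  assumes "b \<in> B"
  shows "reflection G s n B (n b) = - n b"
proof -
  have fin: "finite B" and s: "s * s = 1" and on: "\<And>c. c \<in> B \<Longrightarrow> form G (n b) (n c) = (if b = c then of_real s else 0)"
    using system assms by (auto simp: orthonormal_system_def)
  have "(\<Sum>c\<in>B. (2 * of_real s * form G (n b) (n c)) *\<^sub>C n c) = (\<Sum>c\<in>B. if c = b then 2 *\<^sub>C n b else 0)"
  proof (rule sum.cong)
    fix c assume "c \<in> B"
    moreover have "2 * complex_of_real s * complex_of_real s = 2"
      using s by (simp add: mult.assoc flip: of_real_mult)
    ultimately show "(2 * of_real s * form G (n b) (n c)) *\<^sub>C n c = (if c = b then 2 *\<^sub>C n b else 0)"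
      by (simp add: on)
  qed simp
  also have "\<dots> = n b + n b"
    using fin assms complex_vector.scale_left_distrib[of 1 1 "n b"] by simp
  finally show ?thesis by (simp add: reflection_def)
qed

lemma form_reflection_system:
  assumes "x \<in> carrier G" "b \<in> B"
  shows "form G (reflection G s n B x) (n b) = - form G x (n b)"
  using assms form_diff_right[of x 0 "n b"] by (simp add: reflection_symmetric reflection_system system_mem reflection_mem)

text \<open>A reflection changes the sign of every coefficient \<open>[x, n b]\<close>, so the
  second application adds back what the first one subtracted.\<close>

lemma reflection_reflection:
  assumes x: "x \<in> carrier G"
  shows "reflection G s n B (reflection G s n B x) = x"
proof -
  have "(\<Sum>b\<in>B. (2 * of_real s * form G (reflection G s n B x) (n b)) *\<^sub>C n b) =
      (\<Sum>b\<in>B. - ((2 * of_real s * form G x (n b)) *\<^sub>C n b))"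
    by (rule sum.cong) (simp_all add: form_reflection_system x)
  then show ?thesis
    unfolding reflection_def[of G s n B "reflection G s n B x"]
    by (simp add: sum_negf reflection_def[of G s n B x])
qed

end

section \<open>Maximal negative orthonormal systems\<close>

lemma form_combination:
  assumes "orthonormal_system G s (\<lambda>b. b) B"
  shows "b \<in> B \<Longrightarrow> form G (\<Sum>c\<in>B. u c *\<^sub>C c) b = of_real s * u b"
    and "form G (\<Sum>c\<in>B. u c *\<^sub>C c) (\<Sum>c\<in>B. u c *\<^sub>C c) = of_real (s * (\<Sum>c\<in>B. (cmod (u c))\<^sup>2))"
proof -
  have fin: "finite B" and mem: "\<And>b. b \<in> B \<Longrightarrow> b \<in> carrier G"
    and on: "\<And>b c. \<lbrakk>b \<in> B; c \<in> B\<rbrakk> \<Longrightarrow> form G b c = (if b = c then of_real s else 0)"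
    using assms by (auto simp: orthonormal_system_def)
  show *: "form G (\<Sum>c\<in>B. u c *\<^sub>C c) b = of_real s * u b" if "b \<in> B" for b
  proof -
    have "form G (\<Sum>c\<in>B. u c *\<^sub>C c) b = (\<Sum>c\<in>B. if c = b then of_real s * u b else 0)"
      using that by (simp add: form_sum_left form_scale_left mem) (auto intro!: sum.cong simp: on)
    then show ?thesis using that fin by simp
  qed
  have "form G (\<Sum>c\<in>B. u c *\<^sub>C c) (\<Sum>c\<in>B. u c *\<^sub>C c) = (\<Sum>b\<in>B. cnj (u b) * form G (\<Sum>c\<in>B. u c *\<^sub>C c) b)"
    using form_sum_right[of B "\<lambda>c. u c *\<^sub>C c" "\<Sum>c\<in>B. u c *\<^sub>C c"] by (simp add: mem form_scale_right)
  also have "\<dots> = (\<Sum>b\<in>B. of_real s * of_real ((cmod (u b))\<^sup>2))"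
    by (intro sum.cong) (simp_all add: * mult.left_commute[of _ "of_real s"] cnj_mult_self[simplified])
  finally show "form G (\<Sum>c\<in>B. u c *\<^sub>C c) (\<Sum>c\<in>B. u c *\<^sub>C c) = of_real (s * (\<Sum>c\<in>B. (cmod (u c))\<^sup>2))"
    by (simp add: sum_distrib_left)
qed

text \<open>Translates a bound on the dimension of negative subspaces, which is what the number of
  negative squares provides, into a bound on the size of negative orthonormal systems.\<close>

lemma negative_subspace_span:
  assumes system: "orthonormal_system G (-1) (\<lambda>b. b) B"
  shows "negative_subspace G (complex_vector.span B)" "complex_vector.dim (complex_vector.span B) = card B"
proof -
  have fin: "finite B" and mem: "B \<subseteq> carrier G"
    using system by (auto simp: orthonormal_system_def)
  have "Re (form G f f) < 0" if "f \<in> complex_vector.span B" "f \<noteq> 0" for f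
  proof -
    obtain u where u: "f = (\<Sum>c\<in>B. u c *\<^sub>C c)"
      using \<open>f \<in> complex_vector.span B\<close> complex_vector.span_finite[OF fin] by auto
    have "\<exists>b\<in>B. u b \<noteq> 0"
    proof (rule ccontr)
      assume "\<not> ?thesis"
      then have "f = 0" unfolding u by (intro sum.neutral) simp
      then show False using \<open>f \<noteq> 0\<close> by simp
    qed
    then obtain b where b: "b \<in> B" "u b \<noteq> 0" by blast
    have "0 < (cmod (u b))\<^sup>2" using b by simp
    also have "\<dots> \<le> (\<Sum>c\<in>B. (cmod (u c))\<^sup>2)" using b fin by (intro member_le_sum) simp_all
    finally show ?thesis
      unfolding u form_combination(2)[OF system] by simp
  qed
  then show "negative_subspace G (complex_vector.span B)"
    unfolding negative_subspace_def
    using complex_vector.span_minimal[OF mem subspace_carrier] complex_vector.subspace_span by blast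
  have "complex_vector.independent B"
  proof (rule complex_vector.independent_if_scalars_zero[OF fin])
    fix u b assume "(\<Sum>c\<in>B. u c *\<^sub>C c) = 0" "b \<in> B"
    then show "u b = 0"
      using form_combination(1)[OF system, of b u] mem by auto
  qed
  then show "complex_vector.dim (complex_vector.span B) = card B"
    by (rule complex_vector.dim_span_eq_card_independent)
qed

text \<open>A negative orthonormal system of maximal size does the work of a maximal negative subspace.\<close>

lemma nonneg_reflection:
  assumes bound: "\<And>B. orthonormal_system G (-1) (\<lambda>b. b) B \<Longrightarrow> card B \<le> k"
  shows "\<exists>B. orthonormal_system G (-1) (\<lambda>b. b) B \<and>
    (\<forall>x\<in>carrier G. 0 \<le> Re (form G (reflection G (-1) (\<lambda>b. b) B x) x))"
proof -
  have "orthonormal_system G (-1) (\<lambda>b. b) {}" by (simp add: orthonormal_system_def)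
  moreover have "\<forall>B. orthonormal_system G (-1) (\<lambda>b. b) B \<longrightarrow> card B < Suc k"
    using bound by (simp add: less_Suc_eq_le)
  ultimately have "\<exists>B. orthonormal_system G (-1) (\<lambda>b. b) B \<and>
      (\<forall>C. orthonormal_system G (-1) (\<lambda>b. b) C \<longrightarrow> card C \<le> card B)"
    by (rule ex_has_greatest_nat)
  then obtain B where system: "orthonormal_system G (-1) (\<lambda>b. b) B"
    and max: "\<And>C. orthonormal_system G (-1) (\<lambda>b. b) C \<Longrightarrow> card C \<le> card B"
    by auto
  have fin: "finite B" and mem [simp]: "\<And>b. b \<in> B \<Longrightarrow> b \<in> carrier G"
    and on: "\<And>b c. \<lbrakk>b \<in> B; c \<in> B\<rbrakk> \<Longrightarrow> form G b c = (if b = c then - 1 else 0)"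
    using system by (auto simp: orthonormal_system_def)
  {
    fix x assume x: "x \<in> carrier G"
    \<comment> \<open>As \<open>[b, b] = -1\<close>, this is minus the projection of x to the span
      of \<open>B\<close>; the component orthogonal to \<open>B\<close> is
      \<open>x + p\<close>.\<close>
    define p where "p = (\<Sum>b\<in>B. form G x b *\<^sub>C b)"
    have p [simp]: "p \<in> carrier G" by (simp add: p_def)
    have perp: "form G (x + p) b = 0" if "b \<in> B" for b
      using form_combination(1)[OF system that, of "form G x"] x that by (simp add: form_add_left p_def)
    have perp': "form G b (x + p) = 0" if "b \<in> B" for b
      using form_commute[of "x + p" b] perp[OF that] that x by simp
    have nonneg: "0 \<le> Re (form G (x + p) (x + p))"
    proof (rule ccontr)
      define q where "q = Re (form G (x + p) (x + p))"
      assume "\<not> ?thesis"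
      then have q: "q < 0" by (simp add: q_def)
      \<comment> \<open>Normalized to \<open>[e, e] = -1\<close>, so that e could be added to the
        system \<open>B\<close> of maximal size.\<close>
      define e where "e = of_real (1 / sqrt (- q)) *\<^sub>C (x + p)"
      have e: "e \<in> carrier G" using x by (simp add: e_def)
      have "form G (x + p) (x + p) = of_real q"
        using form_self[of "x + p"] x by (simp add: q_def)
      then have ee: "form G e e = - 1"
        using x q by (simp add: e_def form_scale_left form_scale_right flip: of_real_mult of_real_divide)
      have eb: "form G e b = 0" "form G b e = 0" if "b \<in> B" for b
        using x that perp perp' by (simp_all add: e_def form_scale_left form_scale_right)
      have "e \<notin> B" using ee eb by force
      moreover have "orthonormal_system G (-1) (\<lambda>b. b) (insert e B)"
        unfolding orthonormal_system_def using fin e ee eb on \<open>e \<notin> B\<close> by auto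
      ultimately show False
        using max[of "insert e B"] fin by simp
    qed
    have sq: "(\<Sum>b\<in>B. form G x b * form G b x) = of_real (\<Sum>b\<in>B. (cmod (form G x b))\<^sup>2)"
    proof -
      have "form G x b * form G b x = of_real ((cmod (form G x b))\<^sup>2)" if "b \<in> B" for b
        using form_commute[of x b] x that complex_norm_square[of "form G x b"] by simp
      then show ?thesis by (simp del: of_real_power)
    qed
    have "form G (x + p) p = 0"
      unfolding p_def by (subst form_sum_right) (use x perp in \<open>simp_all add: form_scale_right flip: p_def\<close>)
    then have "form G (x + p) (x + p) = form G x x + form G p x"
      using x by (simp add: form_add_left form_add_right)
    moreover have "form G p x = of_real (\<Sum>b\<in>B. (cmod (form G x b))\<^sup>2)"
      using x sq by (simp add: p_def form_sum_left form_scale_left)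
    moreover have "form G (reflection G (-1) (\<lambda>b. b) B x) x = form G x x + 2 * of_real (\<Sum>b\<in>B. (cmod (form G x b))\<^sup>2)"
      by (simp only: form_reflection[OF system x x] sq) simp
    \<comment> \<open>The reflected square splits into that of the orthogonal component, nonnegative
      by maximality, and the contribution of \<open>B\<close>, whose sign has been turned.\<close>
    ultimately have "Re (form G (reflection G (-1) (\<lambda>b. b) B x) x) =
        Re (form G (x + p) (x + p)) + (\<Sum>b\<in>B. (cmod (form G x b))\<^sup>2)"
      by simp
    then have "0 \<le> Re (form G (reflection G (-1) (\<lambda>b. b) B x) x)"
      using nonneg by (simp add: sum_nonneg)
  }
  then show ?thesis using system by blast
qed

end

section \<open>Completion inside a given space\<close>

context psd_ips
begin

lemma norm_Cauchy_bounded: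
  assumes "ip_Cauchy G s"
  shows "\<exists>C>0. \<forall>n. ip_norm G (s n) \<le> C"
proof -
  have sG: "s n \<in> carrier G" for n using ip_Cauchy_carrier[OF assms] .
  have "Cauchy (\<lambda>n. ip_norm G (s n))"
  proof (rule CauchyI)
    fix e :: real assume "0 < e"
    then obtain N where "\<And>m n. \<lbrakk>N \<le> m; N \<le> n\<rbrakk> \<Longrightarrow> ip_norm G (s m - s n) < e"
      using assms unfolding ip_Cauchy_def by meson
    then have "norm (ip_norm G (s m) - ip_norm G (s n)) < e" if "N \<le> m" "N \<le> n" for m n
      using le_less_trans[OF norm_diff_ineq[OF sG sG]] that by (simp only: real_norm_def)
    then show "\<exists>M. \<forall>m\<ge>M. \<forall>n\<ge>M. norm (ip_norm G (s m) - ip_norm G (s n)) < e" by blast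
  qed
  then have "Bseq (\<lambda>n. ip_norm G (s n))" by (rule Cauchy_Bseq)
  then obtain C where "0 < C" "\<forall>n. norm (ip_norm G (s n)) \<le> C" by (rule BseqE)
  then show ?thesis by (intro exI[of _ C]) (simp add: abs_le_iff)
qed

lemma ip_Cauchy_const: "x \<in> carrier G \<Longrightarrow> ip_Cauchy G (\<lambda>_. x)"
  by (simp add: ip_Cauchy_def)

lemma ip_Cauchy_add:
  assumes s: "ip_Cauchy G s" and t: "ip_Cauchy G t"
  shows "ip_Cauchy G (\<lambda>n. s n + t n)"
  unfolding ip_Cauchy_def
proof (intro conjI allI impI)
  note mem [simp] = ip_Cauchy_carrier[OF s] ip_Cauchy_carrier[OF t]
  show "range (\<lambda>n. s n + t n) \<subseteq> carrier G" by auto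
  fix e :: real assume "0 < e"
  then obtain N M where N: "\<And>m n. \<lbrakk>N \<le> m; N \<le> n\<rbrakk> \<Longrightarrow> ip_norm G (s m - s n) < e / 2"
    and M: "\<And>m n. \<lbrakk>M \<le> m; M \<le> n\<rbrakk> \<Longrightarrow> ip_norm G (t m - t n) < e / 2"
    using s t unfolding ip_Cauchy_def by (meson half_gt_zero)
  have "ip_norm G (s m + t m - (s n + t n)) < e" if "max N M \<le> m" "max N M \<le> n" for m n
  proof -
    have "ip_norm G (s m + t m - (s n + t n)) \<le> ip_norm G (s m - s n) + ip_norm G (t m - t n)"
      using norm_triangle[of "s m - s n" "t m - t n"] by (simp add: algebra_simps)
    then show ?thesis using N[of m n] M[of m n] that by simp
  qed
  then show "\<exists>N. \<forall>m\<ge>N. \<forall>n\<ge>N. ip_norm G (s m + t m - (s n + t n)) < e" by blast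
qed

lemma ip_Cauchy_scale:
  assumes s: "ip_Cauchy G s"
  shows "ip_Cauchy G (\<lambda>n. c *\<^sub>C s n)"
  unfolding ip_Cauchy_def
proof (intro conjI allI impI)
  note mem [simp] = ip_Cauchy_carrier[OF s]
  show "range (\<lambda>n. c *\<^sub>C s n) \<subseteq> carrier G" by auto
  fix e :: real assume "0 < e"
  then have "0 < e / (cmod c + 1)" by (simp add: add_nonneg_pos)
  then obtain N where N: "\<And>m n. \<lbrakk>N \<le> m; N \<le> n\<rbrakk> \<Longrightarrow> ip_norm G (s m - s n) < e / (cmod c + 1)"
    using s unfolding ip_Cauchy_def by meson
  have "ip_norm G (c *\<^sub>C s m - c *\<^sub>C s n) < e" if "N \<le> m" "N \<le> n" for m n
  proof -
    have "ip_norm G (c *\<^sub>C s m - c *\<^sub>C s n) = cmod c * ip_norm G (s m - s n)"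
      using norm_scale[of "s m - s n" c] by (simp add: complex_vector.scale_right_diff_distrib)
    also have "\<dots> \<le> (cmod c + 1) * ip_norm G (s m - s n)"
      by (intro mult_right_mono) simp_all
    also have "\<dots> < e"
      using N[OF that] by (simp add: pos_less_divide_eq add_nonneg_pos mult.commute)
    finally show ?thesis .
  qed
  then show "\<exists>N. \<forall>m\<ge>N. \<forall>n\<ge>N. ip_norm G (c *\<^sub>C s m - c *\<^sub>C s n) < e" by blast
qed

lemma form_Cauchy_convergent:
  assumes s: "ip_Cauchy G s" and t: "ip_Cauchy G t"
  shows "convergent (\<lambda>n. form G (s n) (t n))"
proof -
  note mem [simp] = ip_Cauchy_carrier[OF s] ip_Cauchy_carrier[OF t]
  obtain C where C: "0 < C" "\<And>n. ip_norm G (s n) \<le> C" using norm_Cauchy_bounded[OF s] by blast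
  obtain D where D: "0 < D" "\<And>n. ip_norm G (t n) \<le> D" using norm_Cauchy_bounded[OF t] by blast
  have "Cauchy (\<lambda>n. form G (s n) (t n))"
  proof (rule CauchyI)
    fix e :: real assume "0 < e"
    then have "0 < e / 2 / D" "0 < e / 2 / C" using C D by simp_all
    then obtain N M where N: "\<And>m n. \<lbrakk>N \<le> m; N \<le> n\<rbrakk> \<Longrightarrow> ip_norm G (s m - s n) < e / 2 / D"
      and M: "\<And>m n. \<lbrakk>M \<le> m; M \<le> n\<rbrakk> \<Longrightarrow> ip_norm G (t m - t n) < e / 2 / C"
      using s t unfolding ip_Cauchy_def by meson
    have "norm (form G (s m) (t m) - form G (s n) (t n)) < e" if "max N M \<le> m" "max N M \<le> n" for m n
    proof -
      have "form G (s m) (t m) - form G (s n) (t n) = form G (s m - s n) (t m) + form G (s n) (t m - t n)"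
        by (simp add: form_simps)
      then have "norm (form G (s m) (t m) - form G (s n) (t n)) \<le>
          ip_norm G (s m - s n) * ip_norm G (t m) + ip_norm G (s n) * ip_norm G (t m - t n)"
        using Cauchy_Schwarz[of "s m - s n" "t m"] Cauchy_Schwarz[of "s n" "t m - t n"]
        by (metis add_mono diff_mem mem norm_triangle_le)
      also have "\<dots> \<le> ip_norm G (s m - s n) * D + C * ip_norm G (t m - t n)"
        using C D by (intro add_mono mult_left_mono mult_right_mono) simp_all
      also have "ip_norm G (s m - s n) * D < e / 2"
        using N[of m n] D that by (simp add: pos_less_divide_eq)
      also have "C * ip_norm G (t m - t n) < e / 2"
        using M[of m n] C that by (simp add: pos_less_divide_eq mult.commute)
      finally show ?thesis by simp
    qed
    then show "\<exists>M. \<forall>m\<ge>M. \<forall>n\<ge>M. norm (form G (s m) (t m) - form G (s n) (t n)) < e" by blast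
  qed
  then show ?thesis by (simp add: Cauchy_convergent_iff)
qed

text \<open>Changing a Cauchy sequence by a null sequence does not affect the limit of the forms;
  together with \<open>form_Cauchy_convergent\<close> this makes the form of the completion well
  defined.\<close>

lemma form_null:
  assumes s: "\<And>n. s n \<in> carrier G" "(\<lambda>n. ip_norm G (s n)) \<longlonglongrightarrow> 0" and t: "ip_Cauchy G t"
  shows "(\<lambda>n. form G (s n) (t n)) \<longlonglongrightarrow> 0"
proof -
  note mem [simp] = ip_Cauchy_carrier[OF t]
  obtain D where D: "0 < D" "\<And>n. ip_norm G (t n) \<le> D" using norm_Cauchy_bounded[OF t] by blast
  show ?thesis
  proof (rule Lim_null_comparison)
    have "norm (form G (s n) (t n)) \<le> ip_norm G (s n) * D" for n
      using Cauchy_Schwarz[of "s n" "t n"] s D mult_left_mono[of "ip_norm G (t n)" D "ip_norm G (s n)"]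
      by (meson mem norm_ge_0 order_trans)
    then show "\<forall>\<^sub>F n in sequentially. norm (form G (s n) (t n)) \<le> ip_norm G (s n) * D"
      by (rule always_eventually[OF allI])
    show "(\<lambda>n. ip_norm G (s n) * D) \<longlonglongrightarrow> 0"
      by (rule tendsto_mult_left_zero[OF s(2)])
  qed
qed

text \<open>One entry of \<open>[s n, s n]\<close> is split at a fixed \<open>s N\<close>: the part
  with \<open>s n - s N\<close> is small by the Cauchy property, the part with \<open>s N\<close> by
  weak convergence. Hence a weak limit determines a Cauchy sequence up to a null sequence, which
  allows weak limits to serve as the elements of the completion.\<close>

lemma weakly_null_Cauchy:
  assumes s: "ip_Cauchy G s" and weak: "\<And>y. y \<in> carrier G \<Longrightarrow> (\<lambda>n. form G (s n) y) \<longlonglongrightarrow> 0"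
  shows "(\<lambda>n. ip_norm G (s n)) \<longlonglongrightarrow> 0"
proof -
  note mem [simp] = ip_Cauchy_carrier[OF s]
  obtain C where C: "0 < C" "\<And>n. ip_norm G (s n) \<le> C" using norm_Cauchy_bounded[OF s] by blast
  have "(\<lambda>n. (ip_norm G (s n))\<^sup>2) \<longlonglongrightarrow> 0"
  proof (rule tendstoI)
    fix e :: real assume e: "0 < e"
    then have "0 < e / 2 / C" using C by simp
    then obtain N where N: "\<And>m n. \<lbrakk>N \<le> m; N \<le> n\<rbrakk> \<Longrightarrow> ip_norm G (s m - s n) < e / 2 / C"
      using s unfolding ip_Cauchy_def by meson
    have "\<forall>\<^sub>F n in sequentially. dist (form G (s n) (s N)) 0 < e / 2"
      using weak[OF mem, of N] e by (intro tendstoD) simp_all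
    then show "\<forall>\<^sub>F n in sequentially. dist ((ip_norm G (s n))\<^sup>2) 0 < e"
      using eventually_ge_at_top[of N]
    proof eventually_elim
      case (elim n)
      have "form G (s n) (s n) = form G (s n) (s n - s N) + form G (s n) (s N)"
        by (simp add: form_simps)
      then have "cmod (form G (s n) (s n)) \<le> cmod (form G (s n) (s n - s N)) + cmod (form G (s n) (s N))"
        by (metis norm_triangle_ineq)
      also have "cmod (form G (s n) (s n - s N)) \<le> C * ip_norm G (s n - s N)"
        using Cauchy_Schwarz[of "s n" "s n - s N"] mult_right_mono[OF C(2)[of n], of "ip_norm G (s n - s N)"]
        by (meson diff_mem mem norm_ge_0 order_trans)
      also have "C * ip_norm G (s n - s N) < e / 2"
        using N[of n N] C elim by (simp add: pos_less_divide_eq mult.commute)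
      finally have "cmod (form G (s n) (s n)) < e"
        using elim by simp
      moreover have "cmod (form G (s n) (s n)) = (ip_norm G (s n))\<^sup>2"
        by (metis mem norm_power2_complex norm_of_real abs_of_nonneg zero_le_power2)
      ultimately show ?case by simp
    qed
  qed
  then have "(\<lambda>n. sqrt ((ip_norm G (s n))\<^sup>2)) \<longlonglongrightarrow> sqrt 0" by (rule tendsto_real_sqrt)
  then show ?thesis by simp
qed

end

text \<open>The completion of the quotient of \<open>P\<close> by its null vectors is realized in \<open>E\<close>, with \<open>T\<close> as the
  embedding: \<open>pairing e y\<close> is the inner product of \<open>e\<close> with \<open>T y\<close>, and the elements of the
  completion are the weak limits in \<open>E\<close> of the Cauchy sequences of \<open>P\<close>.\<close>

locale completion = psd_ips P for P :: "'p::complex_vector inner_space" +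
  fixes E :: "'e::complex_vector set" and T :: "'p \<Rightarrow> 'e" and pairing :: "'e \<Rightarrow> 'p \<Rightarrow> complex"
  assumes subspace_E: "complex_vector.subspace E"
    and T_mem: "x \<in> carrier P \<Longrightarrow> T x \<in> E"
    and pairing_add: "\<lbrakk>e \<in> E; d \<in> E; y \<in> carrier P\<rbrakk> \<Longrightarrow> pairing (e + d) y = pairing e y + pairing d y"
    and pairing_scale: "\<lbrakk>e \<in> E; y \<in> carrier P\<rbrakk> \<Longrightarrow> pairing (c *\<^sub>C e) y = c * pairing e y"
    and pairing_T: "\<lbrakk>x \<in> carrier P; y \<in> carrier P\<rbrakk> \<Longrightarrow> pairing (T x) y = form P x y"
    and separating: "\<lbrakk>e \<in> E; \<And>y. y \<in> carrier P \<Longrightarrow> pairing e y = 0\<rbrakk> \<Longrightarrow> e = 0"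
    and weak_limit: "ip_Cauchy P s \<Longrightarrow> \<exists>e\<in>E. \<forall>y\<in>carrier P. (\<lambda>n. form P (s n) y) \<longlonglongrightarrow> pairing e y"
begin

definition represents :: "(nat \<Rightarrow> 'p) \<Rightarrow> 'e \<Rightarrow> bool" where
  "represents s e \<longleftrightarrow> ip_Cauchy P s \<and> e \<in> E \<and> (\<forall>y\<in>carrier P. (\<lambda>n. form P (s n) y) \<longlonglongrightarrow> pairing e y)"

definition representative :: "'e \<Rightarrow> nat \<Rightarrow> 'p" where
  "representative e = (SOME s. represents s e)"

text \<open>One representing sequence per element is fixed only to write down the form;
  \<open>form_compl_limit\<close> removes the choice.\<close>

definition compl :: "'e inner_space" where
  "compl = \<lparr>carrier = {e. \<exists>s. represents s e},
     form = \<lambda>e d. lim (\<lambda>n. form P (representative e n) (representative d n))\<rparr>"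

lemma represents_mem: "represents s e \<Longrightarrow> s n \<in> carrier P"
  by (auto simp: represents_def intro: ip_Cauchy_carrier)

lemma complI: "represents s e \<Longrightarrow> e \<in> carrier compl"
  by (auto simp: compl_def)

lemma represents_representative: "e \<in> carrier compl \<Longrightarrow> represents (representative e) e"
  using someI_ex[of "\<lambda>s. represents s e"] by (simp add: compl_def representative_def)

lemma represents_add:
  assumes s: "represents s e" and t: "represents t d"
  shows "represents (\<lambda>n. s n + t n) (e + d)"
  unfolding represents_def
proof (intro conjI ballI)
  show "ip_Cauchy P (\<lambda>n. s n + t n)" "e + d \<in> E"
    using s t complex_vector.subspace_add[OF subspace_E] by (auto simp: represents_def ip_Cauchy_add)
  show "(\<lambda>n. form P (s n + t n) y) \<longlonglongrightarrow> pairing (e + d) y" if "y \<in> carrier P" for y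
  proof -
    have "(\<lambda>n. form P (s n) y + form P (t n) y) \<longlonglongrightarrow> pairing e y + pairing d y"
      using s t that by (intro tendsto_add) (simp_all add: represents_def)
    then show ?thesis
      using s t that by (simp add: represents_def ip_Cauchy_carrier form_add_left pairing_add)
  qed
qed

lemma represents_scale:
  assumes s: "represents s e"
  shows "represents (\<lambda>n. c *\<^sub>C s n) (c *\<^sub>C e)"
  unfolding represents_def
proof (intro conjI ballI)
  show "ip_Cauchy P (\<lambda>n. c *\<^sub>C s n)" "c *\<^sub>C e \<in> E"
    using s complex_vector.subspace_scale[OF subspace_E] by (auto simp: represents_def ip_Cauchy_scale)
  show "(\<lambda>n. form P (c *\<^sub>C s n) y) \<longlonglongrightarrow> pairing (c *\<^sub>C e) y" if "y \<in> carrier P" for y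
  proof -
    have "(\<lambda>n. c * form P (s n) y) \<longlonglongrightarrow> c * pairing e y"
      using s that by (intro tendsto_mult_left) (simp add: represents_def)
    then show ?thesis
      using s that by (simp add: represents_def ip_Cauchy_carrier form_scale_left pairing_scale)
  qed
qed

lemma represents_diff:
  assumes "represents s e" "represents t d"
  shows "represents (\<lambda>n. s n - t n) (e - d)"
  using represents_add[OF assms(1) represents_scale[OF assms(2), of "-1"]] by simp

lemma represents_T: "x \<in> carrier P \<Longrightarrow> represents (\<lambda>_. x) (T x)"
  by (simp add: represents_def ip_Cauchy_const T_mem pairing_T)

lemma represents_zero: "represents s 0 \<Longrightarrow> (\<lambda>n. ip_norm P (s n)) \<longlonglongrightarrow> 0"
  using pairing_scale[of 0 _ 0] complex_vector.subspace_0[OF subspace_E]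
  by (intro weakly_null_Cauchy) (auto simp: represents_def)

text \<open>A representing sequence differs from the chosen one by a sequence that represents 0 and
  is therefore null in norm. The form is telescoped through \<open>[s, t - t']\<close>,
  \<open>[s - s', t']\<close> and \<open>[s', t']\<close>.\<close>

lemma form_compl_limit:
  assumes s: "represents s e" and t: "represents t d"
  shows "(\<lambda>n. form P (s n) (t n)) \<longlonglongrightarrow> form compl e d"
proof -
  define s' where "s' = representative e"
  define t' where "t' = representative d"
  have s': "represents s' e" and t': "represents t' d"
    using s t by (auto simp: s'_def t'_def intro: complI represents_representative)
  have Cauchy: "ip_Cauchy P s" "ip_Cauchy P t'" "ip_Cauchy P s'"
    using s t' s' by (auto simp: represents_def)
  note mem [simp] = represents_mem[OF s] represents_mem[OF t] represents_mem[OF s'] represents_mem[OF t']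
  have "(\<lambda>n. form P (s' n) (t' n)) \<longlonglongrightarrow> form compl e d"
    using form_Cauchy_convergent[OF Cauchy(3,2)] by (simp add: compl_def s'_def t'_def convergent_LIMSEQ_iff)
  moreover have "(\<lambda>n. form P (s n - s' n) (t' n)) \<longlonglongrightarrow> 0"
    using represents_zero[of "\<lambda>n. s n - s' n"] represents_diff[OF s s'] Cauchy(2) by (intro form_null) simp_all
  moreover have "(\<lambda>n. cnj (form P (t n - t' n) (s n))) \<longlonglongrightarrow> cnj 0"
    using represents_zero[of "\<lambda>n. t n - t' n"] represents_diff[OF t t'] Cauchy(1)
    by (intro tendsto_cnj form_null) simp_all
  then have "(\<lambda>n. form P (s n) (t n - t' n)) \<longlonglongrightarrow> 0"
    by (simp flip: form_commute)
  ultimately have "(\<lambda>n. form P (s n) (t n - t' n) + form P (s n - s' n) (t' n) + form P (s' n) (t' n))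
      \<longlonglongrightarrow> 0 + 0 + form compl e d"
    by (intro tendsto_add)
  then show ?thesis by (simp add: form_simps)
qed

lemma compl_carrier_subset: "carrier compl \<subseteq> E"
  by (auto simp: compl_def represents_def)

lemma T_mem_compl: "x \<in> carrier P \<Longrightarrow> T x \<in> carrier compl"
  by (rule complI[OF represents_T])

lemma form_compl_T:
  assumes "e \<in> carrier compl" "y \<in> carrier P"
  shows "form compl e (T y) = pairing e y"
proof (rule LIMSEQ_unique)
  show "(\<lambda>n. form P (representative e n) y) \<longlonglongrightarrow> form compl e (T y)"
    by (rule form_compl_limit[OF represents_representative[OF assms(1)] represents_T[OF assms(2)]])
  show "(\<lambda>n. form P (representative e n) y) \<longlonglongrightarrow> pairing e y"
    using represents_representative[OF assms(1)] assms(2) by (simp add: represents_def)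
qed

lemma psd_compl: "psd_ips compl"
proof
  note rep = represents_representative
  show "inner_product_space compl"
    unfolding inner_product_space_def
  proof (intro conjI ballI allI)
    show "complex_vector.subspace (carrier compl)"
      using represents_T[of 0] separating[of "T 0"] T_mem[of 0] pairing_T[of 0]
      by (intro complex_vector.subspaceI)
        (auto simp: compl_def intro: represents_add represents_scale)
  next
    fix x y z assume *: "x \<in> carrier compl" "y \<in> carrier compl" "z \<in> carrier compl"
    note mem [simp] = represents_mem[OF rep[OF *(1)]] represents_mem[OF rep[OF *(2)]] represents_mem[OF rep[OF *(3)]]
    show "form compl (x + y) z = form compl x z + form compl y z"
    proof (rule LIMSEQ_unique)
      show "(\<lambda>n. form P (representative x n + representative y n) (representative z n)) \<longlonglongrightarrow> form compl (x + y) z"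
        by (rule form_compl_limit[OF represents_add[OF rep[OF *(1)] rep[OF *(2)]] rep[OF *(3)]])
      show "(\<lambda>n. form P (representative x n + representative y n) (representative z n)) \<longlonglongrightarrow> form compl x z + form compl y z"
        using tendsto_add[OF form_compl_limit[OF rep[OF *(1)] rep[OF *(3)]] form_compl_limit[OF rep[OF *(2)] rep[OF *(3)]]]
        by (simp add: form_add_left)
    qed
  next
    fix c x y assume *: "x \<in> carrier compl" "y \<in> carrier compl"
    note mem [simp] = represents_mem[OF rep[OF *(1)]] represents_mem[OF rep[OF *(2)]]
    show "form compl (c *\<^sub>C x) y = c * form compl x y"
    proof (rule LIMSEQ_unique)
      show "(\<lambda>n. form P (c *\<^sub>C representative x n) (representative y n)) \<longlonglongrightarrow> form compl (c *\<^sub>C x) y"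
        by (rule form_compl_limit[OF represents_scale[OF rep[OF *(1)]] rep[OF *(2)]])
      show "(\<lambda>n. form P (c *\<^sub>C representative x n) (representative y n)) \<longlonglongrightarrow> c * form compl x y"
        using tendsto_mult_left[OF form_compl_limit[OF rep[OF *(1)] rep[OF *(2)]], of c]
        by (simp add: form_scale_left)
    qed
  next
    fix x y assume *: "x \<in> carrier compl" "y \<in> carrier compl"
    note mem [simp] = represents_mem[OF rep[OF *(1)]] represents_mem[OF rep[OF *(2)]]
    show "form compl y x = cnj (form compl x y)"
    proof (rule LIMSEQ_unique)
      show "(\<lambda>n. form P (representative y n) (representative x n)) \<longlonglongrightarrow> form compl y x"
        by (rule form_compl_limit[OF rep[OF *(2)] rep[OF *(1)]])
      show "(\<lambda>n. form P (representative y n) (representative x n)) \<longlonglongrightarrow> cnj (form compl x y)"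
        using tendsto_cnj[OF form_compl_limit[OF rep[OF *(1)] rep[OF *(2)]]]
        by (simp flip: form_commute)
    qed
  qed
  show "0 \<le> Re (form compl x x)" if *: "x \<in> carrier compl" for x
  proof (rule LIMSEQ_le_const)
    show "(\<lambda>n. Re (form P (representative x n) (representative x n))) \<longlonglongrightarrow> Re (form compl x x)"
      by (intro tendsto_Re form_compl_limit rep *)
    show "\<exists>N. \<forall>n\<ge>N. 0 \<le> Re (form P (representative x n) (representative x n))"
      using represents_mem[OF rep[OF *]] form_nonneg by blast
  qed
qed

lemma norm_compl_limit:
  assumes "represents s e"
  shows "(\<lambda>n. ip_norm P (s n)) \<longlonglongrightarrow> ip_norm compl e"
  unfolding ip_norm_def by (intro tendsto_real_sqrt tendsto_Re form_compl_limit assms)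

lemma norm_compl_T:
  assumes "x \<in> carrier P" "y \<in> carrier P"
  shows "ip_norm compl (T x - T y) = ip_norm P (x - y)"
proof (rule LIMSEQ_unique)
  show "(\<lambda>n::nat. ip_norm P (x - y)) \<longlonglongrightarrow> ip_norm compl (T x - T y)"
    by (intro norm_compl_limit represents_diff represents_T assms)
qed simp

text \<open>For fixed m the sequence \<open>s m - s n\<close> represents \<open>T (s m) - e\<close>,
  so the norm of this vector is a limit of distances within the Cauchy sequence. In particular the
  image of \<open>T\<close> is dense.\<close>

lemma T_tendsto_compl:
  assumes s: "represents s e"
  shows "(\<lambda>n. ip_norm compl (T (s n) - e)) \<longlonglongrightarrow> 0"
proof (rule tendstoI)
  interpret compl: psd_ips compl by (rule psd_compl)
  note mem [simp] = represents_mem[OF s]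
  have Te: "T (s n) - e \<in> carrier compl" for n
    by (rule compl.diff_mem[OF T_mem_compl[OF mem] complI[OF s]])
  fix r :: real assume "0 < r"
  then have "0 < r / 2" by simp
  then obtain N where N: "\<And>m n. \<lbrakk>N \<le> m; N \<le> n\<rbrakk> \<Longrightarrow> ip_norm P (s m - s n) < r / 2"
    using s unfolding represents_def ip_Cauchy_def by meson
  have "ip_norm compl (T (s m) - e) < r" if "N \<le> m" for m
  proof -
    have "(\<lambda>n. ip_norm P (s m - s n)) \<longlonglongrightarrow> ip_norm compl (T (s m) - e)"
      by (intro norm_compl_limit represents_diff represents_T s) simp
    then have "ip_norm compl (T (s m) - e) \<le> r / 2"
      using N[OF that] by (intro LIMSEQ_le_const2) (auto intro: less_imp_le)
    then show ?thesis using \<open>0 < r\<close> by simp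
  qed
  then show "\<forall>\<^sub>F n in sequentially. dist (ip_norm compl (T (s n) - e)) 0 < r"
    using compl.norm_ge_0[OF Te] by (auto simp: eventually_sequentially)
qed

text \<open>Definite, because a null vector pairs to 0 with every \<open>T y\<close> and the pairing
  separates. Complete, because \<open>d k\<close> can be replaced by a nearby
  \<open>T (x k)\<close>: the preimages \<open>x k\<close> are Cauchy, as \<open>T\<close> preserves
  distances, and their weak limit is the limit of d.\<close>

lemma hilbert_compl: "hilbert compl"
proof -
  interpret compl: psd_ips compl by (rule psd_compl)
  interpret compl: posdef_ips compl
  proof
    fix e assume e: "e \<in> carrier compl" "e \<noteq> 0"
    show "0 < Re (form compl e e)"
    proof (rule ccontr)
      assume "\<not> ?thesis"
      then have "ip_norm compl e = 0"
        using compl.form_nonneg[OF e(1)] by (simp add: ip_norm_def)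
      then have "form compl e (T y) = 0" if "y \<in> carrier P" for y
        using compl.Cauchy_Schwarz[OF e(1) T_mem_compl[OF that]] by simp
      then have "e = 0"
        using e(1) compl_carrier_subset by (intro separating) (auto simp: form_compl_T)
      then show False using e by simp
    qed
  qed
  show ?thesis
  proof (rule compl.hilbertI)
    fix d assume d: "ip_Cauchy compl d"
    note dmem [simp] = ip_Cauchy_carrier[OF d]
    have "\<exists>x\<in>carrier P. ip_norm compl (T x - d k) < inverse (real (Suc k))" for k
    proof -
      have "\<forall>\<^sub>F n in sequentially. ip_norm compl (T (representative (d k) n) - d k) < inverse (real (Suc k))"
        by (intro order_tendstoD(2)[OF T_tendsto_compl] represents_representative) simp_all
      then show ?thesis
        using eventually_happens'[OF sequentially_bot] represents_mem[OF represents_representative[OF dmem]] by blast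
    qed
    then obtain x where x [simp]: "\<And>k. x k \<in> carrier P"
      and xd: "\<And>k. ip_norm compl (T (x k) - d k) < inverse (real (Suc k))"
      by metis
    have Td: "T (x k) - d k \<in> carrier compl" for k
      by (rule compl.diff_mem[OF T_mem_compl[OF x] dmem])
    have xd0: "(\<lambda>k. ip_norm compl (T (x k) - d k)) \<longlonglongrightarrow> 0"
    proof (rule Lim_null_comparison[OF _ LIMSEQ_inverse_real_of_nat])
      show "\<forall>\<^sub>F n in sequentially. norm (ip_norm compl (T (x n) - d n)) \<le> inverse (real (Suc n))"
        using less_imp_le[OF xd] compl.norm_ge_0[OF Td]
        by (intro always_eventually allI) (simp only: real_norm_def abs_of_nonneg)
    qed
    have "ip_Cauchy P x"
      unfolding ip_Cauchy_def
    proof (intro conjI allI impI)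
      show "range x \<subseteq> carrier P" by auto
      fix r :: real assume "0 < r"
      then have r: "0 < r / 3" by simp
      obtain N where N: "\<And>m n. \<lbrakk>N \<le> m; N \<le> n\<rbrakk> \<Longrightarrow> ip_norm compl (d m - d n) < r / 3"
        using d r unfolding ip_Cauchy_def by meson
      obtain M where M: "\<And>n. M \<le> n \<Longrightarrow> ip_norm compl (T (x n) - d n) < r / 3"
        using order_tendstoD(2)[OF xd0 r] by (auto simp: eventually_sequentially)
      have "ip_norm P (x m - x n) < r" if "max N M \<le> m" "max N M \<le> n" for m n
      proof -
        have "ip_norm P (x m - x n) = ip_norm compl (T (x m) - T (x n))" by (simp add: norm_compl_T)
        also have "\<dots> \<le> ip_norm compl (T (x m) - d m) + ip_norm compl (d m - T (x n))"
          by (intro compl.norm_triangle_diff) (simp_all add: T_mem_compl)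
        also have "ip_norm compl (d m - T (x n)) \<le> ip_norm compl (d m - d n) + ip_norm compl (d n - T (x n))"
          by (intro compl.norm_triangle_diff) (simp_all add: T_mem_compl)
        also have "ip_norm compl (d n - T (x n)) = ip_norm compl (T (x n) - d n)"
          by (intro compl.norm_diff_commute) (simp_all add: T_mem_compl)
        finally show ?thesis
          using N[of m n] M[of m] M[of n] that by simp
      qed
      then show "\<exists>N. \<forall>m\<ge>N. \<forall>n\<ge>N. ip_norm P (x m - x n) < r" by blast
    qed
    then obtain e where e: "represents x e"
      using weak_limit by (auto simp: represents_def)
    have "(\<lambda>k. ip_norm compl (d k - e)) \<longlonglongrightarrow> 0"
    proof (rule Lim_null_comparison)
      have "ip_norm compl (d k - e) \<le> ip_norm compl (T (x k) - d k) + ip_norm compl (T (x k) - e)" for k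
        using compl.norm_triangle_diff[of "d k" "T (x k)" e] compl.norm_diff_commute[of "d k" "T (x k)"]
        by (simp add: T_mem_compl complI[OF e])
      then show "\<forall>\<^sub>F k in sequentially. norm (ip_norm compl (d k - e)) \<le>
          ip_norm compl (T (x k) - d k) + ip_norm compl (T (x k) - e)"
        by (simp add: complI[OF e])
      show "(\<lambda>k. ip_norm compl (T (x k) - d k) + ip_norm compl (T (x k) - e)) \<longlonglongrightarrow> 0"
        using tendsto_add[OF xd0 T_tendsto_compl[OF e]] by simp
    qed
    then show "\<exists>e\<in>carrier compl. (\<lambda>n. ip_norm compl (d n - e)) \<longlonglongrightarrow> 0"
      using complI[OF e] by blast
  qed
qed

end

section \<open>Finitely supported functions and kernels\<close>

text \<open>The linear map from finitely supported functions that sends h placed at x to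
  \<open>V x h\<close>; its range is the span in the density condition. The support as index set
  depends on f, which \<open>synthesis_superset\<close> repairs.\<close>

definition synthesis :: "('x \<Rightarrow> 'h::zero \<Rightarrow> 'k::comm_monoid_add) \<Rightarrow> ('x \<Rightarrow> 'h) \<Rightarrow> 'k" where
  "synthesis V f = (\<Sum>y\<in>{y. f y \<noteq> 0}. V y (f y))"

definition single :: "'x \<Rightarrow> 'h::zero \<Rightarrow> 'x \<Rightarrow> 'h" where
  "single x h = (\<lambda>y. if y = x then h else 0)"

text \<open>The kernel sections of a reproducing kernel space: h goes to the function with value
  \<open>K z x h\<close> at z.\<close>

definition kernel_map :: "'x set \<Rightarrow> ('x \<Rightarrow> 'x \<Rightarrow> 'h \<Rightarrow> 'h) \<Rightarrow> 'x \<Rightarrow> 'h \<Rightarrow> 'x \<Rightarrow> 'h::zero" where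
  "kernel_map X K x h = (\<lambda>z. if z \<in> X then K z x h else 0)"

text \<open>Only the second argument needs finite support. This lets arbitrary functions, among them
  limits, be paired with finitely supported ones.\<close>

definition pointwise_pairing ::
  "'h::complex_vector inner_space \<Rightarrow> ('x \<Rightarrow> 'h) \<Rightarrow> ('x \<Rightarrow> 'h) \<Rightarrow> complex" where
  "pointwise_pairing H e g = (\<Sum>x\<in>{x. g x \<noteq> 0}. form H (e x) (g x))"

definition extended_functions :: "'x set \<Rightarrow> 'h::complex_vector inner_space \<Rightarrow> ('x \<Rightarrow> 'h) set" where
  "extended_functions X H = {e. e \<in> X \<rightarrow> carrier H \<and> (\<forall>x. x \<notin> X \<longrightarrow> e x = 0)}"

text \<open>Common to the kernel sections and to the V of a decomposition: the algebra of
  \<open>synthesis\<close> needs no form on the target.\<close>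

locale fiberwise_linear =
  fixes X :: "'x set" and H :: "'h::complex_vector inner_space" and V :: "'x \<Rightarrow> 'h \<Rightarrow> 'k::complex_vector"
  assumes ips_H: "ips H"
    and V_add: "\<lbrakk>x \<in> X; h \<in> carrier H; k \<in> carrier H\<rbrakk> \<Longrightarrow> V x (h + k) = V x h + V x k"
    and V_scale: "\<lbrakk>x \<in> X; h \<in> carrier H\<rbrakk> \<Longrightarrow> V x (c *\<^sub>C h) = c *\<^sub>C V x h"

sublocale fiberwise_linear \<subseteq> H: ips H
  by (rule ips_H)

lemma carrier_finsupp:
  "f \<in> carrier (finsupp_space X H K) \<longleftrightarrow>
    (\<forall>x\<in>X. f x \<in> carrier H) \<and> (\<forall>x. x \<notin> X \<longrightarrow> f x = 0) \<and> finite {x. f x \<noteq> 0}"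
  by (auto simp: finsupp_space_def)

lemma finsupp_mem: "\<lbrakk>f \<in> carrier (finsupp_space X H K); f x \<noteq> 0\<rbrakk> \<Longrightarrow> x \<in> X \<and> f x \<in> carrier H"
  by (auto simp: carrier_finsupp)

lemma (in ips) finsupp_subspace: "complex_vector.subspace (carrier (finsupp_space X G K))"
proof (rule complex_vector.subspaceI)
  show "0 \<in> carrier (finsupp_space X G K)" by (simp add: carrier_finsupp)
  show "f + g \<in> carrier (finsupp_space X G K)"
    if f: "f \<in> carrier (finsupp_space X G K)" and g: "g \<in> carrier (finsupp_space X G K)" for f g
  proof -
    have "{x. (f + g) x \<noteq> 0} \<subseteq> {x. f x \<noteq> 0} \<union> {x. g x \<noteq> 0}" by auto
    moreover have "finite ({x. f x \<noteq> 0} \<union> {x. g x \<noteq> 0})"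
      using f g by (simp add: carrier_finsupp)
    ultimately have "finite {x. (f + g) x \<noteq> 0}" by (rule finite_subset)
    then show ?thesis using f g by (simp add: carrier_finsupp)
  qed
  show "c *\<^sub>C f \<in> carrier (finsupp_space X G K)" if f: "f \<in> carrier (finsupp_space X G K)" for c f
  proof -
    have "{x. (c *\<^sub>C f) x \<noteq> 0} \<subseteq> {x. f x \<noteq> 0}" by (auto simp: scaleC_fun_def)
    moreover have "finite {x. f x \<noteq> 0}" using f by (simp add: carrier_finsupp)
    ultimately have "finite {x. (c *\<^sub>C f) x \<noteq> 0}" by (rule finite_subset)
    then show ?thesis using f by (simp add: carrier_finsupp scaleC_fun_def)
  qed
qed

lemma (in ips) single_mem: "\<lbrakk>x \<in> X; h \<in> carrier G\<rbrakk> \<Longrightarrow> single x h \<in> carrier (finsupp_space X G K)"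
  by (auto simp: carrier_finsupp single_def intro: finite_subset[of _ "{x}"])

lemma (in ips) pairing_single:
  assumes "e x \<in> carrier G"
  shows "pointwise_pairing G e (single x h) = form G (e x) h"
proof (cases "h = 0")
  case False
  then have "{y. single x h y \<noteq> 0} = {x}" by (auto simp: single_def)
  then show ?thesis by (simp add: pointwise_pairing_def single_def)
qed (use assms in \<open>simp add: pointwise_pairing_def single_def\<close>)

context fiberwise_linear
begin

lemma V_zero: "x \<in> X \<Longrightarrow> V x 0 = 0"
  using V_scale[of x 0 0] by simp

lemma synthesis_superset:
  assumes "finite A" "{x. f x \<noteq> 0} \<subseteq> A" "A \<subseteq> X"
  shows "synthesis V f = (\<Sum>y\<in>A. V y (f y))"
  unfolding synthesis_def using assms V_zero by (intro sum.mono_neutral_left) auto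

lemma synthesis_single: "x \<in> X \<Longrightarrow> synthesis V (single x h) = V x h"
  by (subst synthesis_superset[of "{x}"]) (auto simp: single_def)

lemma synthesis_add:
  assumes f: "f \<in> carrier (finsupp_space X H K)" and g: "g \<in> carrier (finsupp_space X H K)"
  shows "synthesis V (f + g) = synthesis V f + synthesis V g"
proof -
  define A where "A = {x. f x \<noteq> 0} \<union> {x. g x \<noteq> 0}"
  have A: "finite A" "A \<subseteq> X" and sub: "{x. f x \<noteq> 0} \<subseteq> A" "{x. g x \<noteq> 0} \<subseteq> A" "{x. (f + g) x \<noteq> 0} \<subseteq> A"
    using f g by (auto simp: A_def carrier_finsupp)
  have "V y ((f + g) y) = V y (f y) + V y (g y)" if "y \<in> A" for y
    using f g A that by (simp add: V_add carrier_finsupp subset_iff)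
  then show ?thesis
    by (simp add: synthesis_superset[OF A(1) sub(1) A(2)] synthesis_superset[OF A(1) sub(2) A(2)]
      synthesis_superset[OF A(1) sub(3) A(2)] sum.distrib)
qed

lemma synthesis_scale:
  assumes f: "f \<in> carrier (finsupp_space X H K)"
  shows "synthesis V (c *\<^sub>C f) = c *\<^sub>C synthesis V f"
proof -
  define A where "A = {x. f x \<noteq> 0}"
  have A: "finite A" "A \<subseteq> X" and sub: "{x. f x \<noteq> 0} \<subseteq> A" "{x. (c *\<^sub>C f) x \<noteq> 0} \<subseteq> A"
    using f by (auto simp: A_def carrier_finsupp scaleC_fun_def)
  have "V y ((c *\<^sub>C f) y) = c *\<^sub>C V y (f y)" if "y \<in> A" for y
    using f A that by (simp add: V_scale carrier_finsupp subset_iff scaleC_fun_def)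
  then show ?thesis
    by (simp add: synthesis_superset[OF A(1) sub(1) A(2)] synthesis_superset[OF A(1) sub(2) A(2)]
      complex_vector.scale_sum_right)
qed

lemma synthesis_diff:
  assumes f: "f \<in> carrier (finsupp_space X H K)" and g: "g \<in> carrier (finsupp_space X H K)"
  shows "synthesis V (f - g) = synthesis V f - synthesis V g"
  using synthesis_add[OF f complex_vector.subspace_scale[OF H.finsupp_subspace g, of "-1"]]
    synthesis_scale[OF g, of "-1"] by simp

lemma synthesis_zero: "synthesis V 0 = 0"
  by (simp add: synthesis_def)

lemma synthesis_sum:
  assumes "\<And>i. i \<in> I \<Longrightarrow> f i \<in> carrier (finsupp_space X H K)"
  shows "synthesis V (\<Sum>i\<in>I. c i *\<^sub>C f i) = (\<Sum>i\<in>I. c i *\<^sub>C synthesis V (f i))"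
  using assms
proof (induction I rule: infinite_finite_induct)
  case (insert i I)
  have "(\<Sum>i\<in>I. c i *\<^sub>C f i) \<in> carrier (finsupp_space X H K)"
    using insert.prems by (intro complex_vector.subspace_sum complex_vector.subspace_scale H.finsupp_subspace) auto
  moreover have "c i *\<^sub>C f i \<in> carrier (finsupp_space X H K)"
    using insert.prems by (intro complex_vector.subspace_scale H.finsupp_subspace) auto
  ultimately have "synthesis V (c i *\<^sub>C f i + (\<Sum>i\<in>I. c i *\<^sub>C f i)) =
      synthesis V (c i *\<^sub>C f i) + synthesis V (\<Sum>i\<in>I. c i *\<^sub>C f i)"
    by (rule synthesis_add[rotated])
  moreover have "synthesis V (c i *\<^sub>C f i) = c i *\<^sub>C synthesis V (f i)"
    using insert.prems by (intro synthesis_scale) auto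
  moreover have "synthesis V (\<Sum>i\<in>I. c i *\<^sub>C f i) = (\<Sum>i\<in>I. c i *\<^sub>C synthesis V (f i))"
    using insert by auto
  ultimately show ?case
    unfolding sum.insert[OF insert.hyps] by (simp only:)
qed (simp_all add: synthesis_zero)

text \<open>A reflection is a linear combination, so it passes to the target with unchanged
  coefficients; in this way the reflection of the functions reappears in the completion.\<close>

lemma synthesis_reflection:
  assumes f: "f \<in> carrier (finsupp_space X H K)" and B: "\<And>b. b \<in> B \<Longrightarrow> b \<in> carrier (finsupp_space X H K)"
  shows "synthesis V (reflection (finsupp_space X H K) s (\<lambda>b. b) B f) =
    synthesis V f - (\<Sum>b\<in>B. (2 * of_real s * form (finsupp_space X H K) f b) *\<^sub>C synthesis V b)"
proof -
  let ?F = "finsupp_space X H K"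
  define g where "g = (\<Sum>b\<in>B. (2 * of_real s * form ?F f b) *\<^sub>C b)"
  have g: "g \<in> carrier ?F"
    unfolding g_def using B by (intro complex_vector.subspace_sum complex_vector.subspace_scale H.finsupp_subspace)
  have "synthesis V (f - g) = synthesis V f - synthesis V g"
    by (rule synthesis_diff[OF f g])
  then show ?thesis
    using synthesis_sum[of B "\<lambda>b. b" K "\<lambda>b. 2 * of_real s * form ?F f b"] B
    by (simp add: reflection_def g_def)
qed

lemma synthesis_range: "synthesis V ` carrier (finsupp_space X H K) = complex_vector.span (\<Union>x\<in>X. V x ` carrier H)"
proof (rule antisym)
  show "synthesis V ` carrier (finsupp_space X H K) \<subseteq> complex_vector.span (\<Union>x\<in>X. V x ` carrier H)"
  proof (rule image_subsetI)
    fix f assume "f \<in> carrier (finsupp_space X H K)"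
    then have "V y (f y) \<in> (\<Union>x\<in>X. V x ` carrier H)" if "f y \<noteq> 0" for y
      using that finsupp_mem[of f X H K y] by blast
    then show "synthesis V f \<in> complex_vector.span (\<Union>x\<in>X. V x ` carrier H)"
      unfolding synthesis_def by (intro complex_vector.span_sum complex_vector.span_base) simp
  qed
  show "complex_vector.span (\<Union>x\<in>X. V x ` carrier H) \<subseteq> synthesis V ` carrier (finsupp_space X H K)"
  proof (rule complex_vector.span_minimal)
    show "(\<Union>x\<in>X. V x ` carrier H) \<subseteq> synthesis V ` carrier (finsupp_space X H K)"
    proof
      fix v assume "v \<in> (\<Union>x\<in>X. V x ` carrier H)"
      then obtain x h where "x \<in> X" "h \<in> carrier H" "v = V x h" by blast
      then show "v \<in> synthesis V ` carrier (finsupp_space X H K)"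
        using H.single_mem synthesis_single by (intro image_eqI[of _ _ "single x h"]) auto
    qed
    show "complex_vector.subspace (synthesis V ` carrier (finsupp_space X H K))"
    proof (rule complex_vector.subspaceI)
      show "0 \<in> synthesis V ` carrier (finsupp_space X H K)"
        using complex_vector.subspace_0[OF H.finsupp_subspace] by (intro image_eqI[of _ _ 0]) (simp_all add: synthesis_zero)
    next
      fix v w assume "v \<in> synthesis V ` carrier (finsupp_space X H K)" "w \<in> synthesis V ` carrier (finsupp_space X H K)"
      then obtain f g where fg: "f \<in> carrier (finsupp_space X H K)" "g \<in> carrier (finsupp_space X H K)"
        "v = synthesis V f" "w = synthesis V g" by blast
      then show "v + w \<in> synthesis V ` carrier (finsupp_space X H K)"
        using complex_vector.subspace_add[OF H.finsupp_subspace fg(1,2)]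
        by (intro image_eqI[of _ _ "f + g"]) (simp_all add: synthesis_add[OF fg(1,2)])
    next
      fix c v assume "v \<in> synthesis V ` carrier (finsupp_space X H K)"
      then obtain f where f: "f \<in> carrier (finsupp_space X H K)" "v = synthesis V f" by blast
      then show "c *\<^sub>C v \<in> synthesis V ` carrier (finsupp_space X H K)"
        using complex_vector.subspace_scale[OF H.finsupp_subspace f(1)]
        by (intro image_eqI[of _ _ "c *\<^sub>C f"]) (simp_all add: synthesis_scale[OF f(1)])
    qed
  qed
qed

end

section \<open>The inner product space of a hermitian kernel\<close>

locale kernel =
  fixes X :: "'x set" and H :: "'h::complex_vector inner_space" and K :: "'x \<Rightarrow> 'x \<Rightarrow> 'h \<Rightarrow> 'h"
  assumes krein: "krein_space H" and hermitian: "hermitian_kernel X H K"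

sublocale kernel \<subseteq> H: ips H
  using krein by (simp add: krein_space_def ips_def)

context kernel
begin

abbreviation F where "F \<equiv> finsupp_space X H K"

lemma kernel_pair:
  assumes "x \<in> X" "y \<in> X"
  shows "adjoint_pair H H (K x y) (K y x)"
proof -
  have "adjoint_pair H H (K x y) (adj H H (K x y))"
    using hermitian assms by (intro bounded_ops_adjoint_pair) (simp add: hermitian_kernel_def)
  moreover have "adj H H (K x y) h = K y x h" if "h \<in> carrier H" for h
    using hermitian assms that by (simp add: hermitian_kernel_def)
  ultimately show ?thesis by (simp add: adjoint_pair_def Pi_iff)
qed

lemma K_mem: "\<lbrakk>x \<in> X; y \<in> X; h \<in> carrier H\<rbrakk> \<Longrightarrow> K x y h \<in> carrier H"
  using kernel_pair[of x y] by (auto simp: adjoint_pair_def)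

lemma K_symmetric:
  "\<lbrakk>x \<in> X; y \<in> X; h \<in> carrier H; k \<in> carrier H\<rbrakk> \<Longrightarrow> form H (K x y h) k = form H h (K y x k)"
  using kernel_pair[of x y] by (auto simp: adjoint_pair_def)

lemma K_linear: "\<lbrakk>x \<in> X; y \<in> X\<rbrakk> \<Longrightarrow> linear_op H H (K x y)"
  by (rule adjoint_pair_linear[OF kernel_pair krein krein])

lemma form_F: "form F f g = (\<Sum>x\<in>{x. g x \<noteq> 0}. \<Sum>y\<in>{y. f y \<noteq> 0}. form H (K x y (f y)) (g x))"
  by (simp add: finsupp_space_def)

lemma fiberwise_linear_kernel_map: "fiberwise_linear X H (kernel_map X K)"
  using K_linear H.ips_axioms
  by unfold_locales (auto simp: kernel_map_def fun_eq_iff scaleC_fun_def linear_op_def ips_def)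

lemma synthesis_kernel_map:
  "synthesis (kernel_map X K) f = (\<lambda>x. if x \<in> X then \<Sum>y\<in>{y. f y \<noteq> 0}. K x y (f y) else 0)"
proof -
  have "(\<Sum>y\<in>A. kernel_map X K y (f y)) x = (\<Sum>y\<in>A. kernel_map X K y (f y) x)" for A x
    by (induction A rule: infinite_finite_induct) simp_all
  then show ?thesis by (auto simp: synthesis_def fun_eq_iff kernel_map_def)
qed

lemma synthesis_kernel_map_mem:
  assumes "f \<in> carrier F"
  shows "synthesis (kernel_map X K) f \<in> extended_functions X H"
  using finsupp_mem[OF assms] by (auto simp: synthesis_kernel_map extended_functions_def intro!: H.sum_mem K_mem)

text \<open>The sum over the support of f hides linearity in f. Factored through the kernel sections
  it becomes visible, and the first argument can be extended to functions of arbitrary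
  support.\<close>

lemma form_F_pairing:
  assumes f: "f \<in> carrier F" and g: "g \<in> carrier F"
  shows "form F f g = pointwise_pairing H (synthesis (kernel_map X K) f) g"
proof -
  have "form H (synthesis (kernel_map X K) f x) (g x) = (\<Sum>y\<in>{y. f y \<noteq> 0}. form H (K x y (f y)) (g x))"
    if "g x \<noteq> 0" for x
  proof -
    have x: "x \<in> X" "g x \<in> carrier H" using finsupp_mem[OF g that] by auto
    have "form H (\<Sum>y\<in>{y. f y \<noteq> 0}. K x y (f y)) (g x) = (\<Sum>y\<in>{y. f y \<noteq> 0}. form H (K x y (f y)) (g x))"
      using finsupp_mem[OF f] x by (intro H.form_sum_left) (auto intro: K_mem)
    then show ?thesis using x by (simp add: synthesis_kernel_map)
  qed
  then show ?thesis by (simp add: form_F pointwise_pairing_def)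
qed

lemma pairing_add:
  assumes "e \<in> extended_functions X H" "d \<in> extended_functions X H" "g \<in> carrier F"
  shows "pointwise_pairing H (e + d) g = pointwise_pairing H e g + pointwise_pairing H d g"
  unfolding pointwise_pairing_def sum.distrib[symmetric]
  using assms finsupp_mem[OF assms(3)] by (intro sum.cong) (auto simp: extended_functions_def intro!: H.form_add_left)

lemma pairing_scale:
  assumes "e \<in> extended_functions X H" "g \<in> carrier F"
  shows "pointwise_pairing H (c *\<^sub>C e) g = c * pointwise_pairing H e g"
  unfolding pointwise_pairing_def sum_distrib_left
  using assms finsupp_mem[OF assms(2)]
  by (intro sum.cong) (auto simp: extended_functions_def scaleC_fun_def intro!: H.form_scale_left)

lemma ips_F: "ips F"
proof
  interpret fiberwise_linear X H "kernel_map X K" by (rule fiberwise_linear_kernel_map)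
  show "inner_product_space F"
    unfolding inner_product_space_def
  proof (intro conjI ballI allI)
    show "complex_vector.subspace (carrier F)" by (rule H.finsupp_subspace)
  next
    fix f g k assume *: "f \<in> carrier F" "g \<in> carrier F" "k \<in> carrier F"
    then have "f + g \<in> carrier F" by (intro complex_vector.subspace_add[OF H.finsupp_subspace])
    then show "form F (f + g) k = form F f k + form F g k"
      using * by (simp add: form_F_pairing synthesis_add[OF *(1,2)] pairing_add synthesis_kernel_map_mem)
  next
    fix c f g assume *: "f \<in> carrier F" "g \<in> carrier F"
    then have "c *\<^sub>C f \<in> carrier F" by (intro complex_vector.subspace_scale[OF H.finsupp_subspace])
    then show "form F (c *\<^sub>C f) g = c * form F f g"
      using * by (simp add: form_F_pairing synthesis_scale[OF *(1)] pairing_scale synthesis_kernel_map_mem)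
  next
    fix f g assume f: "f \<in> carrier F" and g: "g \<in> carrier F"
    have "form H (K x y (g y)) (f x) = cnj (form H (K y x (f x)) (g y))" if "f x \<noteq> 0" "g y \<noteq> 0" for x y
      using that finsupp_mem[OF f] finsupp_mem[OF g] H.form_commute[of "K y x (f x)" "g y"]
      by (simp add: K_mem K_symmetric)
    then have "form F g f = (\<Sum>x\<in>{x. f x \<noteq> 0}. \<Sum>y\<in>{y. g y \<noteq> 0}. cnj (form H (K y x (f x)) (g y)))"
      by (simp add: form_F)
    also have "\<dots> = (\<Sum>y\<in>{y. g y \<noteq> 0}. \<Sum>x\<in>{x. f x \<noteq> 0}. cnj (form H (K y x (f x)) (g y)))"
      by (rule sum.swap)
    also have "\<dots> = cnj (form F f g)" by (simp add: form_F)
    finally show "form F g f = cnj (form F f g)" .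
  qed
qed

text \<open>Functions supported at one point reduce the claim to nondegeneracy of
  \<open>H\<close>.\<close>

lemma pairing_separating:
  assumes e: "e \<in> extended_functions X H" and 0: "\<And>g. g \<in> carrier F \<Longrightarrow> pointwise_pairing H e g = 0"
  shows "e = 0"
proof
  obtain G J where "fundamental_symmetry H G J" using krein krein_space_iff by blast
  then interpret S: fundamental_symmetry H G J .
  fix x
  show "e x = 0 x"
  proof (cases "x \<in> X")
    case True
    then have ex: "e x \<in> carrier H" using e by (auto simp: extended_functions_def)
    have "form H h (e x) = 0" if "h \<in> carrier H" for h
      using 0[OF H.single_mem[OF True that]] H.pairing_single[of e x h] ex H.form_commute[OF ex that] by simp
    then have "e x = 0" using ex by (intro S.nondegenerate)
    then show ?thesis by simp
  qed (use e in \<open>simp add: extended_functions_def\<close>)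
qed

end

section \<open>Kolmogorov decompositions\<close>

locale decomposition = kernel X H K
  for X :: "'x set" and H :: "'h::complex_vector inner_space" and K :: "'x \<Rightarrow> 'x \<Rightarrow> 'h \<Rightarrow> 'h" +
  fixes V :: "'x \<Rightarrow> 'h \<Rightarrow> 'k::complex_vector" and L :: "'k inner_space"
  assumes krein_L: "krein_space L"
    and V_pair: "x \<in> X \<Longrightarrow> \<exists>W. adjoint_pair H L (V x) W"
    and gram: "\<lbrakk>x \<in> X; y \<in> X; h \<in> carrier H; k \<in> carrier H\<rbrakk> \<Longrightarrow> form L (V y h) (V x k) = form H (K x y h) k"
    and total: "\<lbrakk>z \<in> carrier L; \<And>x h. \<lbrakk>x \<in> X; h \<in> carrier H\<rbrakk> \<Longrightarrow> form L (V x h) z = 0\<rbrakk> \<Longrightarrow> z = 0"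

sublocale decomposition \<subseteq> L: ips L
  using krein_L by (simp add: krein_space_def ips_def)

lemma (in decomposition) V_mem: "\<lbrakk>x \<in> X; h \<in> carrier H\<rbrakk> \<Longrightarrow> V x h \<in> carrier L"
  using V_pair[of x] by (auto simp: adjoint_pair_def)

sublocale decomposition \<subseteq> fiberwise_linear X H V
proof
  have "linear_op H L (V x)" if "x \<in> X" for x
    using V_pair[OF that] adjoint_pair_linear[OF _ krein krein_L] by blast
  then show "\<And>x h k. \<lbrakk>x \<in> X; h \<in> carrier H; k \<in> carrier H\<rbrakk> \<Longrightarrow> V x (h + k) = V x h + V x k"
    and "\<And>x h c. \<lbrakk>x \<in> X; h \<in> carrier H\<rbrakk> \<Longrightarrow> V x (c *\<^sub>C h) = c *\<^sub>C V x h"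
    by (auto simp: linear_op_def)
qed

context kernel
begin

text \<open>Orthogonality to all \<open>V x h\<close> is orthogonality to their span, which
  \<open>dense_in_iff\<close> links with density; the kernel identity for operators is recovered
  from that for forms by nondegeneracy of \<open>H\<close>.\<close>

lemma kolmogorov_decomposition_iff:
  fixes L :: "'k::complex_vector inner_space"
  shows "kolmogorov_decomposition X H K V L \<longleftrightarrow> decomposition X H K V L"
proof
  assume *: "kolmogorov_decomposition X H K V L"
  then have krein_L: "krein_space L" by (simp add: kolmogorov_decomposition_def)
  interpret L: ips L using krein_L by (simp add: krein_space_def ips_def)
  have pair: "adjoint_pair H L (V x) (adj H L (V x))" if "x \<in> X" for x
    using * that by (intro bounded_ops_adjoint_pair) (simp add: kolmogorov_decomposition_def)
  have V_mem: "V x h \<in> carrier L" if "x \<in> X" "h \<in> carrier H" for x h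
    using pair[OF that(1)] that(2) by (auto simp: adjoint_pair_def)
  have dense: "dense_in L (complex_vector.span (\<Union>x\<in>X. V x ` carrier H))"
    using * by (simp add: kolmogorov_decomposition_def)
  have sub: "complex_vector.span (\<Union>x\<in>X. V x ` carrier H) \<subseteq> carrier L"
    using V_mem by (intro complex_vector.span_minimal L.subspace_carrier) auto
  show "decomposition X H K V L"
  proof
    show "krein_space L" by fact
    show "\<exists>W. adjoint_pair H L (V x) W" if "x \<in> X" for x using pair[OF that] by blast
    show "form L (V y h) (V x k) = form H (K x y h) k"
      if "x \<in> X" "y \<in> X" "h \<in> carrier H" "k \<in> carrier H" for x y h k
    proof -
      have "K x y h = adj H L (V x) (V y h)"
        using * that by (simp add: kolmogorov_decomposition_def)
      then have "form L (V x k) (V y h) = form H k (K x y h)"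
        using pair[OF that(1)] V_mem[OF that(2,3)] that(4) by (simp add: adjoint_pair_def)
      then show ?thesis
        using that L.form_commute[of "V x k" "V y h"] H.form_commute[of k "K x y h"] by (simp add: V_mem K_mem)
    qed
    show "z = 0" if z: "z \<in> carrier L" and 0: "\<And>x h. \<lbrakk>x \<in> X; h \<in> carrier H\<rbrakk> \<Longrightarrow> form L (V x h) z = 0" for z
    proof -
      have "complex_vector.subspace {a \<in> carrier L. form L a z = 0}"
        using z by (intro complex_vector.subspaceI) (auto simp: L.form_add_left L.form_scale_left)
      moreover have "(\<Union>x\<in>X. V x ` carrier H) \<subseteq> {a \<in> carrier L. form L a z = 0}"
        using 0 V_mem by auto
      ultimately have "complex_vector.span (\<Union>x\<in>X. V x ` carrier H) \<subseteq> {a \<in> carrier L. form L a z = 0}"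
        by (intro complex_vector.span_minimal)
      then have "\<forall>a\<in>complex_vector.span (\<Union>x\<in>X. V x ` carrier H). form L a z = 0" by blast
      then show ?thesis
        using z dense unfolding dense_in_iff[OF krein_L complex_vector.subspace_span sub] by blast
    qed
  qed
next
  assume "decomposition X H K V L"
  then interpret decomposition X H K V L .
  obtain W where W: "\<And>x. x \<in> X \<Longrightarrow> adjoint_pair H L (V x) (W x)" using V_pair by metis
  obtain G J where "fundamental_symmetry H G J" using krein krein_space_iff by blast
  then interpret S: fundamental_symmetry H G J .
  have sub: "complex_vector.span (\<Union>x\<in>X. V x ` carrier H) \<subseteq> carrier L"
    using V_mem by (intro complex_vector.span_minimal L.subspace_carrier) auto
  show "kolmogorov_decomposition X H K V L"
    unfolding kolmogorov_decomposition_def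
  proof (intro conjI ballI)
    show "krein_space L" by (rule krein_L)
    show "V x \<in> bounded_ops H L" if "x \<in> X" for x
      using W[OF that] by (rule adjoint_pair_bounded_ops[OF _ krein krein_L])
    show "K x y h = adj H L (V x) (V y h)" if "x \<in> X" "y \<in> X" "h \<in> carrier H" for x y h
      unfolding adj_eq[OF W[OF that(1)] krein V_mem[OF that(2,3)]]
    proof (rule S.eqI)
      show "K x y h \<in> carrier H" "W x (V y h) \<in> carrier H"
        using that W[OF that(1)] V_mem[OF that(2,3)] K_mem by (auto simp: adjoint_pair_def)
      show "form H k (K x y h) = form H k (W x (V y h))" if k: "k \<in> carrier H" for k
      proof -
        have "form H k (W x (V y h)) = form L (V x k) (V y h)"
          using W[OF \<open>x \<in> X\<close>] V_mem[OF \<open>y \<in> X\<close> \<open>h \<in> carrier H\<close>] k by (simp add: adjoint_pair_def)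
        also have "\<dots> = form H (K y x k) h"
          by (rule gram[OF \<open>y \<in> X\<close> \<open>x \<in> X\<close> k \<open>h \<in> carrier H\<close>])
        also have "\<dots> = form H k (K x y h)"
          by (rule K_symmetric[OF \<open>y \<in> X\<close> \<open>x \<in> X\<close> k \<open>h \<in> carrier H\<close>])
        finally show ?thesis by simp
      qed
    qed
    show "dense_in L (complex_vector.span (\<Union>x\<in>X. V x ` carrier H))"
      unfolding dense_in_iff[OF krein_L complex_vector.subspace_span sub]
    proof (intro ballI impI)
      fix z assume "z \<in> carrier L" "\<forall>a\<in>complex_vector.span (\<Union>x\<in>X. V x ` carrier H). form L a z = 0"
      then show "z = 0" by (intro total) (auto intro: complex_vector.span_base)
    qed
  qed
qed

end

context decomposition
begin

lemma synthesis_mem: "f \<in> carrier F \<Longrightarrow> synthesis V f \<in> carrier L"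
  unfolding synthesis_def using finsupp_mem[of f X H K] V_mem by (intro L.sum_mem) blast

lemma form_synthesis:
  assumes f: "f \<in> carrier F" and g: "g \<in> carrier F"
  shows "form L (synthesis V f) (synthesis V g) = form F f g"
proof -
  have mem: "V y (f y) \<in> carrier L" if "f y \<noteq> 0" for y using finsupp_mem[OF f that] V_mem by blast
  have mem': "V x (g x) \<in> carrier L" if "g x \<noteq> 0" for x using finsupp_mem[OF g that] V_mem by blast
  have "form L (synthesis V f) (synthesis V g) = (\<Sum>x\<in>{x. g x \<noteq> 0}. form L (synthesis V f) (V x (g x)))"
    unfolding synthesis_def[of V g] using mem' synthesis_mem[OF f] by (intro L.form_sum_right) simp_all
  also have "\<dots> = (\<Sum>x\<in>{x. g x \<noteq> 0}. \<Sum>y\<in>{y. f y \<noteq> 0}. form L (V y (f y)) (V x (g x)))"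
    unfolding synthesis_def using mem mem' by (intro sum.cong refl L.form_sum_left) simp_all
  also have "\<dots> = form F f g"
    unfolding form_F using finsupp_mem[OF f] finsupp_mem[OF g] by (intro sum.cong refl) (simp add: gram)
  finally show ?thesis .
qed

lemma synthesis_total:
  assumes "z \<in> carrier L" "\<And>f. f \<in> carrier F \<Longrightarrow> form L (synthesis V f) z = 0"
  shows "z = 0"
  using assms(1)
proof (rule total)
  show "form L (V x h) z = 0" if "x \<in> X" "h \<in> carrier H" for x h
    using assms(2)[OF H.single_mem[OF that]] synthesis_single[OF that(1)] by simp
qed

lemma synthesis_eqI:
  assumes "z \<in> carrier L" "w \<in> carrier L"
    and "\<And>f. f \<in> carrier F \<Longrightarrow> form L (synthesis V f) z = form L (synthesis V f) w"
  shows "z = w"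
proof -
  have "z - w = 0"
    using assms by (intro synthesis_total) (simp_all add: L.form_diff_right synthesis_mem)
  then show ?thesis by simp
qed

text \<open>Agreement on a total set is passed to the adjoints, which coincide by
  \<open>total\<close>, and from there back to the operators. This replaces an argument by density
  and continuity.\<close>

lemma adjoint_pair_eq:
  assumes T1: "adjoint_pair L M T1 T1'" and T2: "adjoint_pair L M T2 T2'" and M: "krein_space M"
    and eq: "\<And>x h. \<lbrakk>x \<in> X; h \<in> carrier H\<rbrakk> \<Longrightarrow> T1 (V x h) = T2 (V x h)"
    and z: "z \<in> carrier L"
  shows "T1 z = T2 z"
proof -
  obtain G J where "fundamental_symmetry M G J" using M krein_space_iff by blast
  then interpret S: fundamental_symmetry M G J .
  have M: "ips M" by (rule S.ips)
  have T': "T1' y \<in> carrier L" "T2' y \<in> carrier L" if "y \<in> carrier M" for y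
    using T1 T2 that by (auto simp: adjoint_pair_def)
  have "T1' y - T2' y = 0" if y: "y \<in> carrier M" for y
  proof (rule total)
    show "T1' y - T2' y \<in> carrier L" using T'[OF y] by simp
    show "form L (V x h) (T1' y - T2' y) = 0" if "x \<in> X" "h \<in> carrier H" for x h
    proof -
      have "form L (V x h) (T1' y) = form M (T1 (V x h)) y" "form L (V x h) (T2' y) = form M (T2 (V x h)) y"
        using T1 T2 V_mem[OF that] y by (auto simp: adjoint_pair_def)
      then show ?thesis
        using eq[OF that] V_mem[OF that] T'[OF y] by (simp add: L.form_diff_right)
    qed
  qed
  then have T'_eq: "T1' y = T2' y" if "y \<in> carrier M" for y using that by simp
  show ?thesis
  proof (rule S.eqI)
    show "T1 z \<in> carrier M" "T2 z \<in> carrier M" using T1 T2 z by (auto simp: adjoint_pair_def)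
    show "form M y (T1 z) = form M y (T2 z)" if "y \<in> carrier M" for y
    proof -
      have "form M y (T1 z) = form L (T1' y) z" "form M y (T2 z) = form L (T2' y) z"
        using adjoint_pair_sym[OF T1 L.ips_axioms M] adjoint_pair_sym[OF T2 L.ips_axioms M] z that
        by (auto simp: adjoint_pair_def)
      then show ?thesis using T'_eq[OF that] by simp
    qed
  qed
qed

section \<open>The Hilbert norm that a negative system induces on a decomposition\<close>

context
  fixes B
  assumes system: "orthonormal_system F (-1) (\<lambda>b. b) B"
    and nonneg: "\<And>f. f \<in> carrier F \<Longrightarrow> 0 \<le> Re (form F (reflection F (-1) (\<lambda>b. b) B f) f)"
begin

definition positive_form where
  "positive_form = \<lparr>carrier = carrier L, form = \<lambda>y z. form L (reflection L (-1) (synthesis V) B y) z\<rparr>"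

lemma B_mem: "b \<in> B \<Longrightarrow> b \<in> carrier F"
  using system by (auto simp: orthonormal_system_def)

lemma system_synthesis: "orthonormal_system L (-1) (synthesis V) B"
  using system by (auto simp: orthonormal_system_def form_synthesis B_mem synthesis_mem)

lemma form_reflection_synthesis:
  assumes "f \<in> carrier F"
  shows "form L (reflection L (-1) (synthesis V) B (synthesis V f)) (synthesis V f) =
    form F (reflection F (-1) (\<lambda>b. b) B f) f"
proof -
  interpret F: ips F by (rule ips_F)
  show ?thesis
    using assms by (simp add: L.form_reflection[OF system_synthesis] F.form_reflection[OF system]
      synthesis_mem form_synthesis B_mem)
qed

text \<open>The reflected form is nonnegative on the dense image of \<open>F\<close>, hence on all of \<open>L\<close>.\<close>

lemma fundamental_positive_form:
  "fundamental_symmetry L positive_form (reflection L (-1) (synthesis V) B)"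
  unfolding positive_form_def
proof (rule fundamentalI[OF krein_L])
  let ?j = "reflection L (-1) (synthesis V) B"
  show "?j \<in> carrier L \<rightarrow> carrier L" using L.reflection_mem[OF system_synthesis] by blast
  show "form L (?j y) z = form L y (?j z)" if "y \<in> carrier L" "z \<in> carrier L" for y z
    by (rule L.reflection_symmetric[OF system_synthesis that])
  show "?j (?j y) = y" if "y \<in> carrier L" for y
    by (rule L.reflection_reflection[OF system_synthesis that])
  show "0 \<le> Re (form L (?j z) z)" if z: "z \<in> carrier L" for z
  proof -
    obtain G J where "fundamental_symmetry L G J" using krein_L krein_space_iff by blast
    then interpret S: fundamental_symmetry L G J .
    \<comment> \<open>The reflected square is \<open>[y, y]\<close> plus finitely many products of
      functionals, so its continuity reduces to that of the indefinite form.\<close>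
    have q: "form L (?j y) y = form L y y + 2 * (\<Sum>b\<in>B. form L y (synthesis V b) * form L (synthesis V b) y)"
      if "y \<in> carrier L" for y
      using L.form_reflection[OF system_synthesis that that] by simp
    let ?A = "synthesis V ` carrier F"
    have A: "?A \<subseteq> carrier L" "complex_vector.subspace ?A"
    proof -
      show "?A \<subseteq> carrier L" using synthesis_mem by blast
      show "complex_vector.subspace ?A" unfolding synthesis_range by (rule complex_vector.subspace_span)
    qed
    have sep: "y = 0" if "y \<in> carrier L" "\<And>a. a \<in> ?A \<Longrightarrow> form L a y = 0" for y
      using that by (intro synthesis_total) simp_all
    obtain s where s: "\<And>n::nat. s n \<in> ?A" "(\<lambda>n. ip_norm G (s n - z)) \<longlonglongrightarrow> 0"
      using S.approximation[OF A(2,1) sep z] by auto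
    have mem: "s n \<in> carrier L" for n using s(1) A(1) by blast
    have memG: "s n \<in> carrier G" "z \<in> carrier G" for n using mem z by (simp_all add: S.carrier_eq)
    have left: "(\<lambda>n. form L (s n) y) \<longlonglongrightarrow> form L z y" if "y \<in> carrier L" for y
      using that memG S.form_tendsto_left[OF memG _ s(2), of "J y"] by (simp add: S.carrier_eq S.form_eq_right)
    have right: "(\<lambda>n. form L y (s n)) \<longlonglongrightarrow> form L y z" if "y \<in> carrier L" for y
      using tendsto_cnj[OF left[OF that]] that mem z by (simp flip: L.form_commute)
    have "(\<lambda>n. form L (s n - z) (s n - z)) \<longlonglongrightarrow> 0"
    proof (rule Lim_null_comparison)
      show "\<forall>\<^sub>F n in sequentially. norm (form L (s n - z) (s n - z)) \<le> ip_norm G (s n - z) * ip_norm G (s n - z)"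
        using memG by (intro always_eventually allI S.form_bound) simp_all
      show "(\<lambda>n. ip_norm G (s n - z) * ip_norm G (s n - z)) \<longlonglongrightarrow> 0"
        using tendsto_mult[OF s(2) s(2)] by simp
    qed
    \<comment> \<open>Expanding \<open>[s n - z, s n - z]\<close> expresses
      \<open>[s n, s n]\<close> through a term that tends to 0 and terms with only one varying
      entry.\<close>
    then have "(\<lambda>n. form L (s n - z) (s n - z) + form L z (s n) + form L (s n) z - form L z z) \<longlonglongrightarrow>
        0 + form L z z + form L z z - form L z z"
      by (intro tendsto_intros left right z)
    then have diag: "(\<lambda>n. form L (s n) (s n)) \<longlonglongrightarrow> form L z z"
      using mem z by (simp add: L.form_simps)
    have "(\<lambda>n. form L (?j (s n)) (s n)) \<longlonglongrightarrow> form L (?j z) z"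
      unfolding q[OF mem] q[OF z] by (intro tendsto_intros diag left right synthesis_mem B_mem)
    then have "(\<lambda>n. Re (form L (?j (s n)) (s n))) \<longlonglongrightarrow> Re (form L (?j z) z)"
      by (rule tendsto_Re)
    moreover have "0 \<le> Re (form L (?j (s n)) (s n))" for n
    proof -
      obtain f where "f \<in> carrier F" "s n = synthesis V f" using s(1) by blast
      then show ?thesis using nonneg[of f] form_reflection_synthesis[of f] by simp
    qed
    ultimately show ?thesis by (intro LIMSEQ_le_const) auto
  qed
qed

text \<open>The right-hand side contains neither V nor \<open>L\<close>, so the norm is the same in
  every decomposition of K.\<close>

lemma norm_synthesis:
  "f \<in> carrier F \<Longrightarrow> ip_norm positive_form (synthesis V f) =
    sqrt (Re (form F (reflection F (-1) (\<lambda>b. b) B f) f))"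
  by (simp add: ip_norm_def positive_form_def form_reflection_synthesis)

end

end

lemma (in kernel) nonneg_system:
  assumes "has_negative_squares X H K \<kappa>"
  shows "\<exists>B. orthonormal_system F (-1) (\<lambda>b. b) B \<and>
    (\<forall>f\<in>carrier F. 0 \<le> Re (form F (reflection F (-1) (\<lambda>b. b) B f) f))"
proof -
  interpret F: ips F by (rule ips_F)
  have "card B \<le> \<kappa>" if "orthonormal_system F (-1) (\<lambda>b. b) B" for B
    using F.negative_subspace_span[OF that] assms unfolding has_negative_squares_def by metis
  then show ?thesis by (rule F.nonneg_reflection)
qed

section \<open>Uniqueness\<close>

text \<open>The operator is obtained by duality instead of extension by continuity:
  \<open>\<Phi> k\<close> represents the functional that sends \<open>V2 f\<close> to
  \<open>[V1 f, k]\<close>. All further properties, linearity and unitarity included, are tested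
  against the total vectors \<open>V2 f\<close> or \<open>V1 f\<close>.\<close>

lemma (in kernel) decompositions_unitarily_equivalent:
  fixes L1 :: "'k1::complex_vector inner_space" and L2 :: "'k2::complex_vector inner_space"
  assumes D1: "decomposition X H K V1 L1" and D2: "decomposition X H K V2 L2"
    and system: "orthonormal_system F (-1) (\<lambda>b. b) B"
    and nonneg: "\<And>f. f \<in> carrier F \<Longrightarrow> 0 \<le> Re (form F (reflection F (-1) (\<lambda>b. b) B f) f)"
  shows "unitarily_equivalent X H V1 L1 V2 L2"
proof -
  interpret D1: decomposition X H K V1 L1 by fact
  interpret D2: decomposition X H K V2 L2 by fact
  define N1 where "N1 = D1.positive_form B"
  define j1 where "j1 = reflection L1 (-1) (synthesis V1) B"
  define N2 where "N2 = D2.positive_form B"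
  define j2 where "j2 = reflection L2 (-1) (synthesis V2) B"
  interpret S1: fundamental_symmetry L1 N1 j1
    unfolding N1_def j1_def by (rule D1.fundamental_positive_form[OF system nonneg])
  interpret S2: fundamental_symmetry L2 N2 j2
    unfolding N2_def j2_def by (rule D2.fundamental_positive_form[OF system nonneg])
  have norm_eq: "ip_norm N1 (synthesis V1 f) = ip_norm N2 (synthesis V2 f)" if "f \<in> carrier F" for f
    unfolding N1_def N2_def
    by (simp only: D1.norm_synthesis[OF system nonneg that] D2.norm_synthesis[OF system nonneg that])
  \<comment> \<open>The products of \<open>V1 f\<close> with all \<open>V1 h\<close> are values of
    the form on functions, and these can equally be read off from \<open>V2 f\<close>.\<close>
  have welldef: "synthesis V1 f = synthesis V1 g"
    if f: "f \<in> carrier F" and g: "g \<in> carrier F" and eq: "synthesis V2 f = synthesis V2 g" for f g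
  proof (rule D1.synthesis_eqI)
    show "synthesis V1 f \<in> carrier L1" "synthesis V1 g \<in> carrier L1"
      using f g D1.synthesis_mem by blast+
    show "form L1 (synthesis V1 h) (synthesis V1 f) = form L1 (synthesis V1 h) (synthesis V1 g)"
      if h: "h \<in> carrier F" for h
      using D2.form_synthesis[OF h f] D2.form_synthesis[OF h g] eq
      by (simp add: D1.form_synthesis[OF h f] D1.form_synthesis[OF h g])
  qed
  have "\<exists>z. z \<in> carrier L2 \<and> (\<forall>f\<in>carrier F. form L2 (synthesis V2 f) z = form L1 (synthesis V1 f) k) \<and>
      ip_norm N2 z \<le> ip_norm N1 k" if k: "k \<in> carrier L1" for k
  proof -
    define R where "R = synthesis V2 ` carrier F"
    \<comment> \<open>The functional on the range of \<open>synthesis V2\<close>, with some preimage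
      of r; by \<open>welldef\<close> its choice does not matter.\<close>
    define \<phi> where "\<phi> r = form L1 (synthesis V1 (inv_into (carrier F) (synthesis V2) r)) k" for r
    have \<phi>: "\<phi> (synthesis V2 f) = form L1 (synthesis V1 f) k" if f: "f \<in> carrier F" for f
    proof -
      have "synthesis V1 (inv_into (carrier F) (synthesis V2) (synthesis V2 f)) = synthesis V1 f"
        using f by (intro welldef) (simp_all add: inv_into_into f_inv_into_f)
      then show ?thesis by (simp add: \<phi>_def)
    qed
    have sub: "complex_vector.subspace R"
      unfolding R_def D2.synthesis_range by (rule complex_vector.subspace_span)
    have R: "R \<subseteq> carrier N2"
      using D2.synthesis_mem by (auto simp: R_def simp flip: S2.carrier_eq)
    have add: "\<phi> (r + r') = \<phi> r + \<phi> r'" if r: "r \<in> R" "r' \<in> R" for r r'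
    proof -
      obtain f g where fg: "f \<in> carrier F" "g \<in> carrier F" "r = synthesis V2 f" "r' = synthesis V2 g"
        using r by (auto simp: R_def)
      then show ?thesis
        using \<phi>[OF complex_vector.subspace_add[OF H.finsupp_subspace fg(1,2)]] k
        by (simp add: D1.synthesis_add[OF fg(1,2)] D2.synthesis_add[OF fg(1,2)] \<phi> D1.L.form_add_left D1.synthesis_mem)
    qed
    have scale: "\<phi> (c *\<^sub>C r) = c * \<phi> r" if r: "r \<in> R" for c r
    proof -
      obtain f where f: "f \<in> carrier F" "r = synthesis V2 f"
        using r by (auto simp: R_def)
      then show ?thesis
        using \<phi>[OF complex_vector.subspace_scale[OF H.finsupp_subspace f(1), of c]] k
        by (simp add: D1.synthesis_scale[OF f(1)] D2.synthesis_scale[OF f(1)] \<phi> D1.L.form_scale_left D1.synthesis_mem)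
    qed
    have bound: "cmod (\<phi> r) \<le> ip_norm N1 k * ip_norm N2 r" if r: "r \<in> R" for r
    proof -
      obtain f where f: "f \<in> carrier F" "r = synthesis V2 f"
        using r by (auto simp: R_def)
      have "cmod (form L1 (synthesis V1 f) k) \<le> ip_norm N1 (synthesis V1 f) * ip_norm N1 k"
        using f k D1.synthesis_mem by (intro S1.form_bound) (simp_all flip: S1.carrier_eq)
      then show ?thesis using f by (simp add: \<phi> norm_eq mult.commute)
    qed
    have nn: "0 \<le> ip_norm N1 k"
      using k by (intro S1.norm_ge_0) (simp flip: S1.carrier_eq)
    obtain z where z: "z \<in> carrier N2" "\<And>r. r \<in> R \<Longrightarrow> \<phi> r = form N2 r z" "ip_norm N2 z \<le> ip_norm N1 k"
      using S2.Riesz[OF sub R add scale bound nn] by blast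
    \<comment> \<open>Riesz represents the functional in the Hilbert product of \<open>N2\<close>;
      applying \<open>j2\<close> moves the representation to the form of \<open>L2\<close>.\<close>
    have "form L2 (synthesis V2 f) (j2 z) = form L1 (synthesis V1 f) k" if f: "f \<in> carrier F" for f
    proof -
      have "synthesis V2 f \<in> R" using f by (simp add: R_def)
      then show ?thesis using z R \<phi>[OF f] S2.form_J_right[of "synthesis V2 f" z] by auto
    qed
    then show ?thesis
      using z by (intro exI[of _ "j2 z"]) (simp add: S2.carrier_eq)
  qed
  then obtain \<Phi> where mem: "\<And>k. k \<in> carrier L1 \<Longrightarrow> \<Phi> k \<in> carrier L2"
    and eq: "\<And>k f. \<lbrakk>k \<in> carrier L1; f \<in> carrier F\<rbrakk> \<Longrightarrow> form L2 (synthesis V2 f) (\<Phi> k) = form L1 (synthesis V1 f) k"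
    and le: "\<And>k. k \<in> carrier L1 \<Longrightarrow> ip_norm N2 (\<Phi> k) \<le> ip_norm N1 k"
    by metis
  have "linear_op L1 L2 \<Phi>"
    unfolding linear_op_def
  proof (intro conjI ballI allI)
    show "\<Phi> \<in> carrier L1 \<rightarrow> carrier L2" using mem by blast
    show "\<Phi> (k + l) = \<Phi> k + \<Phi> l" if "k \<in> carrier L1" "l \<in> carrier L1" for k l
      using that by (intro D2.synthesis_eqI)
        (simp_all add: mem eq D1.L.form_add_right D2.L.form_add_right D1.synthesis_mem D2.synthesis_mem)
    show "\<Phi> (c *\<^sub>C k) = c *\<^sub>C \<Phi> k" if "k \<in> carrier L1" for c k
      using that by (intro D2.synthesis_eqI)
        (simp_all add: mem eq D1.L.form_scale_right D2.L.form_scale_right D1.synthesis_mem D2.synthesis_mem)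
  qed
  moreover have "\<forall>k\<in>carrier L1. ip_norm N2 (\<Phi> k) \<le> 1 * ip_norm N1 k" using le by simp
  ultimately have "\<Phi> \<in> bounded_ops L1 L2"
    unfolding bounded_ops_def using S1.fundamental S2.fundamental by blast
  then have pair: "adjoint_pair L1 L2 \<Phi> (adj L1 L2 \<Phi>)" by (rule bounded_ops_adjoint_pair)
  then have adj_mem: "adj L1 L2 \<Phi> y \<in> carrier L1" if "y \<in> carrier L2" for y
    using that by (auto simp: adjoint_pair_def)
  have \<Phi>_V: "\<Phi> (synthesis V1 g) = synthesis V2 g" if g: "g \<in> carrier F" for g
    using g by (intro D2.synthesis_eqI)
      (simp_all add: mem eq D1.form_synthesis D2.form_synthesis D1.synthesis_mem D2.synthesis_mem)
  have adj: "form L1 (synthesis V1 f) (adj L1 L2 \<Phi> y) = form L2 (synthesis V2 f) y"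
    if "f \<in> carrier F" "y \<in> carrier L2" for f y
  proof -
    have "form L2 (\<Phi> (synthesis V1 f)) y = form L1 (synthesis V1 f) (adj L1 L2 \<Phi> y)"
      using pair that D1.synthesis_mem[OF that(1)] by (auto simp: adjoint_pair_def)
    then show ?thesis by (simp add: \<Phi>_V that)
  qed
  have "unitary_op L1 L2 \<Phi>"
  proof (rule unitary_opI[OF pair D1.krein_L D2.krein_L])
    show "adj L1 L2 \<Phi> (\<Phi> k) = k" if "k \<in> carrier L1" for k
      using that by (intro D1.synthesis_eqI) (simp_all add: adj_mem mem adj eq)
    show "\<Phi> (adj L1 L2 \<Phi> y) = y" if "y \<in> carrier L2" for y
      using that by (intro D2.synthesis_eqI) (simp_all add: adj_mem mem adj eq)
  qed
  moreover have "V2 x h = \<Phi> (V1 x h)" if "x \<in> X" "h \<in> carrier H" for x h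
    using \<Phi>_V[OF H.single_mem[OF that]] that by (simp add: D1.synthesis_single D2.synthesis_single)
  ultimately show ?thesis
    unfolding unitarily_equivalent_def by blast
qed

section \<open>Existence\<close>

text \<open>With the identity as symmetry. It makes the lemmas on adjoint pairs available for an
  operator on the Hilbert completion.\<close>

lemma hilbert_krein:
  assumes "hilbert G"
  shows "krein_space G"
proof -
  interpret hilbert G by fact
  have "fundamental G G (\<lambda>x. x)"
    using hilbert by (simp add: fundamental_def linear_op_def)
  then show ?thesis
    using inner_product unfolding krein_space_def by blast
qed

text \<open>The Pontryagin space is a reproducing kernel space of functions: \<open>form L e (V x h)\<close> is
  \<open>form H (e x) h\<close>, so evaluation at \<open>x\<close> is the adjoint of \<open>V x\<close>.\<close>

lemma (in kernel) pontryagin_decomposition: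
  assumes system: "orthonormal_system F (-1) (\<lambda>b. b) B"
    and nonneg: "\<And>f. f \<in> carrier F \<Longrightarrow> 0 \<le> Re (form F (reflection F (-1) (\<lambda>b. b) B f) f)"
  obtains L where "pontryagin_space L" "decomposition X H K (kernel_map X K) L"
proof -
  interpret F: ips F by (rule ips_F)
  interpret V: fiberwise_linear X H "kernel_map X K" by (rule fiberwise_linear_kernel_map)
  define j where "j = reflection F (-1) (\<lambda>b. b) B"
  have j_mem [simp]: "j f \<in> carrier F" if "f \<in> carrier F" for f
    using F.reflection_mem[OF system that] by (simp add: j_def)
  have j_sym: "form F (j f) g = form F f (j g)" if "f \<in> carrier F" "g \<in> carrier F" for f g
    using F.reflection_symmetric[OF system that] by (simp add: j_def)
  have j_j [simp]: "j (j f) = f" if "f \<in> carrier F" for f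
    using F.reflection_reflection[OF system that] by (simp add: j_def)
  define T where "T = synthesis (kernel_map X K)"
  define E where "E = extended_functions X H"
  \<comment> \<open>The reflection sits in the second entry, so that the first enters only through
    \<open>T f\<close>; the pairing of an arbitrary function e with \<open>j g\<close> is then the
    natural extension of the form.\<close>
  define P where "P = \<lparr>carrier = carrier F, form = \<lambda>f g. form F f (j g)\<rparr>"
  have P_carrier [simp]: "carrier P = carrier F" and P_form: "form P f g = form F f (j g)" for f g
    by (simp_all add: P_def)
  have T_E: "T f \<in> E" if "f \<in> carrier F" for f
    using synthesis_kernel_map_mem[OF that] by (simp add: T_def E_def)
  have E_mem: "e x \<in> carrier H" if "e \<in> E" "x \<in> X" for e x
    using that by (auto simp: E_def extended_functions_def)
  have form_T: "form F f g = pointwise_pairing H (T f) g" if "f \<in> carrier F" "g \<in> carrier F" for f g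
    using form_F_pairing[OF that] by (simp add: T_def)
  interpret P: psd_ips P
  proof
    have herm: "form F g (j f) = cnj (form F f (j g))" if "f \<in> carrier F" "g \<in> carrier F" for f g
      using F.form_commute[of f "j g"] j_sym[of g f] that by simp
    show "inner_product_space P"
      unfolding inner_product_space_def P_carrier P_form
    proof (intro conjI)
      show "\<forall>f\<in>carrier F. \<forall>g\<in>carrier F. form F g (j f) = cnj (form F f (j g))"
        using herm by blast
    qed (simp_all add: F.subspace_carrier F.form_add_left F.form_scale_left)
    show "0 \<le> Re (form P f f)" if "f \<in> carrier P" for f
      using nonneg[of f] that by (simp add: P_form flip: j_def j_sym)
  qed
  obtain GH JH where "fundamental_symmetry H GH JH" using krein krein_space_iff by blast
  then interpret S: fundamental_symmetry H GH JH .
  \<comment> \<open>Evaluation at x, up to symmetries, is adjoint to placing a vector at x. The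
    latter is defined on the complete space \<open>GH\<close>, so Hellinger-Toeplitz bounds both,
    although \<open>P\<close> is neither complete nor definite.\<close>
  have eval: "\<exists>M\<ge>0. \<forall>f\<in>carrier F. ip_norm GH (T f x) \<le> M * ip_norm P f" if x: "x \<in> X" for x
  proof -
    have Tx: "T f x \<in> carrier GH" if "f \<in> carrier F" for f
      using E_mem[OF T_E[OF that] x] by (simp add: S.carrier_eq)
    have "form P (single x h) g = form GH h (JH (T (j g) x))" if h: "h \<in> carrier GH" and g: "g \<in> carrier P" for h g
    proof -
      have hH: "h \<in> carrier H" using h by (simp add: S.carrier_eq)
      have "form P (single x h) g = cnj (form F (j g) (single x h))"
        using F.form_commute[of "j g" "single x h"] g H.single_mem[OF x hH] by (simp add: P_form)
      also have "form F (j g) (single x h) = form H (T (j g) x) h"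
        using form_T[of "j g" "single x h"] H.pairing_single[of "T (j g)" x h] Tx[of "j g"] g H.single_mem[OF x hH]
        by (simp add: S.carrier_eq)
      also have "cnj (form H (T (j g) x) h) = form H h (T (j g) x)"
        using H.form_commute[of "T (j g) x" h] Tx[of "j g"] g hH by (simp add: S.carrier_eq)
      also have "\<dots> = form GH h (JH (T (j g) x))"
        using h Tx[of "j g"] g by (intro S.form_eq_right) simp_all
      finally show ?thesis .
    qed
    moreover have "single x \<in> carrier GH \<rightarrow> carrier P"
      using H.single_mem[OF x] by (auto simp: S.carrier_eq)
    moreover have "(\<lambda>g. JH (T (j g) x)) \<in> carrier P \<rightarrow> carrier GH"
      using Tx by simp
    ultimately have "\<exists>M\<ge>0. (\<forall>h\<in>carrier GH. ip_norm P (single x h) \<le> M * ip_norm GH h) \<and>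
        (\<forall>g\<in>carrier P. ip_norm GH (JH (T (j g) x)) \<le> M * ip_norm P g)"
      using Hellinger_Toeplitz[OF S.hilbert_axioms P.psd_ips_axioms] by simp
    then obtain M where M: "0 \<le> M" "\<And>g. g \<in> carrier P \<Longrightarrow> ip_norm GH (JH (T (j g) x)) \<le> M * ip_norm P g"
      by blast
    have "ip_norm GH (T f x) \<le> M * ip_norm P f" if f: "f \<in> carrier F" for f
    proof -
      \<comment> \<open>The bound concerns \<open>T (j g) x\<close>; since \<open>j\<close> is an
        involution preserving the seminorm, taking \<open>g = j f\<close> gives it for
        \<open>T f x\<close>.\<close>
      have "ip_norm P (j f) = ip_norm P f"
        using f by (simp add: ip_norm_def P_form j_sym)
      then show ?thesis using M(2)[of "j f"] f Tx by simp
    qed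
    then show ?thesis using M(1) by blast
  qed
  interpret C: completion P E T "\<lambda>e g. pointwise_pairing H e (j g)"
  proof
    show "complex_vector.subspace E"
      unfolding E_def extended_functions_def
      by (rule complex_vector.subspaceI) (auto simp: Pi_iff scaleC_fun_def)
    show "T f \<in> E" if "f \<in> carrier P" for f using T_E that by simp
    show "pointwise_pairing H (e + d) (j g) = pointwise_pairing H e (j g) + pointwise_pairing H d (j g)"
      if "e \<in> E" "d \<in> E" "g \<in> carrier P" for e d g
      using that by (intro pairing_add) (simp_all add: E_def)
    show "pointwise_pairing H (c *\<^sub>C e) (j g) = c * pointwise_pairing H e (j g)" if "e \<in> E" "g \<in> carrier P" for c e g
      using that by (intro pairing_scale) (simp_all add: E_def)
    show "pointwise_pairing H (T f) (j g) = form P f g" if "f \<in> carrier P" "g \<in> carrier P" for f g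
      using that by (simp add: P_form form_T)
    show "e = 0" if e: "e \<in> E" and 0: "\<And>g. g \<in> carrier P \<Longrightarrow> pointwise_pairing H e (j g) = 0" for e
    proof (rule pairing_separating)
      show "e \<in> extended_functions X H" using e by (simp add: E_def)
      show "pointwise_pairing H e g = 0" if "g \<in> carrier F" for g
        using 0[of "j g"] that by simp
    qed
    show "\<exists>e\<in>E. \<forall>g\<in>carrier P. (\<lambda>n. form P (s n) g) \<longlonglongrightarrow> pointwise_pairing H e (j g)"
      if s: "ip_Cauchy P s" for s
    proof -
      have sF [simp]: "s n \<in> carrier F" for n using ip_Cauchy_carrier[OF s] by simp
      \<comment> \<open>By \<open>eval\<close> the values at x form a Cauchy sequence in a Hilbert
        space. The pointwise limits suffice, because every pairing is a finite sum of
        values.\<close>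
      have "\<exists>y. y \<in> carrier GH \<and> (\<lambda>n. ip_norm GH (T (s n) x - y)) \<longlonglongrightarrow> 0" if x: "x \<in> X" for x
      proof -
        obtain M where M: "0 \<le> M" "\<And>f. f \<in> carrier F \<Longrightarrow> ip_norm GH (T f x) \<le> M * ip_norm P f"
          using eval[OF x] by blast
        have "ip_Cauchy GH (\<lambda>n. T (s n) x)"
          unfolding ip_Cauchy_def
        proof (intro conjI allI impI)
          show "range (\<lambda>n. T (s n) x) \<subseteq> carrier GH"
            using E_mem[OF T_E[OF sF] x] by (auto simp: S.carrier_eq)
          fix r :: real assume "0 < r"
          then have "0 < r / (M + 1)" using M by (simp add: add_nonneg_pos)
          then obtain N where N: "\<And>m n. \<lbrakk>N \<le> m; N \<le> n\<rbrakk> \<Longrightarrow> ip_norm P (s m - s n) < r / (M + 1)"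
            using s unfolding ip_Cauchy_def by meson
          have "ip_norm GH (T (s m) x - T (s n) x) < r" if "N \<le> m" "N \<le> n" for m n
          proof -
            have "T (s m - s n) = T (s m) - T (s n)"
              unfolding T_def by (rule V.synthesis_diff[OF sF sF])
            then have "ip_norm GH (T (s m) x - T (s n) x) = ip_norm GH (T (s m - s n) x)" by simp
            also have "\<dots> \<le> M * ip_norm P (s m - s n)" by (rule M(2)) (rule F.diff_mem[OF sF sF])
            also have "\<dots> \<le> (M + 1) * ip_norm P (s m - s n)"
              using P.norm_ge_0[of "s m - s n"] F.diff_mem[OF sF sF] by (intro mult_right_mono) simp_all
            also have "\<dots> < r"
              using N[OF that] M by (simp add: pos_less_divide_eq add_nonneg_pos mult.commute)
            finally show ?thesis .
          qed
          then show "\<exists>N. \<forall>m\<ge>N. \<forall>n\<ge>N. ip_norm GH (T (s m) x - T (s n) x) < r" by blast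
        qed
        then show ?thesis by (rule S.Cauchy_convergent) blast
      qed
      then obtain y where y: "\<And>x. x \<in> X \<Longrightarrow> y x \<in> carrier GH"
        and lim: "\<And>x. x \<in> X \<Longrightarrow> (\<lambda>n. ip_norm GH (T (s n) x - y x)) \<longlonglongrightarrow> 0"
        by metis
      define e where "e x = (if x \<in> X then y x else 0)" for x
      have "(\<lambda>n. form P (s n) g) \<longlonglongrightarrow> pointwise_pairing H e (j g)" if g: "g \<in> carrier P" for g
      proof -
        have "form P (s n) g = (\<Sum>x\<in>{x. j g x \<noteq> 0}. form H (T (s n) x) (j g x))" for n
          using g by (simp add: P_form form_T pointwise_pairing_def)
        moreover have "(\<lambda>n. \<Sum>x\<in>{x. j g x \<noteq> 0}. form H (T (s n) x) (j g x)) \<longlonglongrightarrow>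
            (\<Sum>x\<in>{x. j g x \<noteq> 0}. form H (e x) (j g x))"
        proof (rule tendsto_sum)
          fix x assume "x \<in> {x. j g x \<noteq> 0}"
          then have x: "x \<in> X" and jg: "j g x \<in> carrier GH"
            using finsupp_mem[of "j g" X H K x] g by (simp_all add: S.carrier_eq)
          have Tx: "T (s n) x \<in> carrier GH" for n
            using E_mem[OF T_E[OF sF] x] by (simp add: S.carrier_eq)
          have "(\<lambda>n. form GH (T (s n) x) (JH (j g x))) \<longlonglongrightarrow> form GH (y x) (JH (j g x))"
            by (intro S.form_tendsto_left Tx y x lim S.J_mem jg)
          then show "(\<lambda>n. form H (T (s n) x) (j g x)) \<longlonglongrightarrow> form H (e x) (j g x)"
            using x by (simp add: e_def S.form_eq_right[OF Tx jg] S.form_eq_right[OF y jg])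
        qed
        ultimately show ?thesis by (simp add: pointwise_pairing_def)
      qed
      moreover have "e \<in> E"
        using y by (auto simp: e_def E_def extended_functions_def S.carrier_eq)
      ultimately show ?thesis by blast
    qed
  qed
  define G where "G = C.compl"
  interpret G: hilbert G unfolding G_def by (rule C.hilbert_compl)
  have G_E: "carrier G \<subseteq> E" unfolding G_def by (rule C.compl_carrier_subset)
  have T_G: "T f \<in> carrier G" if "f \<in> carrier F" for f
    unfolding G_def using that by (intro C.T_mem_compl) simp
  have form_G_T: "form G e (T g) = pointwise_pairing H e (j g)" if "e \<in> carrier G" "g \<in> carrier F" for e g
    using that unfolding G_def by (intro C.form_compl_T) simp_all
  have B_F: "b \<in> carrier F" if "b \<in> B" for b
    using system that by (auto simp: orthonormal_system_def)
  have j_B: "form F f (j b) = - form F f b" if "f \<in> carrier F" "b \<in> B" for f b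
    using F.form_reflection_system[OF system that] j_sym[of f b] that B_F by (simp add: j_def)
  \<comment> \<open>The product in \<open>G\<close> involves \<open>j\<close>, which changes the
    sign on \<open>B\<close>: the negative system becomes a positive one, whence the sign 1.\<close>
  have system_T: "orthonormal_system G 1 T B"
    unfolding orthonormal_system_def
  proof (intro conjI ballI)
    show "T \<in> B \<rightarrow> carrier G" using T_G B_F by blast
    show "form G (T b) (T c) = (if b = c then of_real 1 else 0)" if "b \<in> B" "c \<in> B" for b c
    proof -
      have "form G (T b) (T c) = form F b (j c)"
        using that by (simp add: form_G_T T_G B_F form_T)
      then show ?thesis
        using system that by (simp add: j_B B_F orthonormal_system_def)
    qed
  qed (use system in \<open>simp_all add: orthonormal_system_def\<close>)
  define J where "J = reflection G 1 T B"
  have J_mem: "J e \<in> carrier G" if "e \<in> carrier G" for e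
    using G.reflection_mem[OF system_T that] by (simp add: J_def)
  have J_sym: "form G (J e) d = form G e (J d)" if "e \<in> carrier G" "d \<in> carrier G" for e d
    using G.reflection_symmetric[OF system_T that] by (simp add: J_def)
  have J_J: "J (J e) = e" if "e \<in> carrier G" for e
    using G.reflection_reflection[OF system_T that] by (simp add: J_def)
  have J_T: "J (T f) = T (j f)" if f: "f \<in> carrier F" for f
  proof -
    \<comment> \<open>Both the sign of the system and the sign of the coefficients change, so the
      reflection in \<open>G\<close> extends the image of \<open>j\<close> under
      \<open>T\<close>.\<close>
    have "form G (T f) (T b) = - form F f b" if "b \<in> B" for b
      using f that form_T[of f "j b"] by (simp add: form_G_T T_G B_F j_B)
    then show ?thesis
      using V.synthesis_reflection[OF f B_F, of B "-1"]
      by (simp add: J_def j_def T_def reflection_def[of G] cong: sum.cong)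
  qed
  have "adjoint_pair G G J J"
    using J_mem J_sym by (auto simp: adjoint_pair_def)
  then have J_linear: "linear_op G G J"
    using hilbert_krein[OF G.hilbert_axioms] by (intro adjoint_pair_linear)
  define L where "L = \<lparr>carrier = carrier G, form = \<lambda>e d. form G (J e) d\<rparr>"
  have L_carrier [simp]: "carrier L = carrier G" and L_form: "form L e d = form G (J e) d" for e d
    by (simp_all add: L_def)
  interpret L: fundamental_symmetry L G J
    using J_sym J_J J_linear G.hilbert by unfold_locales (simp add: fundamental_def L_form)
  have krein_L: "krein_space L"
    using L.fundamental_symmetry_axioms krein_space_iff by blast
  \<comment> \<open>The symmetry \<open>J\<close> acts on \<open>T g\<close> as \<open>j\<close> and
    cancels the \<open>j\<close> contained in the product of \<open>G\<close>.\<close>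
  have reproducing: "form L e (T g) = pointwise_pairing H e g" if "e \<in> carrier G" "g \<in> carrier F" for e g
    using that J_sym[OF that(1) T_G[OF that(2)]] form_G_T[OF that(1), of "j g"] by (simp add: L_form J_T)
  have V_T: "kernel_map X K x h = T (single x h)" if "x \<in> X" for x h
    using V.synthesis_single[OF that] by (simp add: T_def)
  have V_mem: "kernel_map X K x h \<in> carrier G" if "x \<in> X" "h \<in> carrier H" for x h
    using that by (simp add: V_T T_G H.single_mem)
  have eval_L: "form L e (kernel_map X K x h) = form H (e x) h" if "e \<in> carrier G" "x \<in> X" "h \<in> carrier H" for e x h
    using that G_E E_mem H.pairing_single[of e x h] by (auto simp: V_T reproducing H.single_mem)
  interpret L': ips L by (rule L.ips)
  have eval_L': "form L (kernel_map X K x h) e = form H h (e x)" if "e \<in> carrier G" "x \<in> X" "h \<in> carrier H" for e x h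
    using eval_L[OF that] L'.form_commute[of e "kernel_map X K x h"] H.form_commute[of "e x" h] that V_mem G_E E_mem
    by auto
  have "decomposition X H K (kernel_map X K) L"
  proof
    show "krein_space L" by (rule krein_L)
    show "\<exists>W. adjoint_pair H L (kernel_map X K x) W" if "x \<in> X" for x
      using that V_mem eval_L' G_E E_mem
      by (intro exI[of _ "\<lambda>e. e x"]) (auto simp: adjoint_pair_def)
    show "form L (kernel_map X K y h) (kernel_map X K x k) = form H (K x y h) k"
      if "x \<in> X" "y \<in> X" "h \<in> carrier H" "k \<in> carrier H" for x y h k
      using that by (simp add: eval_L V_mem) (simp add: kernel_map_def)
    show "e = 0" if e: "e \<in> carrier L" and 0: "\<And>x h. \<lbrakk>x \<in> X; h \<in> carrier H\<rbrakk> \<Longrightarrow> form L (kernel_map X K x h) e = 0" for e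
    proof
      fix x
      have eE: "e \<in> E" using e G_E by auto
      show "e x = 0 x"
      proof (cases "x \<in> X")
        case True
        then have "e x = 0"
          using 0[OF True] eval_L'[of e x] e E_mem[OF eE True] by (intro S.nondegenerate) simp_all
        then show ?thesis by simp
      qed (use eE in \<open>simp add: E_def extended_functions_def\<close>)
    qed
  qed
  moreover have "pontryagin_space L"
    unfolding pontryagin_space_def
  proof (intro conjI exI)
    show "inner_product_space L" by (rule L'.inner_product)
    show "fundamental L G J" by (rule L.fundamental)
    \<comment> \<open>On this set the reflection formula expresses \<open>2 e\<close> as a
      combination of the finitely many \<open>T b\<close>.\<close>
    have "{e \<in> carrier L. e + J e = 0} \<subseteq> complex_vector.span (T ` B)"
    proof
      fix e assume "e \<in> {e \<in> carrier L. e + J e = 0}"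
      then have "e + e = (\<Sum>b\<in>B. (2 * form G e (T b)) *\<^sub>C T b)"
        by (simp add: J_def reflection_def algebra_simps)
      then have "e + e \<in> complex_vector.span (T ` B)"
        by (simp add: complex_vector.span_sum complex_vector.span_scale complex_vector.span_base)
      then have "(1/2) *\<^sub>C (e + e) \<in> complex_vector.span (T ` B)"
        by (rule complex_vector.span_scale)
      moreover have "(1/2) *\<^sub>C (e + e) = e"
        by (simp only: complex_vector.scale_right_distrib flip: complex_vector.scale_left_distrib) simp
      ultimately show "e \<in> complex_vector.span (T ` B)" by simp
    qed
    moreover have "finite (T ` B)" using system by (simp add: orthonormal_system_def)
    ultimately show "finite_dim {e \<in> carrier L. e + J e = 0}"
      unfolding finite_dim_def by blast
  qed
  ultimately show thesis using that by blast
qed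

section \<open>Invariance\<close>

lemma adjoint_pair_comp:
  assumes "adjoint_pair K1 K2 T T'" "adjoint_pair K2 K3 U U'"
  shows "adjoint_pair K1 K3 (\<lambda>x. U (T x)) (\<lambda>y. T' (U' y))"
  using assms by (auto simp: adjoint_pair_def Pi_iff)

lemma adjoint_pair_scale:
  assumes "adjoint_pair K1 K2 T T'" "ips K1" "ips K2"
  shows "adjoint_pair K1 K2 (\<lambda>x. c *\<^sub>C T x) (\<lambda>y. cnj c *\<^sub>C T' y)"
proof -
  interpret K1: ips K1 by fact
  interpret K2: ips K2 by fact
  show ?thesis
    using assms(1) by (auto simp: adjoint_pair_def Pi_iff K2.form_scale_left K1.form_scale_right)
qed

locale invariant_setting = kernel X H K + group_action S X \<phi>
  for S :: "('s, 'm) monoid_scheme" and X :: "'x set" and \<phi> :: "'s \<Rightarrow> 'x \<Rightarrow> 'x"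
    and H :: "'h::complex_vector inner_space" and K :: "'x \<Rightarrow> 'x \<Rightarrow> 'h \<Rightarrow> 'h" +
  fixes \<alpha> :: "'s \<Rightarrow> 'x \<Rightarrow> complex"
  assumes nonzero: "\<lbrakk>a \<in> carrier S; x \<in> X\<rbrakk> \<Longrightarrow> \<alpha> a x \<noteq> 0"
    and cocycle: "\<lbrakk>a \<in> carrier S; b \<in> carrier S; x \<in> X; y \<in> X\<rbrakk> \<Longrightarrow>
           \<alpha> (a \<otimes>\<^bsub>S\<^esub> b) x * cnj (\<alpha> (a \<otimes>\<^bsub>S\<^esub> b) y) =
           \<alpha> a (\<phi> b x) * cnj (\<alpha> a (\<phi> b y)) * \<alpha> b x * cnj (\<alpha> b y)"
    and invariant: "invariant_kernel S X \<phi> \<alpha> H K"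
begin

lemma group_S: "group S"
  using group_hom by (simp add: group_hom_def)

lemma \<phi>_mem: "\<lbrakk>a \<in> carrier S; x \<in> X\<rbrakk> \<Longrightarrow> \<phi> a x \<in> X"
  using element_image by blast

text \<open>The invariance condition read at the point \<open>\<phi> a x\<close>, which the inverse
  of a returns to x; the action then appears symmetrically in both arguments.\<close>

lemma K_shift:
  assumes "a \<in> carrier S" "x \<in> X" "y \<in> X" "h \<in> carrier H"
  shows "K (\<phi> a x) (\<phi> a y) h = (cnj (\<alpha> a x) * \<alpha> a y) *\<^sub>C K x y h"
proof -
  have "\<phi> (inv\<^bsub>S\<^esub> a) (\<phi> a x) = x" using assms by (intro orbit_sym_aux) simp_all
  then show ?thesis
    using invariant assms \<phi>_mem[OF assms(1,2)] unfolding invariant_kernel_def by simp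
qed

text \<open>The condition on \<alpha> says \<open>c x * cnj (c y) = 1\<close> for the candidate
  values c at any two points. Comparing x and the chosen point y against the same y and cancelling
  gives \<open>c x = c y\<close>.\<close>

lemma sigma_eq:
  assumes a: "a \<in> carrier S" and b: "b \<in> carrier S" and x: "x \<in> X"
  shows "sigma S X \<phi> \<alpha> a b = inverse (\<alpha> a (\<phi> b x)) * inverse (\<alpha> b x) * \<alpha> (a \<otimes>\<^bsub>S\<^esub> b) x"
proof -
  define c where "c x = inverse (\<alpha> a (\<phi> b x)) * inverse (\<alpha> b x) * \<alpha> (a \<otimes>\<^bsub>S\<^esub> b) x" for x
  define y where "y = (SOME x. x \<in> X)"
  have y: "y \<in> X" unfolding y_def by (rule someI[of "\<lambda>x. x \<in> X", OF x])
  have c: "c x * cnj (c y) = 1" if "x \<in> X" for x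
    using cocycle[OF a b that y] nonzero a b that y \<phi>_mem by (simp add: c_def field_simps)
  have "cnj (c y) \<noteq> 0" using c[OF y] by auto
  then have "c x = c y" using c[OF x] c[OF y] by (metis mult_right_cancel)
  then show ?thesis by (simp add: sigma_def Let_def c_def y_def)
qed

text \<open>The factor \<open>inverse (\<alpha> a x)\<close> cancels the scalars of
  \<open>K_shift\<close>, so the products of the vectors are unchanged. Totality survives because
  \<open>\<phi> a\<close> maps X onto X.\<close>

lemma shifted_decomposition:
  assumes D: "decomposition X H K V L" and a: "a \<in> carrier S"
  shows "decomposition X H K (\<lambda>x h. inverse (\<alpha> a x) *\<^sub>C V (\<phi> a x) h) L"
proof -
  interpret D: decomposition X H K V L by fact
  interpret group S by (rule group_S)
  show ?thesis
  proof
    show "krein_space L" by (rule D.krein_L)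
    show "\<exists>W. adjoint_pair H L (\<lambda>h. inverse (\<alpha> a x) *\<^sub>C V (\<phi> a x) h) W" if x: "x \<in> X" for x
      using D.V_pair[OF \<phi>_mem[OF a x]] adjoint_pair_scale[OF _ H.ips_axioms D.L.ips_axioms] by blast
    show "form L (inverse (\<alpha> a y) *\<^sub>C V (\<phi> a y) h) (inverse (\<alpha> a x) *\<^sub>C V (\<phi> a x) k) = form H (K x y h) k"
      if *: "x \<in> X" "y \<in> X" "h \<in> carrier H" "k \<in> carrier H" for x y h k
    proof -
      have "inverse (cnj (\<alpha> a x)) * (inverse (\<alpha> a y) * (cnj (\<alpha> a x) * \<alpha> a y)) = 1"
        using nonzero[OF a *(1)] nonzero[OF a *(2)] by (simp add: field_simps)
      then show ?thesis
        using * by (simp add: D.L.form_scale_left D.L.form_scale_right D.V_mem \<phi>_mem[OF a] D.gram K_shift[OF a]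
          H.form_scale_left K_mem)
    qed
    show "z = 0" if z: "z \<in> carrier L"
      and 0: "\<And>x h. \<lbrakk>x \<in> X; h \<in> carrier H\<rbrakk> \<Longrightarrow> form L (inverse (\<alpha> a x) *\<^sub>C V (\<phi> a x) h) z = 0" for z
      using z
    proof (rule D.total)
      fix y h assume y: "y \<in> X" and h: "h \<in> carrier H"
      define x where "x = \<phi> (inv\<^bsub>S\<^esub> a) y"
      have inv_a: "inv\<^bsub>S\<^esub> a \<in> carrier S" using a by simp
      have x: "x \<in> X" unfolding x_def by (rule \<phi>_mem[OF inv_a y])
      have "\<phi> (inv\<^bsub>S\<^esub> (inv\<^bsub>S\<^esub> a)) x = y"
        unfolding x_def by (rule orbit_sym_aux[OF inv_a y refl])
      then have "\<phi> a x = y" using a by simp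
      then show "form L (V y h) z = 0"
        using 0[OF x h] nonzero[OF a x] y h z by (simp add: D.L.form_scale_left D.V_mem)
    qed
  qed
qed

text \<open>The rule for \<open>U a (U b z)\<close> compares two operators that have adjoints, so by
  \<open>adjoint_pair_eq\<close> it need only be verified on the vectors \<open>V x h\<close>. There
  it is the defining formula of \<sigma>, which \<open>sigma_eq\<close> provides at the very point x
  at hand.\<close>

lemma projectively_invariant_decomposition:
  assumes D: "decomposition X H K V L"
    and system: "orthonormal_system F (-1) (\<lambda>b. b) B"
    and nonneg: "\<And>f. f \<in> carrier F \<Longrightarrow> 0 \<le> Re (form F (reflection F (-1) (\<lambda>b. b) B f) f)"
  shows "projectively_invariant S X \<phi> \<alpha> H V L"
proof -
  interpret D: decomposition X H K V L by fact
  interpret group S by (rule group_S)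
  have "\<exists>\<Phi>. unitary_op L L \<Phi> \<and> (\<forall>x\<in>X. \<forall>h\<in>carrier H. inverse (\<alpha> a x) *\<^sub>C V (\<phi> a x) h = \<Phi> (V x h))"
    if "a \<in> carrier S" for a
    using decompositions_unitarily_equivalent[OF D shifted_decomposition[OF D that] system nonneg]
    by (simp add: unitarily_equivalent_def)
  then obtain U where U: "\<And>a. a \<in> carrier S \<Longrightarrow> unitary_op L L (U a)"
    and UV: "\<And>a x h. \<lbrakk>a \<in> carrier S; x \<in> X; h \<in> carrier H\<rbrakk> \<Longrightarrow> U a (V x h) = inverse (\<alpha> a x) *\<^sub>C V (\<phi> a x) h"
    by metis
  have bounded: "U a \<in> bounded_ops L L" if "a \<in> carrier S" for a
    using U[OF that] by (simp add: unitary_op_def)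
  have pair: "adjoint_pair L L (U a) (adj L L (U a))" if "a \<in> carrier S" for a
    by (rule bounded_ops_adjoint_pair[OF bounded[OF that]])
  have U_scale: "U a (c *\<^sub>C z) = c *\<^sub>C U a z" if "a \<in> carrier S" "z \<in> carrier L" for a c z
    using adjoint_pair_linear[OF pair D.krein_L D.krein_L] that by (auto simp: linear_op_def)
  have "U a (U b z) = sigma S X \<phi> \<alpha> a b *\<^sub>C U (a \<otimes>\<^bsub>S\<^esub> b) z"
    if a: "a \<in> carrier S" and b: "b \<in> carrier S" and z: "z \<in> carrier L" for a b z
  proof (rule D.adjoint_pair_eq[OF adjoint_pair_comp[OF pair[OF b] pair[OF a]]
        adjoint_pair_scale[OF pair[of "a \<otimes>\<^bsub>S\<^esub> b"] D.L.ips_axioms D.L.ips_axioms] D.krein_L _ z])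
    show "a \<otimes>\<^bsub>S\<^esub> b \<in> carrier S" using a b by simp
    fix x h assume x: "x \<in> X" and h: "h \<in> carrier H"
    have "U a (U b (V x h)) = (inverse (\<alpha> b x) * inverse (\<alpha> a (\<phi> b x))) *\<^sub>C V (\<phi> a (\<phi> b x)) h"
      using a b x h by (simp add: UV U_scale D.V_mem \<phi>_mem)
    moreover have "U (a \<otimes>\<^bsub>S\<^esub> b) (V x h) = inverse (\<alpha> (a \<otimes>\<^bsub>S\<^esub> b) x) *\<^sub>C V (\<phi> a (\<phi> b x)) h"
      using a b x h by (simp add: UV composition_rule)
    moreover have "sigma S X \<phi> \<alpha> a b * inverse (\<alpha> (a \<otimes>\<^bsub>S\<^esub> b) x) = inverse (\<alpha> b x) * inverse (\<alpha> a (\<phi> b x))"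
      using nonzero[of "a \<otimes>\<^bsub>S\<^esub> b" x] a b x by (simp add: sigma_eq[OF a b x])
    ultimately show "U a (U b (V x h)) = sigma S X \<phi> \<alpha> a b *\<^sub>C U (a \<otimes>\<^bsub>S\<^esub> b) (V x h)"
      by simp
  qed
  then have "projective_representation S X \<phi> \<alpha> L U"
    using bounded by (simp add: projective_representation_def)
  moreover have "V (\<phi> a x) h = \<alpha> a x *\<^sub>C U a (V x h)" if "a \<in> carrier S" "x \<in> X" "h \<in> carrier H" for a x h
    using nonzero[OF that(1,2)] by (simp add: UV[OF that])
  ultimately show ?thesis
    unfolding projectively_invariant_def by blast
qed

end

theorem theorem3p4:
  fixes S :: "('s, 'm) monoid_scheme"
    and X :: "'x set"
    and \<phi> :: "'s \<Rightarrow> 'x \<Rightarrow> 'x"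
    and \<alpha> :: "'s \<Rightarrow> 'x \<Rightarrow> complex"
    and H :: "'h::complex_vector inner_space"
    and K :: "'x \<Rightarrow> 'x \<Rightarrow> 'h \<Rightarrow> 'h"
  assumes "group_action S X \<phi>"
    and "\<And>a x. \<lbrakk>a \<in> carrier S; x \<in> X\<rbrakk> \<Longrightarrow> \<alpha> a x \<noteq> 0"
    and "\<And>a b x y. \<lbrakk>a \<in> carrier S; b \<in> carrier S; x \<in> X; y \<in> X\<rbrakk> \<Longrightarrow>
           \<alpha> (a \<otimes>\<^bsub>S\<^esub> b) x * cnj (\<alpha> (a \<otimes>\<^bsub>S\<^esub> b) y) =
           \<alpha> a (\<phi> b x) * cnj (\<alpha> a (\<phi> b y)) * \<alpha> b x * cnj (\<alpha> b y)"
    and "\<And>a x. \<lbrakk>a \<in> carrier S; x \<in> X\<rbrakk> \<Longrightarrow> \<alpha> (a \<otimes>\<^bsub>S\<^esub> inv\<^bsub>S\<^esub> a) x = 1"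
    and "krein_space H"
    and "hermitian_kernel X H K"
    and "invariant_kernel S X \<phi> \<alpha> H K"
    and "\<exists>\<kappa>. has_negative_squares X H K \<kappa>"
  shows "(\<exists>(L :: ('x \<Rightarrow> 'h) inner_space) V.
            pontryagin_space L \<and>
            kolmogorov_decomposition X H K V L \<and>
            projectively_invariant S X \<phi> \<alpha> H V L) \<and>
         (\<forall>(L1 :: 'k1::complex_vector inner_space) V1 (L2 :: 'k2::complex_vector inner_space) V2.
            kolmogorov_decomposition X H K V1 L1 \<and>
            projectively_invariant S X \<phi> \<alpha> H V1 L1 \<and>
            kolmogorov_decomposition X H K V2 L2 \<and>
            projectively_invariant S X \<phi> \<alpha> H V2 L2 \<longrightarrow>
            unitarily_equivalent X H V1 L1 V2 L2)"
proof -
  interpret kernel X H K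
    using assms(5,6) by unfold_locales
  interpret group_action S X \<phi> by (rule assms(1))
  interpret invariant_setting S X \<phi> H K \<alpha>
    using assms(2,3,7) by unfold_locales
  obtain \<kappa> where "has_negative_squares X H K \<kappa>" using assms(8) by blast
  \<comment> \<open>\<open>B\<close> depends on K alone, so one choice serves the construction, the
    comparison of decompositions and the operators \<open>U a\<close>.\<close>
  then obtain B where B: "orthonormal_system F (-1) (\<lambda>b. b) B"
    "\<And>f. f \<in> carrier F \<Longrightarrow> 0 \<le> Re (form F (reflection F (-1) (\<lambda>b. b) B f) f)"
    using nonneg_system by blast
  obtain L where L: "pontryagin_space L" "decomposition X H K (kernel_map X K) L"
    using pontryagin_decomposition[OF B] by blast
  then have "projectively_invariant S X \<phi> \<alpha> H (kernel_map X K) L"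
    using projectively_invariant_decomposition[OF _ B] by blast
  then show ?thesis
    using L decompositions_unitarily_equivalent[OF _ _ B] by (auto simp: kolmogorov_decomposition_iff)
qed

end
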